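(* Let $X$ be a complete geodesic vector field on a Riemannian $3$-manifold $M$. Assume that $\nabla_X R_X=0$ and that for every $p\in M$ one of the following holds: \begin{enumerate} \item[(i)] $\max_{v\in X_p^\perp\setminus\{0\}}K(v,X_p)>0$, or \item[(ii)] $\max_{v\in X_p^\perp\setminus\{0\}}K(v,X_p)=0$ and $\operatorname{rank}\beta_p=2$, \end{enumerate} where $K(\cdot,\cdot)$ denotes the sectional curvature of the plane spanned by the two vectors. Then $X$ induces a contact structure.
   Context: A vector field $X$ on a Riemannian manifold $(M,g)$ is called geodesic if it has unit length and $\nabla_X X=0$, where $\nabla$ is the Levi-Civita connection. "Complete" means that the flow of $X$ is defined for all times. $X^\perp$ is the distribution orthogonal to $X$. The bundle map $\beta\colon X^\perp\to X^\perp$ is $\beta_p(v)=\nabla_v X$. The Jacobi tensor is the self-adjoint bundle map $R_X\colon X^\perp\to X^\perp$, $R_X(v)=R(v,X)X$, where $R$ is the Riemann curvature tensor with sign convention such that $\langle R(v,X)X,v\rangle=K(v,X)$ for unit $v\in X^\perp$; $\nabla_X R_X=0$ means that $R_X$ is parallel along the flow lines of $X$, i.e. $\nabla_X(R_X(V))=R_X(\nabla_X V)$ for sections $V$ of $X^\perp$. $X$ induces a contact structure if the plane field $X^\perp=\ker\alpha$, $\alpha:=g(X,\cdot)$, is a contact structure, i.e. $\alpha\wedge d\alpha\neq 0$ everywhere. *)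

theory Defs
  imports "HOL-Analysis.Analysis" "HOL-Library.Function_Algebras"
begin

section \<open>Smooth maps between Euclidean spaces\<close>

text \<open>
  \<open>Ck_on k S f\<close> is the usual notion of a \<open>k\<close> times continuously differentiable map
  only for open \<open>S\<close>; it is used for open \<open>S\<close> throughout.
\<close>

primrec Ck_on :: "nat \<Rightarrow> 'a::euclidean_space set \<Rightarrow> ('a \<Rightarrow> 'b::real_normed_vector) \<Rightarrow> bool" where
  "Ck_on 0 S f \<longleftrightarrow> continuous_on S f"
| "Ck_on (Suc k) S f \<longleftrightarrow>
     f differentiable_on S \<and> (\<forall>v. Ck_on k S (\<lambda>x. frechet_derivative f (at x) v))"

definition smooth_on :: "'a::euclidean_space set \<Rightarrow> ('a \<Rightarrow> 'b::real_normed_vector) \<Rightarrow> bool" where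
  "smooth_on S f \<longleftrightarrow> (\<forall>k. Ck_on k S f)"

definition pderiv_at :: "'n::finite \<Rightarrow> (real^'n \<Rightarrow> real) \<Rightarrow> real^'n \<Rightarrow> real" where
  "pderiv_at i f x = frechet_derivative f (at x) (axis i 1)"


section \<open>Levi-Civita connection and curvature of a metric in coordinates\<close>

text \<open>
  Here \<open>G\<close> is the matrix of a metric with respect to the coordinate vector fields.
  \<open>christoffel G x i j k\<close> has the lower indices \<open>i\<close>, \<open>j\<close> and the upper index \<open>k\<close>:
  the covariant derivative of the \<open>j\<close>-th coordinate field in the direction of the
  \<open>i\<close>-th one is the sum over \<open>k\<close> of \<open>christoffel G x i j k\<close> times the \<open>k\<close>-th one.
\<close>

definition christoffel ::
    "(real^'n \<Rightarrow> real^'n^'n) \<Rightarrow> real^'n \<Rightarrow> 'n \<Rightarrow> 'n \<Rightarrow> 'n::finite \<Rightarrow> real" where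
  "christoffel G x i j k = 1/2 * (\<Sum>l\<in>UNIV. matrix_inv (G x) $ k $ l *
     (pderiv_at i (\<lambda>y. G y $ j $ l) x + pderiv_at j (\<lambda>y. G y $ i $ l) x
        - pderiv_at l (\<lambda>y. G y $ i $ j) x))"

text \<open>
  The Christoffel symbols are the coefficients of the unique connection that is torsion-free
  (symmetric coefficients) and compatible with the metric.
\<close>

lemma christoffel_levi_civita:
  fixes G :: "real^'n::finite \<Rightarrow> real^'n^'n" and \<Gamma> :: "'n \<Rightarrow> 'n \<Rightarrow> 'n \<Rightarrow> real"
  assumes S: "open S" "x \<in> S"
    and sym: "\<And>y. y \<in> S \<Longrightarrow> transpose (G y) = G y"
    and diff: "\<And>i j. (\<lambda>y. G y $ i $ j) differentiable at x"
    and inv: "invertible (G x)"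
  shows "(\<forall>i j k. \<Gamma> i j k = \<Gamma> j i k) \<and>
         (\<forall>i j k. pderiv_at k (\<lambda>y. G y $ i $ j) x
            = (\<Sum>l\<in>UNIV. \<Gamma> k i l * G x $ l $ j) + (\<Sum>l\<in>UNIV. \<Gamma> k j l * G x $ i $ l))
     \<longleftrightarrow> \<Gamma> = christoffel G x"
proof -
  define D where "D k i j = pderiv_at k (\<lambda>y. G y $ i $ j) x" for k i j
  have Gs: "G y $ i $ j = G y $ j $ i" if "y \<in> S" for y i j
    using sym[OF that] by (metis transpose_def vec_lambda_beta)
  have Ds: "D k i j = D k j i" for k i j
    unfolding D_def pderiv_at_def
    by (rule fun_cong[OF frechet_derivative_transform_within_open[OF diff S Gs]])
  have I: "(\<Sum>k\<in>UNIV. G x $ m $ k * matrix_inv (G x) $ k $ l) = (if m = l then 1 else 0)"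
      "(\<Sum>k\<in>UNIV. matrix_inv (G x) $ m $ k * G x $ k $ l) = (if m = l then 1 else 0)" for m l
  proof -
    have "G x ** matrix_inv (G x) = mat 1" "matrix_inv (G x) ** G x = mat 1"
      using someI_ex[OF inv[unfolded invertible_def]] unfolding matrix_inv_def by simp_all
    then have "(G x ** matrix_inv (G x)) $ m $ l = mat 1 $ m $ l"
       "(matrix_inv (G x) ** G x) $ m $ l = mat 1 $ m $ l" by simp_all
    then show "(\<Sum>k\<in>UNIV. G x $ m $ k * matrix_inv (G x) $ k $ l) = (if m = l then 1 else 0)"
      "(\<Sum>k\<in>UNIV. matrix_inv (G x) $ m $ k * G x $ k $ l) = (if m = l then 1 else 0)"
      by (simp_all add: matrix_matrix_mult_def mat_def)
  qed
  define E where "E i j l = 1/2 * (D i j l + D j i l - D l i j)" for i j l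
  have chr: "christoffel G x i j k = (\<Sum>l\<in>UNIV. matrix_inv (G x) $ k $ l * E i j l)" for i j k
    unfolding christoffel_def E_def D_def by (simp add: sum_distrib_left mult.left_commute)
  have low: "(\<Sum>k\<in>UNIV. christoffel G x i j k * G x $ k $ m) = E i j m" for i j m
  proof -
    have "(\<Sum>k\<in>UNIV. christoffel G x i j k * G x $ k $ m)
        = (\<Sum>k\<in>UNIV. \<Sum>l\<in>UNIV. (G x $ m $ k * matrix_inv (G x) $ k $ l) * E i j l)"
      unfolding chr Gs[OF S(2), of _ m] by (simp add: sum_distrib_left sum_distrib_right mult_ac)
    also have "\<dots> = (\<Sum>l\<in>UNIV. (\<Sum>k\<in>UNIV. G x $ m $ k * matrix_inv (G x) $ k $ l) * E i j l)"
      by (subst sum.swap) (simp add: sum_distrib_right)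
    also have "\<dots> = E i j m"
      unfolding I by (simp add: if_distrib[of "\<lambda>a. a * _"] sum.delta' cong: if_cong)
    finally show ?thesis .
  qed
  have fin: "\<Gamma> = christoffel G x \<longleftrightarrow> (\<forall>i j m. (\<Sum>k\<in>UNIV. \<Gamma> i j k * G x $ k $ m) = E i j m)"
  proof
    assume L: "\<forall>i j m. (\<Sum>k\<in>UNIV. \<Gamma> i j k * G x $ k $ m) = E i j m"
    have "\<Gamma> i j n = christoffel G x i j n" for i j n
    proof -
      have "christoffel G x i j n
          = (\<Sum>l\<in>UNIV. \<Sum>k\<in>UNIV. \<Gamma> i j k * (matrix_inv (G x) $ n $ l * G x $ l $ k))"
        unfolding chr L[rule_format, symmetric]
        by (subst Gs[OF S(2)]) (simp add: sum_distrib_left mult_ac)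
      also have "\<dots> = (\<Sum>k\<in>UNIV. \<Gamma> i j k * (\<Sum>l\<in>UNIV. matrix_inv (G x) $ n $ l * G x $ l $ k))"
        by (subst sum.swap) (simp add: sum_distrib_left)
      also have "\<dots> = \<Gamma> i j n"
        unfolding I by (simp add: if_distrib[of "\<lambda>a. _ * a"] sum.delta' cong: if_cong)
      finally show ?thesis by simp
    qed
    then show "\<Gamma> = christoffel G x" by (intro ext)
  qed (simp add: low)
  define L where "L i j m = (\<Sum>k\<in>UNIV. \<Gamma> i j k * G x $ k $ m)" for i j m
  have L2: "(\<Sum>l\<in>UNIV. \<Gamma> k j l * G x $ i $ l) = L k j i" for i j k
    unfolding L_def by (subst Gs[OF S(2)]) simp
  show ?thesis
  proof
    assume "\<Gamma> = christoffel G x"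
    then have LE: "L i j m = E i j m" for i j m using fin[THEN iffD1, OF \<open>\<Gamma> = christoffel G x\<close>]
      unfolding L_def by simp
    have "\<Gamma> i j k = \<Gamma> j i k" for i j k
      unfolding \<open>\<Gamma> = christoffel G x\<close> chr E_def using Ds by (simp add: add.commute)
    moreover have "D k i j = L k i j + L k j i" for i j k
      unfolding LE E_def using Ds[of k i j] Ds[of i k j] Ds[of j k i] by (simp add: field_simps)
    ultimately show "(\<forall>i j k. \<Gamma> i j k = \<Gamma> j i k) \<and>
         (\<forall>i j k. pderiv_at k (\<lambda>y. G y $ i $ j) x
            = (\<Sum>l\<in>UNIV. \<Gamma> k i l * G x $ l $ j) + (\<Sum>l\<in>UNIV. \<Gamma> k j l * G x $ i $ l))"
      unfolding L2 L_def[symmetric] D_def[symmetric] by blast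
  next
    assume A: "(\<forall>i j k. \<Gamma> i j k = \<Gamma> j i k) \<and>
         (\<forall>i j k. pderiv_at k (\<lambda>y. G y $ i $ j) x
            = (\<Sum>l\<in>UNIV. \<Gamma> k i l * G x $ l $ j) + (\<Sum>l\<in>UNIV. \<Gamma> k j l * G x $ i $ l))"
    then have Dk: "D k i j = L k i j + L k j i" for i j k
      unfolding L2 by (simp add: L_def D_def)
    have Ls: "L i j m = L j i m" for i j m using A unfolding L_def by simp
    have "L i j m = E i j m" for i j m
      unfolding E_def Dk using Ls[of i j m] Ls[of m i j] Ls[of m j i] by (simp add: field_simps)
    then show "\<Gamma> = christoffel G x" unfolding fin L_def by simp
  qed
qed

text \<open>Covariant derivative at \<open>x\<close> of the field with components \<open>W\<close> in the direction \<open>u\<close>.\<close>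

definition covd ::
    "(real^'n \<Rightarrow> real^'n^'n) \<Rightarrow> real^'n::finite \<Rightarrow> (real^'n \<Rightarrow> real^'n) \<Rightarrow> real^'n \<Rightarrow> real^'n" where
  "covd G u W x = frechet_derivative W (at x) u +
     (\<chi> k. \<Sum>i\<in>UNIV. \<Sum>j\<in>UNIV. christoffel G x i j k * u $ i * W x $ j)"

text \<open>
  \<open>R(u,v)w\<close> is computed with the extensions of \<open>u\<close>, \<open>v\<close>, \<open>w\<close> to fields with constant
  components; these commute, so that the term with the Lie bracket of \<open>u\<close> and \<open>v\<close> vanishes.
\<close>

definition curvature_coord ::
    "(real^'n \<Rightarrow> real^'n^'n) \<Rightarrow> real^'n \<Rightarrow> real^'n \<Rightarrow> real^'n \<Rightarrow> real^'n \<Rightarrow> real^'n::finite" where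
  "curvature_coord G x u v w =
     covd G u (covd G v (\<lambda>_. w)) x - covd G v (covd G u (\<lambda>_. w)) x"


section \<open>Smooth manifolds and tangent vectors\<close>

text \<open>
  A manifold is a whole type with a Hausdorff, second countable topology, together with a smooth
  atlas, not necessarily a maximal one.
\<close>

type_synonym ('a, 'n) chart = "'a set \<times> ('a \<Rightarrow> real^'n)"

abbreviation dom :: "('a, 'n) chart \<Rightarrow> 'a set" where "dom \<equiv> fst"
abbreviation crd :: "('a, 'n) chart \<Rightarrow> 'a \<Rightarrow> real^'n" where "crd \<equiv> snd"

definition par :: "('a, 'n) chart \<Rightarrow> real^'n \<Rightarrow> 'a" where
  "par c = inv_into (dom c) (crd c)"

definition smooth_atlas ::
    "('a::{t2_space,second_countable_topology}, 'n::finite) chart set \<Rightarrow> bool" where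
  "smooth_atlas A \<longleftrightarrow>
     (\<forall>c\<in>A. open (dom c) \<and> open (crd c ` dom c) \<and>
        homeomorphism (dom c) (crd c ` dom c) (crd c) (par c)) \<and>
     (\<Union>c\<in>A. dom c) = UNIV \<and>
     (\<forall>c\<in>A. \<forall>d\<in>A. smooth_on (crd c ` (dom c \<inter> dom d)) (crd d \<circ> par c))"

definition charts_at :: "('a, 'n) chart set \<Rightarrow> 'a \<Rightarrow> ('a, 'n) chart set" where
  "charts_at A p = {c \<in> A. p \<in> dom c}"

text \<open>
  A tangent vector at \<open>p\<close> is the family of its components in all charts around \<open>p\<close>, which
  transform by the differential of the coordinate change. Families are 0 on all other charts, so
  that the pointwise operations make the tangent space a 3-dimensional vector space (for charts
  in dimension 3).
\<close>

type_synonym ('a, 'n) tvec = "('a, 'n) chart \<Rightarrow> real^'n"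

instantiation "fun" :: (type, real_vector) real_vector
begin

definition "scaleR_fun r f = (\<lambda>x. r *\<^sub>R f x)"

instance
  by standard (auto simp: scaleR_fun_def fun_eq_iff scaleR_add_right scaleR_add_left)

end

definition chart_change :: "('a, 'n::finite) chart \<Rightarrow> ('a, 'n) chart \<Rightarrow> 'a \<Rightarrow> real^'n \<Rightarrow> real^'n" where
  "chart_change c d p = frechet_derivative (crd d \<circ> par c) (at (crd c p))"

definition tangent_space :: "('a, 'n::finite) chart set \<Rightarrow> 'a \<Rightarrow> ('a, 'n) tvec set" where
  "tangent_space A p =
     {v. (\<forall>c\<in>charts_at A p. \<forall>d\<in>charts_at A p. v d = chart_change c d p (v c)) \<and>
         (\<forall>c. c \<notin> charts_at A p \<longrightarrow> v c = 0)}"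

definition coord_vec :: "('a, 'n::finite) chart set \<Rightarrow> ('a, 'n) chart \<Rightarrow> 'n \<Rightarrow> 'a \<Rightarrow> ('a, 'n) tvec" where
  "coord_vec A c i p = (\<lambda>d. if d \<in> charts_at A p then chart_change c d p (axis i 1) else 0)"

definition vector_field_on ::
    "('a, 'n::finite) chart set \<Rightarrow> 'a set \<Rightarrow> ('a \<Rightarrow> ('a, 'n) tvec) \<Rightarrow> bool" where
  "vector_field_on A U V \<longleftrightarrow>
     (\<forall>p\<in>U. V p \<in> tangent_space A p) \<and>
     (\<forall>c\<in>A. smooth_on (crd c ` (dom c \<inter> U)) (\<lambda>x. V (par c x) c))"


section \<open>Riemannian metrics\<close>

type_synonym ('a, 'n) metric = "'a \<Rightarrow> ('a, 'n) tvec \<Rightarrow> ('a, 'n) tvec \<Rightarrow> real"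

definition metric_matrix ::
    "('a, 'n::finite) chart set \<Rightarrow> ('a, 'n) metric \<Rightarrow> ('a, 'n) chart \<Rightarrow> real^'n \<Rightarrow> real^'n^'n" where
  "metric_matrix A g c x =
     (\<chi> i j. g (par c x) (coord_vec A c i (par c x)) (coord_vec A c j (par c x)))"

definition riemannian_metric :: "('a, 'n::finite) chart set \<Rightarrow> ('a, 'n) metric \<Rightarrow> bool" where
  "riemannian_metric A g \<longleftrightarrow>
     (\<forall>p. \<forall>u\<in>tangent_space A p. \<forall>v\<in>tangent_space A p.
        g p u v = g p v u \<and>
        (\<forall>w\<in>tangent_space A p. \<forall>a b. g p (a *\<^sub>R u + b *\<^sub>R v) w = a * g p u w + b * g p v w) \<and>
        (u \<noteq> 0 \<longrightarrow> g p u u > 0)) \<and>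
     (\<forall>c\<in>A. smooth_on (crd c ` dom c) (metric_matrix A g c))"

text \<open>\<open>nabla A g p v Y\<close> is the covariant derivative of the vector field \<open>Y\<close> along \<open>v\<close> at \<open>p\<close>.\<close>

definition nabla :: "('a, 'n::finite) chart set \<Rightarrow> ('a, 'n) metric \<Rightarrow> 'a \<Rightarrow> ('a, 'n) tvec \<Rightarrow>
    ('a \<Rightarrow> ('a, 'n) tvec) \<Rightarrow> ('a, 'n) tvec" where
  "nabla A g p v Y = (\<lambda>c. if c \<in> charts_at A p
     then covd (metric_matrix A g c) (v c) (\<lambda>x. Y (par c x) c) (crd c p) else 0)"

definition curvature :: "('a, 'n::finite) chart set \<Rightarrow> ('a, 'n) metric \<Rightarrow> 'a \<Rightarrow>
    ('a, 'n) tvec \<Rightarrow> ('a, 'n) tvec \<Rightarrow> ('a, 'n) tvec \<Rightarrow> ('a, 'n) tvec" where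
  "curvature A g p u v w = (\<lambda>c. if c \<in> charts_at A p
     then curvature_coord (metric_matrix A g c) (crd c p) (u c) (v c) (w c) else 0)"

definition sectional_curvature :: "('a, 'n::finite) chart set \<Rightarrow> ('a, 'n) metric \<Rightarrow> 'a \<Rightarrow>
    ('a, 'n) tvec \<Rightarrow> ('a, 'n) tvec \<Rightarrow> real" where
  "sectional_curvature A g p u v =
     g p (curvature A g p u v v) u / (g p u u * g p v v - (g p u v)\<^sup>2)"


section \<open>Geodesic vector fields\<close>

definition geodesic_field ::
    "('a, 'n::finite) chart set \<Rightarrow> ('a, 'n) metric \<Rightarrow> ('a \<Rightarrow> ('a, 'n) tvec) \<Rightarrow> bool" where
  "geodesic_field A g X \<longleftrightarrow> vector_field_on A UNIV X \<and>
     (\<forall>p. g p (X p) (X p) = 1 \<and> nabla A g p (X p) X = 0)"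

definition integral_curve :: "('a::topological_space, 'n::finite) chart set \<Rightarrow>
    ('a \<Rightarrow> ('a, 'n) tvec) \<Rightarrow> (real \<Rightarrow> 'a) \<Rightarrow> bool" where
  "integral_curve A X \<gamma> \<longleftrightarrow> continuous_on UNIV \<gamma> \<and>
     (\<forall>t. \<forall>c\<in>charts_at A (\<gamma> t).
        ((\<lambda>s. crd c (\<gamma> s)) has_vector_derivative X (\<gamma> t) c) (at t))"

definition complete_field ::
    "('a::topological_space, 'n::finite) chart set \<Rightarrow> ('a \<Rightarrow> ('a, 'n) tvec) \<Rightarrow> bool" where
  "complete_field A X \<longleftrightarrow> (\<forall>p. \<exists>\<gamma>. integral_curve A X \<gamma> \<and> \<gamma> 0 = p)"

definition orth :: "('a, 'n::finite) chart set \<Rightarrow> ('a, 'n) metric \<Rightarrow> ('a \<Rightarrow> ('a, 'n) tvec) \<Rightarrow>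
    'a \<Rightarrow> ('a, 'n) tvec set" where
  "orth A g X p = {v \<in> tangent_space A p. g p (X p) v = 0}"

definition beta :: "('a, 'n::finite) chart set \<Rightarrow> ('a, 'n) metric \<Rightarrow> ('a \<Rightarrow> ('a, 'n) tvec) \<Rightarrow>
    'a \<Rightarrow> ('a, 'n) tvec \<Rightarrow> ('a, 'n) tvec" where
  "beta A g X p v = nabla A g p v X"

definition rank_beta :: "('a, 'n::finite) chart set \<Rightarrow> ('a, 'n) metric \<Rightarrow> ('a \<Rightarrow> ('a, 'n) tvec) \<Rightarrow>
    'a \<Rightarrow> nat" where
  "rank_beta A g X p = dim (beta A g X p ` orth A g X p)"

definition jacobi_tensor :: "('a, 'n::finite) chart set \<Rightarrow> ('a, 'n) metric \<Rightarrow> ('a \<Rightarrow> ('a, 'n) tvec) \<Rightarrow>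
    'a \<Rightarrow> ('a, 'n) tvec \<Rightarrow> ('a, 'n) tvec" where
  "jacobi_tensor A g X p v = curvature A g p v (X p) (X p)"

text \<open>The sections of the orthogonal distribution are local ones, over arbitrary open sets.\<close>

definition jacobi_parallel :: "('a::topological_space, 'n::finite) chart set \<Rightarrow> ('a, 'n) metric \<Rightarrow>
    ('a \<Rightarrow> ('a, 'n) tvec) \<Rightarrow> bool" where
  "jacobi_parallel A g X \<longleftrightarrow>
     (\<forall>U V. open U \<and> vector_field_on A U V \<and> (\<forall>p\<in>U. V p \<in> orth A g X p) \<longrightarrow>
        (\<forall>p\<in>U. nabla A g p (X p) (\<lambda>q. jacobi_tensor A g X q (V q))
           = jacobi_tensor A g X p (nabla A g p (X p) V)))"


section \<open>Contact forms in dimension 3\<close>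

type_synonym ('a, 'n) one_form = "'a \<Rightarrow> ('a, 'n) tvec \<Rightarrow> real"

text \<open>
  The exterior derivative of \<open>\<alpha>\<close> at \<open>p\<close>, computed in the chart \<open>c\<close>: its value on the
  \<open>i\<close>-th and \<open>j\<close>-th coordinate vectors is the \<open>i\<close>-th partial derivative of the \<open>j\<close>-th
  component of \<open>\<alpha>\<close> minus the \<open>j\<close>-th partial derivative of the \<open>i\<close>-th one.
\<close>

definition ext_deriv :: "('a, 'n::finite) chart set \<Rightarrow> ('a, 'n) chart \<Rightarrow> ('a, 'n) one_form \<Rightarrow>
    'a \<Rightarrow> ('a, 'n) tvec \<Rightarrow> ('a, 'n) tvec \<Rightarrow> real" where
  "ext_deriv A c \<alpha> p u v = (\<Sum>i\<in>UNIV. \<Sum>j\<in>UNIV.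
     (pderiv_at i (\<lambda>x. \<alpha> (par c x) (coord_vec A c j (par c x))) (crd c p)
       - pderiv_at j (\<lambda>x. \<alpha> (par c x) (coord_vec A c i (par c x))) (crd c p)) * u c $ i * v c $ j)"

definition wedge_ext_deriv :: "('a, 'n::finite) chart set \<Rightarrow> ('a, 'n) chart \<Rightarrow> ('a, 'n) one_form \<Rightarrow>
    'a \<Rightarrow> ('a, 'n) tvec \<Rightarrow> ('a, 'n) tvec \<Rightarrow> ('a, 'n) tvec \<Rightarrow> real" where
  "wedge_ext_deriv A c \<alpha> p u v w =
     \<alpha> p u * ext_deriv A c \<alpha> p v w + \<alpha> p v * ext_deriv A c \<alpha> p w u
       + \<alpha> p w * ext_deriv A c \<alpha> p u v"

definition contact_form :: "('a, 3) chart set \<Rightarrow> ('a, 3) one_form \<Rightarrow> bool" where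
  "contact_form A \<alpha> \<longleftrightarrow> (\<forall>p. \<forall>c\<in>charts_at A p.
     \<exists>u\<in>tangent_space A p. \<exists>v\<in>tangent_space A p. \<exists>w\<in>tangent_space A p.
       wedge_ext_deriv A c \<alpha> p u v w \<noteq> 0)"

definition induces_contact_structure ::
    "('a, 3) chart set \<Rightarrow> ('a, 3) metric \<Rightarrow> ('a \<Rightarrow> ('a, 3) tvec) \<Rightarrow> bool" where
  "induces_contact_structure A g X \<longleftrightarrow> contact_form A (\<lambda>p v. g p (X p) v)"

end

theory Submission
  imports Defs
begin

text \<open>
  Put \<open>\<alpha> = g(X, -)\<close>, \<open>\<beta> = \<nabla>X\<close> and \<open>R = R\<^sub>X\<close>. The form \<open>d\<alpha>\<close> is twice the skew part of \<open>\<beta>\<close>; it is closed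
  and vanishes on \<open>X\<close>, hence is invariant under the flow. So if \<open>\<alpha> \<and> d\<alpha>\<close> vanishes at a point, then
  \<open>\<beta>\<close> is self-adjoint along the whole flow line through it, where it solves the Riccati equation
  \<open>\<beta>' + \<beta>\<^sup>2 + R = 0\<close> with \<open>R\<close> parallel. Let \<open>k\<close> be the largest eigenvalue of \<open>R\<close> on the complement of
  \<open>X\<close>, that is the maximal curvature, and \<open>e\<close> a parallel unit eigenvector. Then \<open>h = \<langle>\<beta> e, e\<rangle>\<close> satisfies
  \<open>h' = - \<bar>\<beta> e\<bar>\<^sup>2 - k \<le> - h\<^sup>2 - k\<close> on all of \<open>\<real>\<close>. For \<open>k \<ge> 0\<close> this forces \<open>h = 0\<close>, hence \<open>k = 0\<close> and
  \<open>\<beta> e = 0\<close>, so that neither (i) nor (ii) holds.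

  Parallel transport is avoided by expressing \<open>h\<close> through the traces of \<open>\<beta>\<close>, \<open>\<beta> R\<close>, \<open>R\<close> and \<open>R\<^sup>2\<close>,
  which do not depend on the chart, and whose derivatives along the flow only involve traces.
\<close>

section \<open>Calculus of smooth maps\<close>

text \<open>A flow line need not stay in one chart, so no frame is transported along it. Eigenframes
  are chosen at each time separately, with no continuity in time; only traces are differentiated,
  and for these a chart around the current point suffices. Ordering the eigenvalues lets the traces
  of R and R^2 determine both of them, so both are constant along the flow. In a chart \<beta> and R
  act on all of R^3; both kill X and take values orthogonal to X, so their traces are those on the
  complement of X. The chart formulas must first be shown to be tensorial. Uniqueness of the
  Levi-Civita connection gives the transformation of the Christoffel symbols. Curvature enters only
  through R, and the Riccati equation expresses R by covariant derivatives; smoothness,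
  transformation law and (with d\<alpha> invariant) symmetry of R are obtained that way, without the
  general curvature identities. Completeness is used in both time directions: forward blow-up
  excludes h < 0, backward blow-up excludes h > 0.\<close>

lemma frechet_derivative_cong_on:
  assumes "open S" "x \<in> S" "\<And>y. y \<in> S \<Longrightarrow> f y = g y"
  shows "frechet_derivative f (at x) = frechet_derivative g (at x)"
proof -
  have "(f has_derivative D) (at x) \<longleftrightarrow> (g has_derivative D) (at x)" for D
    using has_derivative_transform_within_open[OF _ assms(1,2), of f D UNIV g]
      has_derivative_transform_within_open[OF _ assms(1,2), of g D UNIV f] assms(3) by auto
  then show ?thesis unfolding frechet_derivative_def by simp
qed

lemma Ck_on_subset: "Ck_on k S f \<Longrightarrow> T \<subseteq> S \<Longrightarrow> Ck_on k T f"
  by (induction k arbitrary: f) (auto intro: continuous_on_subset differentiable_on_subset)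

lemma Ck_on_cong_imp:
  assumes "open S" "\<And>x. x \<in> S \<Longrightarrow> f x = g x" "Ck_on k S f"
  shows "Ck_on k S g"
  using assms(2,3)
proof (induction k arbitrary: f g)
  case 0
  then show ?case by (simp cong: continuous_on_cong)
next
  case (Suc k)
  have d: "f differentiable at x" if "x \<in> S" for x
    using Suc.prems(2) that assms(1) by (auto simp: differentiable_on_eq_differentiable_at)
  have "g differentiable at x" if "x \<in> S" for x
  proof -
    obtain D where "(f has_derivative D) (at x)" using d[OF \<open>x \<in> S\<close>] unfolding differentiable_def by auto
    from has_derivative_transform_within_open[OF this assms(1) that Suc.prems(1)]
    show ?thesis unfolding differentiable_def by auto
  qed
  moreover have fd: "frechet_derivative f (at x) = frechet_derivative g (at x)" if "x \<in> S" for x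
    using frechet_derivative_cong_on[OF assms(1) that Suc.prems(1)] .
  have "Ck_on k S (\<lambda>x. frechet_derivative g (at x) v)" for v
  proof (rule Suc.IH)
    show "Ck_on k S (\<lambda>x. frechet_derivative f (at x) v)" using Suc.prems(2) by simp
  qed (simp add: fd)
  ultimately show ?case
    using assms(1) by (simp add: differentiable_on_eq_differentiable_at)
qed

lemma Ck_on_const: "Ck_on k S (\<lambda>x. c)"
  by (induction k arbitrary: c) auto

context
  fixes S :: "'a::euclidean_space set"
  assumes S: "open S"
begin

lemma Ck_on_Suc_diff: "Ck_on (Suc k) S f \<Longrightarrow> x \<in> S \<Longrightarrow> f differentiable at x"
  using S by (auto simp: differentiable_on_eq_differentiable_at)

lemma Ck_on_Suc_has_derivative:
  "Ck_on (Suc k) S f \<Longrightarrow> x \<in> S \<Longrightarrow> (f has_derivative frechet_derivative f (at x)) (at x)"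
  using Ck_on_Suc_diff frechet_derivative_works by blast

text \<open>Allows an explicit derivative formula \<open>D\<close> in place of
  \<open>frechet_derivative\<close>, so that induction hypotheses can be applied to the summands and
  factors of \<open>D\<close>.\<close>

lemma Ck_on_SucI:
  assumes "\<And>x. x \<in> S \<Longrightarrow> (f has_derivative D x) (at x)" "\<And>v. Ck_on k S (\<lambda>x. D x v)"
  shows "Ck_on (Suc k) S f"
proof -
  have "frechet_derivative f (at x) = D x" if "x \<in> S" for x
    using frechet_derivative_at[OF assms(1)[OF that]] by simp
  then have "Ck_on k S (\<lambda>x. frechet_derivative f (at x) v)" for v
    by (intro Ck_on_cong_imp[OF S _ assms(2)[of v]]) simp
  moreover have "f differentiable_on S"
    using assms(1) S by (auto simp: differentiable_on_eq_differentiable_at differentiable_def)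
  ultimately show ?thesis by simp
qed

lemma Ck_on_Suc_imp: "Ck_on (Suc k) S f \<Longrightarrow> Ck_on k S f"
  by (induction k arbitrary: f) (auto simp: differentiable_imp_continuous_on)

lemma Ck_on_bounded_linear:
  assumes "bounded_linear L" "Ck_on k S f"
  shows "Ck_on k S (\<lambda>x. L (f x))"
  using assms(2)
proof (induction k arbitrary: f)
  case 0
  then show ?case using assms(1) by (simp add: bounded_linear.continuous_on)
next
  case (Suc k)
  show ?case
    by (rule Ck_on_SucI, rule bounded_linear.has_derivative[OF assms(1)],
        rule Ck_on_Suc_has_derivative[OF Suc.prems], assumption)
       (use Suc in auto)
qed

lemma Ck_on_add:
  assumes "Ck_on k S f" "Ck_on k S g"
  shows "Ck_on k S (\<lambda>x. f x + g x)"
  using assms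
proof (induction k arbitrary: f g)
  case 0
  then show ?case by (simp add: continuous_on_add)
next
  case (Suc k)
  show ?case
    by (rule Ck_on_SucI, rule has_derivative_add[OF Ck_on_Suc_has_derivative[OF Suc.prems(1)] Ck_on_Suc_has_derivative[OF Suc.prems(2)]])
       (use Suc in auto)
qed

lemma Ck_on_sum:
  assumes "\<And>i. i \<in> I \<Longrightarrow> Ck_on k S (f i)"
  shows "Ck_on k S (\<lambda>x. \<Sum>i\<in>I. f i x)"
  using assms
  by (induction I rule: infinite_finite_induct) (auto simp: Ck_on_const Ck_on_add)

lemma Ck_on_bilinear:
  assumes B: "bounded_bilinear m" and "Ck_on k S f" "Ck_on k S g"
  shows "Ck_on k S (\<lambda>x. m (f x) (g x))"
  using assms(2,3)
proof (induction k arbitrary: f g)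
  case 0
  then show ?case using bounded_bilinear.continuous_on[OF B] by simp
next
  case (Suc k)
  note D = Ck_on_Suc_has_derivative[OF Suc.prems(1)] Ck_on_Suc_has_derivative[OF Suc.prems(2)]
    and C = Ck_on_Suc_imp[OF Suc.prems(1)] Ck_on_Suc_imp[OF Suc.prems(2)]
  show ?case
    by (rule Ck_on_SucI, rule bounded_bilinear.FDERIV[OF B D], assumption, assumption)
       (intro Ck_on_add Suc.IH C; use Suc.prems in simp)
qed

end

lemma frechet_derivative_Basis_sum:
  fixes f :: "'a::euclidean_space \<Rightarrow> 'b::real_normed_vector"
  assumes "f differentiable at x"
  shows "frechet_derivative f (at x) v = (\<Sum>b\<in>Basis. (v \<bullet> b) *\<^sub>R frechet_derivative f (at x) b)"
proof -
  interpret linear "frechet_derivative f (at x)"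
    by (rule linear_frechet_derivative[OF assms])
  show ?thesis
    by (subst euclidean_representation[of v, symmetric]) (simp only: sum scale)
qed

text \<open>The chain rule puts the inner map both into the base point and into the direction.
  Expanding the direction in \<open>Basis\<close> leaves sums of products in which the outer
  derivative has a fixed direction \<open>b\<close>, and these are covered by the induction
  hypothesis.\<close>

lemma Ck_on_compose:
  fixes S :: "'a::euclidean_space set" and T :: "'b::euclidean_space set"
    and f :: "'b \<Rightarrow> 'c::real_normed_vector"
  assumes S: "open S" and T: "open T" and "Ck_on k T f" "Ck_on k S g" and "\<And>x. x \<in> S \<Longrightarrow> g x \<in> T"
  shows "Ck_on k S (\<lambda>x. f (g x))"
  using assms(3-5)
proof (induction k arbitrary: f g)
  case 0
  then show ?case using continuous_on_compose2[of T f S g] by auto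
next
  case (Suc k)
  note df = Ck_on_Suc_diff[OF T Suc.prems(1)]
  show ?case
  proof (rule Ck_on_SucI[OF S])
    fix x assume "x \<in> S"
    show "((\<lambda>x. f (g x)) has_derivative (\<lambda>v. frechet_derivative f (at (g x)) (frechet_derivative g (at x) v))) (at x)"
      by (rule has_derivative_compose[OF Ck_on_Suc_has_derivative[OF S Suc.prems(2)] Ck_on_Suc_has_derivative[OF T Suc.prems(1)]])
         (use \<open>x \<in> S\<close> Suc.prems(3) in auto)
  next
    fix v
    have 1: "Ck_on k S (\<lambda>x. frechet_derivative f (at (g x)) b)" for b
      by (rule Suc.IH) (use Suc.prems in \<open>auto intro: Ck_on_Suc_imp[OF S]\<close>)
    have "Ck_on k S (\<lambda>x. \<Sum>b\<in>Basis. (frechet_derivative g (at x) v \<bullet> b) *\<^sub>R frechet_derivative f (at (g x)) b)"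
      by (intro Ck_on_sum[OF S] Ck_on_bilinear[OF S bounded_bilinear_scaleR] 1
            Ck_on_bounded_linear[OF S bounded_linear_inner_left]) (use Suc.prems in auto)
    then show "Ck_on k S (\<lambda>x. frechet_derivative f (at (g x)) (frechet_derivative g (at x) v))"
      by (rule Ck_on_cong_imp[OF S, rotated])
         (use df Suc.prems(3) in \<open>auto simp: frechet_derivative_Basis_sum[symmetric]\<close>)
  qed
qed

lemma smooth_on_subset: "smooth_on S f \<Longrightarrow> T \<subseteq> S \<Longrightarrow> smooth_on T f"
  unfolding smooth_on_def using Ck_on_subset by blast

lemma smooth_on_cong:
  assumes "open S" "\<And>x. x \<in> S \<Longrightarrow> f x = g x"
  shows "smooth_on S f \<longleftrightarrow> smooth_on S g"
  using Ck_on_cong_imp[OF assms(1), of f g] Ck_on_cong_imp[OF assms(1), of g f] assms(2)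
  unfolding smooth_on_def by auto

lemma smooth_on_const: "smooth_on S (\<lambda>x. c)"
  by (simp add: smooth_on_def Ck_on_const)

lemma smooth_on_compose:
  assumes "open S" "open T" "smooth_on T f" "smooth_on S g" "\<And>x. x \<in> S \<Longrightarrow> g x \<in> T"
  shows "smooth_on S (\<lambda>x. f (g x))"
  using assms Ck_on_compose unfolding smooth_on_def by blast

context
  fixes S :: "'a::euclidean_space set"
  assumes S: "open S"
begin

lemma smooth_on_bounded_linear:
  "bounded_linear L \<Longrightarrow> smooth_on S f \<Longrightarrow> smooth_on S (\<lambda>x. L (f x))"
  by (simp add: smooth_on_def Ck_on_bounded_linear[OF S])

lemma smooth_on_ident: "smooth_on S (\<lambda>x. x)"
  unfolding smooth_on_def
proof
  fix k show "Ck_on k S (\<lambda>x. x)"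
  proof (cases k)
    case (Suc n)
    show ?thesis unfolding Suc
      by (rule Ck_on_SucI[OF S has_derivative_ident]) (rule Ck_on_const)
  qed simp
qed

lemma smooth_on_add: "smooth_on S f \<Longrightarrow> smooth_on S g \<Longrightarrow> smooth_on S (\<lambda>x. f x + g x)"
  by (simp add: smooth_on_def Ck_on_add[OF S])

lemma smooth_on_sum: "(\<And>i. i \<in> I \<Longrightarrow> smooth_on S (f i)) \<Longrightarrow> smooth_on S (\<lambda>x. \<Sum>i\<in>I. f i x)"
  by (simp add: smooth_on_def Ck_on_sum[OF S])

lemma smooth_on_bilinear:
  "bounded_bilinear m \<Longrightarrow> smooth_on S f \<Longrightarrow> smooth_on S g \<Longrightarrow> smooth_on S (\<lambda>x. m (f x) (g x))"
  by (simp add: smooth_on_def Ck_on_bilinear[OF S])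

lemmas smooth_on_scaleR = smooth_on_bilinear[OF bounded_bilinear_scaleR]
  and smooth_on_inner = smooth_on_bilinear[OF bounded_bilinear_inner]

lemma smooth_on_mult:
  fixes f :: "'a \<Rightarrow> real"
  shows "smooth_on S f \<Longrightarrow> smooth_on S g \<Longrightarrow> smooth_on S (\<lambda>x. f x * g x)"
  using smooth_on_bilinear[OF bounded_bilinear_mult] .

lemma smooth_on_minus: "smooth_on S f \<Longrightarrow> smooth_on S (\<lambda>x. - f x)"
  using smooth_on_bounded_linear[OF bounded_linear_minus[OF bounded_linear_ident]] .

lemma smooth_on_diff: "smooth_on S f \<Longrightarrow> smooth_on S g \<Longrightarrow> smooth_on S (\<lambda>x. f x - g x)"
  using smooth_on_add[OF _ smooth_on_minus] by fastforce

lemma smooth_on_imp_differentiable: "smooth_on S f \<Longrightarrow> x \<in> S \<Longrightarrow> f differentiable at x"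
  using Ck_on_Suc_diff[OF S] unfolding smooth_on_def by blast

lemma smooth_on_has_derivative:
  "smooth_on S f \<Longrightarrow> x \<in> S \<Longrightarrow> (f has_derivative frechet_derivative f (at x)) (at x)"
  using smooth_on_imp_differentiable frechet_derivative_works by blast

lemma smooth_on_imp_continuous_on: "smooth_on S f \<Longrightarrow> continuous_on S f"
  unfolding smooth_on_def using Ck_on.simps(1) by blast

lemma smooth_on_frechet_derivative:
  "smooth_on S f \<Longrightarrow> smooth_on S (\<lambda>x. frechet_derivative f (at x) v)"
  unfolding smooth_on_def using Ck_on.simps(2) by blast

lemma smooth_on_vec_nth: "smooth_on S f \<Longrightarrow> smooth_on S (\<lambda>x. f x $ i)"
  using smooth_on_bounded_linear[OF bounded_linear_vec_nth] .

lemma smooth_on_vec_lambda: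
  fixes f :: "'n::finite \<Rightarrow> 'a \<Rightarrow> 'b::euclidean_space"
  assumes "\<And>i. smooth_on S (f i)"
  shows "smooth_on S (\<lambda>x. \<chi> i. f i x)"
proof -
  have "(\<lambda>x. \<chi> i. f i x) = (\<lambda>x. \<Sum>i\<in>UNIV. axis i (f i x))"
    by (auto simp: fun_eq_iff vec_eq_iff axis_def if_distrib cong: if_cong)
  moreover have "bounded_linear (\<lambda>y::'b. axis (i::'n) y)" for i
    by (intro linear_conv_bounded_linear[THEN iffD1] linearI) (auto simp: vec_eq_iff axis_def)
  ultimately show ?thesis
    using assms by (auto intro!: smooth_on_sum smooth_on_bounded_linear[of "\<lambda>y. axis _ y"])
qed

end

lemma smooth_on_frechet_derivative_app:
  fixes S :: "'a::euclidean_space set" and T :: "'b::euclidean_space set"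
  assumes "open S" "open T" "smooth_on T f" "smooth_on S g" "smooth_on S h" "\<And>x. x \<in> S \<Longrightarrow> g x \<in> T"
  shows "smooth_on S (\<lambda>x. frechet_derivative f (at (g x)) (h x))"
proof -
  have "smooth_on S (\<lambda>x. frechet_derivative f (at (g x)) b)" for b
    by (rule smooth_on_compose[OF assms(1,2) smooth_on_frechet_derivative[OF assms(2)] assms(4)])
       (use assms in auto)
  then have "smooth_on S (\<lambda>x. \<Sum>b\<in>Basis. (h x \<bullet> b) *\<^sub>R frechet_derivative f (at (g x)) b)"
    by (intro smooth_on_sum smooth_on_scaleR smooth_on_bounded_linear[OF _ bounded_linear_inner_left] assms)
  then show ?thesis
    by (subst smooth_on_cong[OF assms(1) frechet_derivative_Basis_sum])
       (use assms smooth_on_imp_differentiable[OF assms(2,3)] in auto)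
qed

section \<open>Smoothness of matrix products and inverses\<close>

lemma bounded_bilinear_matrix_matrix_mult:
  "bounded_bilinear ((**) :: real^'n^'m \<Rightarrow> real^'p^'n \<Rightarrow> real^'p^'m)"
  unfolding bilinear_conv_bounded_bilinear[symmetric] bilinear_def
  by (auto intro!: linearI simp: matrix_matrix_mult_def vec_eq_iff algebra_simps sum.distrib sum_distrib_left)

lemma bounded_bilinear_matrix_vector_mult:
  "bounded_bilinear ((*v) :: real^'n^'m \<Rightarrow> real^'n \<Rightarrow> real^'m)"
  unfolding bilinear_conv_bounded_bilinear[symmetric] bilinear_def
  by (auto intro!: linearI simp: matrix_vector_mult_def vec_eq_iff algebra_simps sum.distrib sum_distrib_left)

lemma matrix_inv_inverse:
  fixes M :: "real^'n^'n"
  assumes "invertible M"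
  shows "M ** matrix_inv M = mat 1" "matrix_inv M ** M = mat 1"
  using someI_ex[OF assms[unfolded invertible_def]] unfolding matrix_inv_def by simp_all

text \<open>Cramer's rule for the columns of the inverse. It reduces smoothness of the inverse to
  that of determinants and of a reciprocal.\<close>

lemma matrix_inv_entry:
  fixes M :: "real^'n^'n"
  assumes "invertible M"
  shows "matrix_inv M $ k $ l
    = det (\<chi> i j. if j = k then (if i = l then 1 else 0) else M $ i $ j) * inverse (det M)"
proof -
  have "det M \<noteq> 0" using assms invertible_det_nz by blast
  moreover have "M *v (matrix_inv M *v axis l 1) = axis l 1"
    by (simp add: matrix_vector_mul_assoc matrix_inv_inverse[OF assms])
  ultimately have "matrix_inv M *v axis l 1
      = (\<chi> k. det (\<chi> i j. if j = k then axis l 1 $ i else M $ i $ j) / det M)"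
    using cramer by blast
  then have "column l (matrix_inv M) $ k
      = det (\<chi> i j. if j = k then axis l 1 $ i else M $ i $ j) / det M"
    by (simp add: matrix_vector_mult_basis)
  moreover have "axis l (1::real) $ i = (if i = l then 1 else 0)" for i
    by (simp add: axis_def)
  ultimately show ?thesis
    by (simp only: column_def vec_lambda_beta divide_inverse)
qed

lemma Ck_on_inverse:
  fixes f :: "'a::euclidean_space \<Rightarrow> real"
  assumes S: "open S" and "Ck_on k S f" and nz: "\<And>x. x \<in> S \<Longrightarrow> f x \<noteq> 0"
  shows "Ck_on k S (\<lambda>x. inverse (f x))"
  using assms(2)
proof (induction k)
  case 0
  then show ?case using nz by (auto intro: continuous_on_inverse)
next
  case (Suc k)
  have "Ck_on k S (\<lambda>x. (- 1) * (inverse (f x) * frechet_derivative f (at x) v * inverse (f x)))" for v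
    by (intro Ck_on_bilinear[OF S bounded_bilinear_mult] Suc.IH Ck_on_const)
       (use Suc.prems Ck_on_Suc_imp[OF S] in auto)
  then show ?case
    by (intro Ck_on_SucI[OF S, where D = "\<lambda>x v. - (inverse (f x) * frechet_derivative f (at x) v * inverse (f x))"]
          Deriv.has_derivative_inverse[OF nz Ck_on_Suc_has_derivative[OF S Suc.prems]]) auto
qed

lemma smooth_on_inverse:
  fixes f :: "'a::euclidean_space \<Rightarrow> real"
  shows "open S \<Longrightarrow> smooth_on S f \<Longrightarrow> (\<And>x. x \<in> S \<Longrightarrow> f x \<noteq> 0) \<Longrightarrow> smooth_on S (\<lambda>x. inverse (f x))"
  unfolding smooth_on_def using Ck_on_inverse by blast

lemma smooth_on_prod:
  fixes f :: "'i \<Rightarrow> 'a::euclidean_space \<Rightarrow> real"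
  assumes "open S" "\<And>i. i \<in> I \<Longrightarrow> smooth_on S (f i)"
  shows "smooth_on S (\<lambda>x. \<Prod>i\<in>I. f i x)"
  using assms
  by (induction I rule: infinite_finite_induct) (auto simp: smooth_on_const intro: smooth_on_mult)

lemma smooth_on_det:
  fixes M :: "'a::euclidean_space \<Rightarrow> real^'n^'n"
  assumes "open S" "\<And>i j. smooth_on S (\<lambda>x. M x $ i $ j)"
  shows "smooth_on S (\<lambda>x. det (M x))"
  unfolding det_def using assms
  by (intro smooth_on_sum smooth_on_mult smooth_on_prod smooth_on_const) auto

lemma smooth_on_matrix_inv_entry:
  fixes M :: "'a::euclidean_space \<Rightarrow> real^'n^'n"
  assumes S: "open S" and M: "smooth_on S M" and inv: "\<And>x. x \<in> S \<Longrightarrow> invertible (M x)"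
  shows "smooth_on S (\<lambda>x. matrix_inv (M x) $ k $ l)"
proof -
  note e = smooth_on_vec_nth[OF S smooth_on_vec_nth[OF S M]]
  have "smooth_on S (\<lambda>x. det (\<chi> i j. if j = k then (if i = l then 1 else 0) else M x $ i $ j) * inverse (det (M x)))"
  proof (intro smooth_on_mult smooth_on_inverse smooth_on_det S e)
    show "smooth_on S (\<lambda>x. (\<chi> i j. if j = k then (if i = l then 1 else 0) else M x $ i $ j) $ i $ j)" for i j
      using e by (cases "j = k") (auto simp: smooth_on_const)
  qed (use inv invertible_det_nz in auto)
  then show ?thesis
    by (subst smooth_on_cong[OF S matrix_inv_entry]) (use inv in auto)
qed

text \<open>The mean value theorem is applied twice: in direction \<open>u\<close> to the increment
  of \<open>f\<close> along \<open>h *\<^sub>R v\<close>, then in direction \<open>v\<close> to the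
  derivative of \<open>f\<close> along \<open>u\<close>.\<close>

lemma mixed_difference_quotient:
  fixes f :: "'a::real_normed_vector \<Rightarrow> real"
  assumes h: "h > 0"
    and f: "\<And>s t. 0 \<le> s \<Longrightarrow> s \<le> h \<Longrightarrow> 0 \<le> t \<Longrightarrow> t \<le> h \<Longrightarrow>
      (f has_derivative D (x + s *\<^sub>R u + t *\<^sub>R v)) (at (x + s *\<^sub>R u + t *\<^sub>R v))"
    and D: "\<And>s t. 0 \<le> s \<Longrightarrow> s \<le> h \<Longrightarrow> 0 \<le> t \<Longrightarrow> t \<le> h \<Longrightarrow>
      ((\<lambda>y. D y u) has_derivative D2 (x + s *\<^sub>R u + t *\<^sub>R v)) (at (x + s *\<^sub>R u + t *\<^sub>R v))"
  obtains s t where "0 < s" "s < h" "0 < t" "t < h"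
    "f (x + h *\<^sub>R u + h *\<^sub>R v) - f (x + h *\<^sub>R u) - f (x + h *\<^sub>R v) + f x = h * h * D2 (x + s *\<^sub>R u + t *\<^sub>R v) v"
proof -
  define \<phi> where "\<phi> s = f (x + s *\<^sub>R u + h *\<^sub>R v) - f (x + s *\<^sub>R u + 0 *\<^sub>R v)" for s
  have d\<phi>: "(\<phi> has_derivative (\<lambda>r. r * (D (x + s *\<^sub>R u + h *\<^sub>R v) u - D (x + s *\<^sub>R u + 0 *\<^sub>R v) u))) (at s)"
    if "0 \<le> s" "s \<le> h" for s
  proof -
    have "((\<lambda>s. f (x + s *\<^sub>R u + t *\<^sub>R v)) has_derivative (\<lambda>r. D (x + s *\<^sub>R u + t *\<^sub>R v) (r *\<^sub>R u))) (at s)"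
      if "0 \<le> t" "t \<le> h" for t
      by (rule has_derivative_compose[where g = f and f = "\<lambda>s. x + s *\<^sub>R u + t *\<^sub>R v"])
         (use f \<open>0 \<le> s\<close> \<open>s \<le> h\<close> that in \<open>auto intro!: derivative_eq_intros\<close>)
    from has_derivative_diff[OF this[of h] this[of 0]] h show ?thesis
      using bounded_linear.linear[OF has_derivative_bounded_linear[OF f[OF that, of 0]]]
        bounded_linear.linear[OF has_derivative_bounded_linear[OF f[OF that, of h]]]
      unfolding \<phi>_def by (simp add: linear_cmul right_diff_distrib)
  qed
  have "\<exists>s\<in>{0<..<h}. \<phi> h - \<phi> 0
      = (h - 0) * (D (x + s *\<^sub>R u + h *\<^sub>R v) u - D (x + s *\<^sub>R u + 0 *\<^sub>R v) u)"
    by (rule mvt_simple[OF h]) (rule has_derivative_at_withinI[OF d\<phi>])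
  then obtain s where s: "0 < s" "s < h"
    "\<phi> h - \<phi> 0 = (h - 0) * (D (x + s *\<^sub>R u + h *\<^sub>R v) u - D (x + s *\<^sub>R u + 0 *\<^sub>R v) u)"
    by auto
  have dD: "((\<lambda>t. D (x + s *\<^sub>R u + t *\<^sub>R v) u) has_derivative (\<lambda>r. r * D2 (x + s *\<^sub>R u + t *\<^sub>R v) v)) (at t)"
    if "0 \<le> t" "t \<le> h" for t
  proof -
    have "((\<lambda>t. D (x + s *\<^sub>R u + t *\<^sub>R v) u) has_derivative (\<lambda>r. D2 (x + s *\<^sub>R u + t *\<^sub>R v) (r *\<^sub>R v))) (at t)"
      by (rule has_derivative_compose[where g = "\<lambda>y. D y u" and f = "\<lambda>t. x + s *\<^sub>R u + t *\<^sub>R v"])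
         (use D s that in \<open>auto intro!: derivative_eq_intros\<close>)
    then show ?thesis
      using bounded_linear.linear[OF has_derivative_bounded_linear[OF D[of s t]]] s that
      by (simp add: linear_cmul)
  qed
  have "\<exists>t\<in>{0<..<h}. D (x + s *\<^sub>R u + h *\<^sub>R v) u - D (x + s *\<^sub>R u + 0 *\<^sub>R v) u
      = (h - 0) * D2 (x + s *\<^sub>R u + t *\<^sub>R v) v"
    by (rule mvt_simple[OF h]) (rule has_derivative_at_withinI[OF dD])
  then obtain t where t: "0 < t" "t < h"
    "D (x + s *\<^sub>R u + h *\<^sub>R v) u - D (x + s *\<^sub>R u + 0 *\<^sub>R v) u = (h - 0) * D2 (x + s *\<^sub>R u + t *\<^sub>R v) v"
    by auto
  show ?thesis
    by (rule that[OF s(1,2) t(1,2)]) (use s(3) t(3) in \<open>simp add: \<phi>_def\<close>)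
qed

text \<open>
  Both mixed derivatives are the limit of the second difference quotient, taken in either order
  of the two increments.
\<close>

lemma symmetric_second_frechet_derivative_real:
  fixes f :: "'a::euclidean_space \<Rightarrow> real"
  assumes S: "open S" "x \<in> S" and f: "smooth_on S f"
  shows "frechet_derivative (\<lambda>y. frechet_derivative f (at y) u) (at x) v
       = frechet_derivative (\<lambda>y. frechet_derivative f (at y) v) (at x) u"
proof (rule ccontr)
  define D where "D w y = frechet_derivative f (at y) w" for w y
  define E where "E u v y = frechet_derivative (D u) (at y) v" for u v y
  assume "\<not> ?thesis"
  then have ne: "E u v x \<noteq> E v u x" unfolding E_def D_def .
  \<comment> \<open>Half the gap: two equal numbers cannot lie within \<open>e\<close> of these two
    distinct values.\<close>
  define e where "e = \<bar>E u v x - E v u x\<bar> / 2"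
  have e: "e > 0" using ne unfolding e_def by simp
  have sD: "smooth_on S (D w)" for w
    unfolding D_def by (rule smooth_on_frechet_derivative[OF S(1) f])
  have "continuous_on S (E u v)" "continuous_on S (E v u)"
    unfolding E_def by (intro smooth_on_imp_continuous_on[OF S(1)] smooth_on_frechet_derivative[OF S(1)] sD)+
  then have "\<forall>\<^sub>F y in at x. dist (E u v y) (E u v x) < e" "\<forall>\<^sub>F y in at x. dist (E v u y) (E v u x) < e"
    using S e by (auto simp: continuous_on_eq_continuous_at isCont_def intro: tendstoD)
  then have "\<forall>\<^sub>F y in nhds x. dist (E u v y) (E u v x) < e \<and> dist (E v u y) (E v u x) < e \<and> y \<in> S"
    using e S by (auto simp: eventually_at_filter intro!: eventually_conj eventually_nhds_in_open elim: eventually_mono)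
  then obtain d where d: "d > 0" "\<And>y. dist y x < d \<Longrightarrow> dist (E u v y) (E u v x) < e \<and> dist (E v u y) (E v u x) < e \<and> y \<in> S"
    unfolding eventually_nhds_metric by blast
  \<comment> \<open>The parallelogram with sides \<open>h *\<^sub>R u\<close> and
    \<open>h *\<^sub>R v\<close> then stays in the ball of radius \<open>d\<close>; the summand 1
    keeps the denominator positive.\<close>
  define h where "h = d / (2 * (norm u + norm v + 1))"
  have h: "h > 0" unfolding h_def using d(1) by (intro divide_pos_pos) (auto intro: add_nonneg_pos)
  have near: "dist (x + s *\<^sub>R u + t *\<^sub>R v) x < d" if "0 \<le> s" "s \<le> h" "0 \<le> t" "t \<le> h" for s t
  proof -
    have "dist (x + s *\<^sub>R u + t *\<^sub>R v) x \<le> s * norm u + t * norm v"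
      using norm_triangle_ineq[of "s *\<^sub>R u" "t *\<^sub>R v"] that by (simp add: dist_norm algebra_simps)
    also have "\<dots> \<le> h * norm u + h * norm v"
      using that by (intro add_mono mult_right_mono) auto
    also have "\<dots> < h * (2 * (norm u + norm v + 1))"
      using h by (simp add: algebra_simps add_nonneg_pos)
    also have "\<dots> = d"
      using add_nonneg_pos[OF add_nonneg_nonneg[OF norm_ge_zero norm_ge_zero] zero_less_one, of u v]
      unfolding h_def by simp
    finally show ?thesis .
  qed
  have DE: "(D w has_derivative (\<lambda>v. E w v y)) (at y)" "(f has_derivative (\<lambda>w. D w y)) (at y)"
    if "dist y x < d" for w y
    using smooth_on_has_derivative[OF S(1) sD] smooth_on_has_derivative[OF S(1) f] d(2)[OF that]
    unfolding D_def E_def by auto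
  let ?\<Delta> = "f (x + h *\<^sub>R u + h *\<^sub>R v) - f (x + h *\<^sub>R u) - f (x + h *\<^sub>R v) + f x"
  have ex: "\<exists>s t. 0 < s \<and> s < h \<and> 0 < t \<and> t < h \<and>
      f (x + h *\<^sub>R u + h *\<^sub>R v) - f (x + h *\<^sub>R u) - f (x + h *\<^sub>R v) + f x = h * h * E u v (x + s *\<^sub>R u + t *\<^sub>R v)"
    if near: "\<And>s t. 0 \<le> s \<Longrightarrow> s \<le> h \<Longrightarrow> 0 \<le> t \<Longrightarrow> t \<le> h \<Longrightarrow> dist (x + s *\<^sub>R u + t *\<^sub>R v) x < d" for u v
    by (rule mixed_difference_quotient[OF h, where f = f and D = "\<lambda>y w. D w y" and x = x and u = u and v = v
          and ?D2.0 = "\<lambda>y v. E u v y"])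
       (use DE near in blast)+
  obtain s t where st: "0 < s" "s < h" "0 < t" "t < h"
    "f (x + h *\<^sub>R u + h *\<^sub>R v) - f (x + h *\<^sub>R u) - f (x + h *\<^sub>R v) + f x = h * h * E u v (x + s *\<^sub>R u + t *\<^sub>R v)"
    using ex[of u v] near by auto
  have c: "x + t *\<^sub>R v + s *\<^sub>R u = x + s *\<^sub>R u + t *\<^sub>R v" for s t by simp
  obtain s' t' where st': "0 < s'" "s' < h" "0 < t'" "t' < h"
    "f (x + h *\<^sub>R v + h *\<^sub>R u) - f (x + h *\<^sub>R v) - f (x + h *\<^sub>R u) + f x = h * h * E v u (x + t' *\<^sub>R v + s' *\<^sub>R u)"
    using ex[of v u] near unfolding c by blast
  have "E u v (x + s *\<^sub>R u + t *\<^sub>R v) = E v u (x + s' *\<^sub>R u + t' *\<^sub>R v)"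
  proof -
    have "h * h * E u v (x + s *\<^sub>R u + t *\<^sub>R v) = h * h * E v u (x + s' *\<^sub>R u + t' *\<^sub>R v)"
      using st(5) st'(5) unfolding c by linarith
    then show ?thesis using h by simp
  qed
  moreover have "\<bar>E u v (x + s *\<^sub>R u + t *\<^sub>R v) - E u v x\<bar> < e" "\<bar>E v u (x + s' *\<^sub>R u + t' *\<^sub>R v) - E v u x\<bar> < e"
    using d(2)[OF near] st st' by (auto simp: dist_real_def)
  ultimately show False unfolding e_def by (smt (verit) field_sum_of_halves)
qed

lemma frechet_derivative_bounded_linear:
  assumes "bounded_linear L" "f differentiable at x"
  shows "frechet_derivative (\<lambda>y. L (f y)) (at x) v = L (frechet_derivative f (at x) v)"
  using frechet_derivative_at[OF bounded_linear.has_derivative[OF assms(1)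
    assms(2)[unfolded frechet_derivative_works]]] by metis

lemma symmetric_second_frechet_derivative:
  fixes f :: "'a::euclidean_space \<Rightarrow> 'b::euclidean_space"
  assumes S: "open S" "x \<in> S" and f: "smooth_on S f"
  shows "frechet_derivative (\<lambda>y. frechet_derivative f (at y) u) (at x) v
       = frechet_derivative (\<lambda>y. frechet_derivative f (at y) v) (at x) u"
proof (rule euclidean_eqI)
  fix b :: 'b
  note bl = bounded_linear_inner_left[of b]
  have "frechet_derivative (\<lambda>y. frechet_derivative f (at y) u) (at x) v \<bullet> b
     = frechet_derivative (\<lambda>y. frechet_derivative (\<lambda>y. f y \<bullet> b) (at y) u) (at x) v" for u v
  proof -
    have "frechet_derivative (\<lambda>y. frechet_derivative f (at y) u \<bullet> b) (at x)
        = frechet_derivative (\<lambda>y. frechet_derivative (\<lambda>y. f y \<bullet> b) (at y) u) (at x)"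
      by (rule frechet_derivative_cong_on[OF S])
         (rule frechet_derivative_bounded_linear[OF bl smooth_on_imp_differentiable[OF S(1) f], symmetric])
    then show ?thesis
      using frechet_derivative_bounded_linear[OF bl smooth_on_imp_differentiable[OF S(1) smooth_on_frechet_derivative[OF S(1) f] S(2)]]
      by metis
  qed
  then show "frechet_derivative (\<lambda>y. frechet_derivative f (at y) u) (at x) v \<bullet> b
       = frechet_derivative (\<lambda>y. frechet_derivative f (at y) v) (at x) u \<bullet> b"
    using symmetric_second_frechet_derivative_real[OF S smooth_on_bounded_linear[OF S(1) bl f]] by metis
qed

section \<open>The Levi-Civita connection in a chart\<close>

text \<open>A product rule for \<open>F y (h y)\<close> that asks for differentiability of
  \<open>F\<close> on fixed vectors only, not in an operator norm: \<open>h y\<close> is expanded in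
  \<open>Basis\<close>. It serves for families such as the differential of a map, the Christoffel
  form or the shape operator.\<close>

lemma has_derivative_bounded_linear_family:
  fixes F :: "'a::real_normed_vector \<Rightarrow> 'b::euclidean_space \<Rightarrow> 'c::real_normed_vector"
  assumes lin: "\<forall>y\<in>S. linear (F y)" and S: "open S" "x \<in> S"
    and F: "\<And>b. b \<in> Basis \<Longrightarrow> ((\<lambda>y. F y b) has_derivative (\<lambda>w. D w b)) (at x)"
    and h: "(h has_derivative h') (at x)"
  shows "((\<lambda>y. F y (h y)) has_derivative (\<lambda>w. (\<Sum>b\<in>Basis. (h x \<bullet> b) *\<^sub>R D w b) + F x (h' w))) (at x)"
proof -
  have e: "F y a = (\<Sum>b\<in>Basis. (a \<bullet> b) *\<^sub>R F y b)" if "y \<in> S" for y a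
  proof -
    interpret linear "F y" using lin that by blast
    show ?thesis
      by (subst euclidean_representation[of a, symmetric]) (simp only: sum scale)
  qed
  have "((\<lambda>y. \<Sum>b\<in>Basis. (h y \<bullet> b) *\<^sub>R F y b) has_derivative
      (\<lambda>w. \<Sum>b\<in>Basis. (h x \<bullet> b) *\<^sub>R D w b + (h' w \<bullet> b) *\<^sub>R F x b)) (at x)"
    by (intro has_derivative_sum has_derivative_scaleR F has_derivative_inner_left h)
  then have "((\<lambda>y. F y (h y)) has_derivative
      (\<lambda>w. \<Sum>b\<in>Basis. (h x \<bullet> b) *\<^sub>R D w b + (h' w \<bullet> b) *\<^sub>R F x b)) (at x)"
    by (rule has_derivative_transform_within_open[OF _ S]) (rule e[symmetric])
  then show ?thesis
    by (simp add: sum.distrib e[OF S(2), symmetric])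
qed

lemma frechet_derivative_bounded_linear_family:
  fixes F :: "'a::real_normed_vector \<Rightarrow> 'b::euclidean_space \<Rightarrow> 'c::real_normed_vector"
  assumes lin: "\<forall>y\<in>S. linear (F y)" and S: "open S" "x \<in> S"
    and F: "\<And>b. (\<lambda>y. F y b) differentiable at x"
    and h: "h differentiable at x"
  shows "(\<lambda>y. F y (h y)) differentiable at x"
    and "frechet_derivative (\<lambda>y. F y (h y)) (at x) w
      = frechet_derivative (\<lambda>y. F y (h x)) (at x) w + F x (frechet_derivative h (at x) w)"
proof -
  let ?D = "\<lambda>w b. frechet_derivative (\<lambda>y. F y b) (at x) w"
  have F': "((\<lambda>y. F y b) has_derivative (\<lambda>w. ?D w b)) (at x)" for b
    using F frechet_derivative_works by blast
  have 1: "((\<lambda>y. F y (h y)) has_derivative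
      (\<lambda>w. (\<Sum>b\<in>Basis. (h x \<bullet> b) *\<^sub>R ?D w b) + F x (frechet_derivative h (at x) w))) (at x)"
    by (rule has_derivative_bounded_linear_family[OF lin S F']) (use h frechet_derivative_works in auto)
  have "((\<lambda>y. F y (h x)) has_derivative
      (\<lambda>w. (\<Sum>b\<in>Basis. (h x \<bullet> b) *\<^sub>R ?D w b) + F x 0)) (at x)"
    by (rule has_derivative_bounded_linear_family[OF lin S F']) auto
  then have "?D w (h x) = (\<Sum>b\<in>Basis. (h x \<bullet> b) *\<^sub>R ?D w b)"
    using frechet_derivative_at[symmetric] linear_0[OF bspec[OF lin S(2)]] by fastforce
  with frechet_derivative_at[OF 1, symmetric] show "frechet_derivative (\<lambda>y. F y (h y)) (at x) w
      = frechet_derivative (\<lambda>y. F y (h x)) (at x) w + F x (frechet_derivative h (at x) w)"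
    by simp
  show "(\<lambda>y. F y (h y)) differentiable at x" using 1 unfolding differentiable_def by blast
qed

lemma frechet_derivative_add:
  "f differentiable at x \<Longrightarrow> g differentiable at x \<Longrightarrow>
    frechet_derivative (\<lambda>y. f y + g y) (at x) w = frechet_derivative f (at x) w + frechet_derivative g (at x) w"
  by (simp add: frechet_derivative_works frechet_derivative_at[OF has_derivative_add, symmetric])

lemma frechet_derivative_diff:
  "f differentiable at x \<Longrightarrow> g differentiable at x \<Longrightarrow>
    frechet_derivative (\<lambda>y. f y - g y) (at x) w = frechet_derivative f (at x) w - frechet_derivative g (at x) w"
  by (simp add: frechet_derivative_works frechet_derivative_at[OF has_derivative_diff, symmetric])

lemma frechet_derivative_bilinear:
  assumes "bounded_bilinear m" "f differentiable at x" "g differentiable at x"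
  shows "frechet_derivative (\<lambda>y. m (f y) (g y)) (at x) w
    = m (f x) (frechet_derivative g (at x) w) + m (frechet_derivative f (at x) w) (g x)"
  using frechet_derivative_at[OF bounded_bilinear.FDERIV[OF assms(1) assms(2,3)[unfolded frechet_derivative_works]]]
  by metis

text \<open>The Christoffel term of \<open>covd\<close> as a bilinear map. It is not a tensor; its
  change between charts is \<open>christoffel_transform\<close>.\<close>

definition Gam :: "(real^'n \<Rightarrow> real^'n^'n) \<Rightarrow> real^'n \<Rightarrow> real^'n \<Rightarrow> real^'n \<Rightarrow> real^'n::finite" where
  "Gam G x u v = (\<chi> k. \<Sum>i\<in>UNIV. \<Sum>j\<in>UNIV. christoffel G x i j k * u $ i * v $ j)"

lemma covd_eq: "covd G u W x = frechet_derivative W (at x) u + Gam G x u (W x)"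
  unfolding covd_def Gam_def ..

lemma bilinear_Gam: "bilinear (Gam G x)"
  unfolding bilinear_def Gam_def
  by (auto intro!: linearI simp: vec_eq_iff algebra_simps sum.distrib sum_distrib_left)

lemmas Gam_linear_simps =
  bilinear_ladd[OF bilinear_Gam] bilinear_radd[OF bilinear_Gam]
  bilinear_lsub[OF bilinear_Gam] bilinear_rsub[OF bilinear_Gam]
  bilinear_lmul[OF bilinear_Gam] bilinear_rmul[OF bilinear_Gam]
  bilinear_lneg[OF bilinear_Gam] bilinear_rneg[OF bilinear_Gam]
  bilinear_lzero[OF bilinear_Gam] bilinear_rzero[OF bilinear_Gam]

lemma linear_Gam: "linear (Gam G x u)" "linear (\<lambda>v. Gam G x v u)"
  using bilinear_Gam unfolding bilinear_def by auto

text \<open>Alternating the symmetry of the first two slots with the skewness of the last two, three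
  times each, leads back to the same arguments with the opposite sign. This is the algebra behind
  the uniqueness of the Levi-Civita connection.\<close>

lemma symmetric_skew_trilinear_zero:
  fixes t :: "'a \<Rightarrow> 'a \<Rightarrow> 'a \<Rightarrow> real"
  assumes "\<And>u v w. t u v w = t v u w" "\<And>u v w. t u v w = - t u w v"
  shows "t u v w = 0"
  using assms(1)[of u v w] assms(2)[of v u w] assms(1)[of v w u] assms(2)[of w v u]
    assms(1)[of w u v] assms(2)[of u w v] by linarith

lemma inner_sum_matrix:
  fixes M :: "real^'n::finite^'n"
  shows "u \<bullet> (M *v v) = (\<Sum>i\<in>UNIV. \<Sum>j\<in>UNIV. u $ i * v $ j * M $ i $ j)"
  by (simp add: inner_vec_def matrix_vector_mult_def sum_distrib_left mult_ac)

locale metric_chart =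
  fixes S :: "(real^'n::finite) set" and G :: "real^'n \<Rightarrow> real^'n^'n"
  assumes open_S: "open S" and smooth_G: "smooth_on S G"
    and sym_G: "\<And>x. x \<in> S \<Longrightarrow> transpose (G x) = G x"
    and pos_G: "\<And>x v. x \<in> S \<Longrightarrow> v \<noteq> 0 \<Longrightarrow> v \<bullet> (G x *v v) > 0"
begin

lemma G_commute: "x \<in> S \<Longrightarrow> u \<bullet> (G x *v v) = v \<bullet> (G x *v u)"
  using dot_lmul_matrix[of u "G x" v] vector_transpose_matrix[of u "G x"] sym_G[of x]
  by (simp add: inner_commute)

lemma G_nondegenerate: "x \<in> S \<Longrightarrow> (\<And>w. u \<bullet> (G x *v w) = 0) \<Longrightarrow> u = 0"
  using pos_G[of x u] by force

lemma invertible_G: "x \<in> S \<Longrightarrow> invertible (G x)"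
proof -
  assume "x \<in> S"
  then have "v = 0" if "G x *v v = 0" for v using pos_G[of x v] that by force
  then show ?thesis
    by (simp add: invertible_left_inverse matrix_left_invertible_ker)
qed

lemma smooth_christoffel: "smooth_on S (\<lambda>x. christoffel G x i j k)"
  unfolding christoffel_def pderiv_at_def
  by (intro smooth_on_mult smooth_on_const smooth_on_sum smooth_on_matrix_inv_entry smooth_on_diff
      smooth_on_add smooth_on_frechet_derivative smooth_on_vec_nth open_S smooth_G invertible_G)

lemma smooth_Gam: "smooth_on S u \<Longrightarrow> smooth_on S v \<Longrightarrow> smooth_on S (\<lambda>x. Gam G x (u x) (v x))"
  unfolding Gam_def
  by (intro smooth_on_vec_lambda smooth_on_sum smooth_on_mult smooth_christoffel smooth_on_vec_nth open_S)

lemma smooth_covd: "smooth_on S u \<Longrightarrow> smooth_on S W \<Longrightarrow> smooth_on S (\<lambda>x. covd G (u x) W x)"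
  unfolding covd_eq
  by (intro smooth_on_add smooth_Gam smooth_on_frechet_derivative_app[where T = S] smooth_on_ident open_S)

lemma levi_civita:
  assumes "x \<in> S"
  shows "christoffel G x i j k = christoffel G x j i k"
    and "pderiv_at k (\<lambda>y. G y $ i $ j) x
       = (\<Sum>l\<in>UNIV. christoffel G x k i l * G x $ l $ j) + (\<Sum>l\<in>UNIV. christoffel G x k j l * G x $ i $ l)"
  using christoffel_levi_civita[OF open_S assms sym_G
      smooth_on_imp_differentiable[OF open_S smooth_on_vec_nth[OF open_S smooth_on_vec_nth[OF open_S smooth_G]] assms]
      invertible_G[OF assms], of "christoffel G x"]
  by auto

lemma Gam_commute: "x \<in> S \<Longrightarrow> Gam G x u v = Gam G x v u"
proof -
  assume x: "x \<in> S"
  have "(\<Sum>i\<in>UNIV. \<Sum>j\<in>UNIV. christoffel G x i j k * u $ i * v $ j)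
    = (\<Sum>j\<in>UNIV. \<Sum>i\<in>UNIV. christoffel G x j i k * v $ j * u $ i)" for k
    by (subst sum.swap, intro sum.cong refl, subst levi_civita(1)[OF x]) (simp only: mult_ac)
  then show ?thesis unfolding Gam_def by simp
qed

text \<open>Contract the index identity of \<open>levi_civita\<close> with \<open>u\<close>,
  \<open>v\<close> and \<open>w\<close>; what is left is to match the order of the four
  sums.\<close>

lemma metric_compatible:
  assumes x: "x \<in> S"
  shows "u \<bullet> (frechet_derivative G (at x) w *v v) = Gam G x w u \<bullet> (G x *v v) + u \<bullet> (G x *v Gam G x w v)"
proof -
  have dG: "frechet_derivative G (at x) w $ i $ j = (\<Sum>k\<in>UNIV. w $ k * pderiv_at k (\<lambda>y. G y $ i $ j) x)" for i j
  proof -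
    have bl: "bounded_linear (\<lambda>M::real^'n^'n. M $ i $ j)"
      by (intro bounded_linear_compose[OF bounded_linear_vec_nth bounded_linear_vec_nth])
    note d = smooth_on_imp_differentiable[OF open_S smooth_G x]
    have d': "(\<lambda>y. G y $ i $ j) differentiable at x"
      using smooth_on_imp_differentiable[OF open_S smooth_on_vec_nth[OF open_S smooth_on_vec_nth[OF open_S smooth_G]] x] .
    have "frechet_derivative G (at x) w $ i $ j = frechet_derivative (\<lambda>y. G y $ i $ j) (at x) w"
      using frechet_derivative_bounded_linear[OF bl d] by simp
    also have "\<dots> = frechet_derivative (\<lambda>y. G y $ i $ j) (at x) (\<Sum>k\<in>UNIV. w $ k *\<^sub>R axis k 1)"
      by (simp add: basis_expansion scalar_mult_eq_scaleR[symmetric])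
    also have "\<dots> = (\<Sum>k\<in>UNIV. w $ k * pderiv_at k (\<lambda>y. G y $ i $ j) x)"
      unfolding pderiv_at_def using linear_frechet_derivative[OF d']
      by (simp add: linear_sum linear_cmul)
    finally show ?thesis .
  qed
  have "u \<bullet> (frechet_derivative G (at x) w *v v)
    = (\<Sum>i\<in>UNIV. \<Sum>j\<in>UNIV. \<Sum>k\<in>UNIV. \<Sum>l\<in>UNIV. u $ i * v $ j * w $ k * (christoffel G x k i l * G x $ l $ j))
    + (\<Sum>i\<in>UNIV. \<Sum>j\<in>UNIV. \<Sum>k\<in>UNIV. \<Sum>l\<in>UNIV. u $ i * v $ j * w $ k * (christoffel G x k j l * G x $ i $ l))"
    unfolding inner_sum_matrix dG levi_civita(2)[OF x]
    by (simp add: sum_distrib_left sum.distrib algebra_simps)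
  also have "(\<Sum>i\<in>UNIV. \<Sum>j\<in>UNIV. \<Sum>k\<in>UNIV. \<Sum>l\<in>UNIV. u $ i * v $ j * w $ k * (christoffel G x k i l * G x $ l $ j))
     = Gam G x w u \<bullet> (G x *v v)"
  proof -
    have "Gam G x w u \<bullet> (G x *v v) = (\<Sum>l\<in>UNIV. \<Sum>j\<in>UNIV. \<Sum>k\<in>UNIV. \<Sum>i\<in>UNIV. u $ i * v $ j * w $ k * (christoffel G x k i l * G x $ l $ j))"
      unfolding inner_sum_matrix Gam_def by (simp add: sum_distrib_left sum_distrib_right mult_ac)
    also have "\<dots> = (\<Sum>j\<in>UNIV. \<Sum>l\<in>UNIV. \<Sum>k\<in>UNIV. \<Sum>i\<in>UNIV. u $ i * v $ j * w $ k * (christoffel G x k i l * G x $ l $ j))"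
      by (rule sum.swap)
    also have "\<dots> = (\<Sum>j\<in>UNIV. \<Sum>k\<in>UNIV. \<Sum>i\<in>UNIV. \<Sum>l\<in>UNIV. u $ i * v $ j * w $ k * (christoffel G x k i l * G x $ l $ j))"
      by (rule sum.cong[OF refl], rule trans[OF sum.swap], rule sum.cong[OF refl], rule sum.swap)
    also have "\<dots> = (\<Sum>j\<in>UNIV. \<Sum>i\<in>UNIV. \<Sum>k\<in>UNIV. \<Sum>l\<in>UNIV. u $ i * v $ j * w $ k * (christoffel G x k i l * G x $ l $ j))"
      by (rule sum.cong[OF refl], rule sum.swap)
    also have "\<dots> = (\<Sum>i\<in>UNIV. \<Sum>j\<in>UNIV. \<Sum>k\<in>UNIV. \<Sum>l\<in>UNIV. u $ i * v $ j * w $ k * (christoffel G x k i l * G x $ l $ j))"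
      by (rule sum.swap)
    finally show ?thesis by simp
  qed
  also have "(\<Sum>i\<in>UNIV. \<Sum>j\<in>UNIV. \<Sum>k\<in>UNIV. \<Sum>l\<in>UNIV. u $ i * v $ j * w $ k * (christoffel G x k j l * G x $ i $ l))
     = u \<bullet> (G x *v Gam G x w v)"
  proof -
    have "u \<bullet> (G x *v Gam G x w v) = (\<Sum>i\<in>UNIV. \<Sum>l\<in>UNIV. \<Sum>k\<in>UNIV. \<Sum>j\<in>UNIV. u $ i * v $ j * w $ k * (christoffel G x k j l * G x $ i $ l))"
      unfolding inner_sum_matrix Gam_def by (simp add: sum_distrib_left sum_distrib_right mult_ac)
    also have "\<dots> = (\<Sum>i\<in>UNIV. \<Sum>k\<in>UNIV. \<Sum>j\<in>UNIV. \<Sum>l\<in>UNIV. u $ i * v $ j * w $ k * (christoffel G x k j l * G x $ i $ l))"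
      by (rule sum.cong[OF refl], rule trans[OF sum.swap], rule sum.cong[OF refl], rule sum.swap)
    also have "\<dots> = (\<Sum>i\<in>UNIV. \<Sum>j\<in>UNIV. \<Sum>k\<in>UNIV. \<Sum>l\<in>UNIV. u $ i * v $ j * w $ k * (christoffel G x k j l * G x $ i $ l))"
      by (rule sum.cong[OF refl], rule sum.swap)
    finally show ?thesis by simp
  qed
  finally show ?thesis .
qed

text \<open>The difference of two torsion-free metric connections, lowered by the metric, is
  symmetric in its first two slots and skew in its last two, hence zero.\<close>

lemma Gam_unique:
  assumes x: "x \<in> S" and "\<And>u v. T u v = T v u"
    and c: "\<And>u v w. u \<bullet> (frechet_derivative G (at x) w *v v) = T w u \<bullet> (G x *v v) + u \<bullet> (G x *v T w v)"
  shows "T u v = Gam G x u v"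
proof -
  let ?t = "\<lambda>u v w. (T u v - Gam G x u v) \<bullet> (G x *v w)"
  have "?t u v w = 0" for w
  proof (rule symmetric_skew_trilinear_zero[where t = ?t])
    fix u v w
    show "?t u v w = ?t v u w" using assms(2)[of u v] Gam_commute[OF x, of u v] by simp
    have "v \<bullet> (G x *v T u w) = T u w \<bullet> (G x *v v)" "v \<bullet> (G x *v Gam G x u w) = Gam G x u w \<bullet> (G x *v v)"
      using G_commute[OF x] by auto
    then show "?t u v w = - ?t u w v"
      using c[of v u w] metric_compatible[OF x, of v u w]
      by (simp add: inner_diff_left)
  qed
  then show ?thesis using G_nondegenerate[OF x, of "T u v - Gam G x u v"] by simp
qed

lemma Gam_differentiable: "x \<in> S \<Longrightarrow> (\<lambda>y. Gam G y a b) differentiable at x"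
  by (rule smooth_on_imp_differentiable[OF open_S smooth_Gam[OF smooth_on_const smooth_on_const]])

lemma frechet_derivative_Gam:
  assumes x: "x \<in> S" and u: "u differentiable at x" and v: "v differentiable at x"
  shows "(\<lambda>y. Gam G y (u y) (v y)) differentiable at x"
    and "frechet_derivative (\<lambda>y. Gam G y (u y) (v y)) (at x) w
    = frechet_derivative (\<lambda>y. Gam G y (u x) (v x)) (at x) w
      + Gam G x (frechet_derivative u (at x) w) (v x) + Gam G x (u x) (frechet_derivative v (at x) w)"
proof -
  note 1 = frechet_derivative_bounded_linear_family[where S = S and F = "\<lambda>y b. Gam G y b a" for a,
      OF ballI[OF linear_Gam(2)] open_S x Gam_differentiable[OF x] u]
  note 2 = frechet_derivative_bounded_linear_family[where S = S and F = "\<lambda>y b. Gam G y (u y) b" and h = v,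
      OF ballI[OF linear_Gam(1)] open_S x 1(1) v]
  show "(\<lambda>y. Gam G y (u y) (v y)) differentiable at x" by (rule 2(1))
  show "frechet_derivative (\<lambda>y. Gam G y (u y) (v y)) (at x) w
    = frechet_derivative (\<lambda>y. Gam G y (u x) (v x)) (at x) w
      + Gam G x (frechet_derivative u (at x) w) (v x) + Gam G x (u x) (frechet_derivative v (at x) w)"
    unfolding 2(2) 1(2) ..
qed

lemma curvature_coord_eq:
  assumes x: "x \<in> S"
  shows "curvature_coord G x u v w = frechet_derivative (\<lambda>y. Gam G y v w) (at x) u
      - frechet_derivative (\<lambda>y. Gam G y u w) (at x) v
      + Gam G x u (Gam G x v w) - Gam G x v (Gam G x u w)"
proof -
  have "covd G v (\<lambda>_. w) = (\<lambda>y. Gam G y v w)" for v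
    by (rule ext) (simp add: covd_eq)
  then show ?thesis unfolding curvature_coord_def by (simp add: covd_eq)
qed

end

section \<open>Geodesic fields in a chart\<close>

lemma frechet_derivative_matrix_vector_const:
  fixes F :: "'a::real_normed_vector \<Rightarrow> real^'n^'m"
  assumes "F differentiable at x"
  shows "frechet_derivative (\<lambda>y. F y *v v) (at x) w = frechet_derivative F (at x) w *v v"
  using frechet_derivative_bounded_linear[OF bounded_bilinear.bounded_linear_left[OF bounded_bilinear_matrix_vector_mult] assms] .

lemma smooth_on_matrix:
  fixes F :: "'a::euclidean_space \<Rightarrow> real^'n::finite \<Rightarrow> real^'m::finite"
  assumes "open S" "\<And>v. smooth_on S (\<lambda>x. F x v)"
  shows "smooth_on S (\<lambda>x. matrix (F x))"
  unfolding matrix_def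
  by (intro smooth_on_vec_lambda smooth_on_vec_nth assms)

lemma matrix_eqI: "(\<And>v. M *v v = N *v v) \<Longrightarrow> M = (N::real^'n::finite^'m)"
  by (simp add: matrix_eq)

lemma inner_transpose_mult: "w \<bullet> (transpose M *v v) = v \<bullet> (M *v w)" for M :: "real^'n::finite^'n"
  by (simp add: transpose_matrix_vector inner_commute[of w] dot_lmul_matrix)

lemma matrix_eq_innerI:
  fixes M N :: "real^'n::finite^'m::finite"
  assumes "\<And>v w. w \<bullet> (M *v v) = w \<bullet> (N *v v)"
  shows "M = N"
  by (rule matrix_eqI, rule vector_eq_ldot[THEN iffD1], rule allI, rule assms)

context metric_chart
begin

lemma linear_covd: "W differentiable at x \<Longrightarrow> linear (\<lambda>u. covd G u W x)"
  unfolding covd_eq by (intro linear_compose_add linear_frechet_derivative linear_Gam)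

lemma inner_G_derivative:
  assumes x: "x \<in> S" and V: "V differentiable at x" and W: "W differentiable at x"
  shows "(\<lambda>y. V y \<bullet> (G y *v W y)) differentiable at x"
    and "frechet_derivative (\<lambda>y. V y \<bullet> (G y *v W y)) (at x) w
      = covd G w V x \<bullet> (G x *v W x) + V x \<bullet> (G x *v covd G w W x)"
proof -
  note dG = smooth_on_imp_differentiable[OF open_S smooth_G x]
  note GW = bounded_bilinear.FDERIV[OF bounded_bilinear_matrix_vector_mult dG[unfolded frechet_derivative_works] W[unfolded frechet_derivative_works]]
  then have dGW: "(\<lambda>y. G y *v W y) differentiable at x" unfolding differentiable_def by blast
  show "(\<lambda>y. V y \<bullet> (G y *v W y)) differentiable at x"
    using bounded_bilinear.FDERIV[OF bounded_bilinear_inner V[unfolded frechet_derivative_works] dGW[unfolded frechet_derivative_works]]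
    unfolding differentiable_def by blast
  show "frechet_derivative (\<lambda>y. V y \<bullet> (G y *v W y)) (at x) w
      = covd G w V x \<bullet> (G x *v W x) + V x \<bullet> (G x *v covd G w W x)"
    by (simp add: frechet_derivative_bilinear[OF bounded_bilinear_inner V dGW]
        frechet_derivative_bilinear[OF bounded_bilinear_matrix_vector_mult dG W]
        metric_compatible[OF x] covd_eq inner_add_left inner_add_right matrix_vector_right_distrib)
qed

end

locale geodesic_chart = metric_chart S G for S :: "(real^'n::finite) set" and G +
  fixes X :: "real^'n \<Rightarrow> real^'n"
  assumes smooth_X: "smooth_on S X"
    and unit_X: "\<And>x. x \<in> S \<Longrightarrow> X x \<bullet> (G x *v X x) = 1"
    and geodesic_X: "\<And>x. x \<in> S \<Longrightarrow> covd G (X x) X x = 0"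
begin

abbreviation shape :: "real^'n \<Rightarrow> real^'n \<Rightarrow> real^'n" where "shape x v \<equiv> covd G v X x"
abbreviation jac :: "real^'n \<Rightarrow> real^'n \<Rightarrow> real^'n" where "jac x v \<equiv> curvature_coord G x v (X x) (X x)"

lemma diff_X: "x \<in> S \<Longrightarrow> X differentiable at x"
  by (rule smooth_on_imp_differentiable[OF open_S smooth_X])

lemma linear_DX: "x \<in> S \<Longrightarrow> linear (frechet_derivative X (at x))"
  by (rule linear_frechet_derivative[OF diff_X])

lemma linear_shape: "x \<in> S \<Longrightarrow> linear (shape x)"
  by (rule linear_covd[OF diff_X])

lemma smooth_shape: "smooth_on S (\<lambda>x. shape x v)"
  by (intro smooth_covd smooth_on_const smooth_X)

text \<open>Differentiate the constant function \<open>g(X, X) = 1\<close>.\<close>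

lemma shape_orthogonal:
  assumes x: "x \<in> S"
  shows "shape x v \<bullet> (G x *v X x) = 0"
proof -
  have "frechet_derivative (\<lambda>y. X y \<bullet> (G y *v X y)) (at x) v = frechet_derivative (\<lambda>y. 1) (at x) v"
    using frechet_derivative_cong_on[OF open_S x unit_X] by simp
  then have "shape x v \<bullet> (G x *v X x) + X x \<bullet> (G x *v shape x v) = 0"
    using inner_G_derivative(2)[OF x diff_X[OF x] diff_X[OF x]] by simp
  then show ?thesis using G_commute[OF x, of "X x"] by simp
qed

text \<open>Differentiate the geodesic equation in direction \<open>v\<close> and exchange the two
  directions by the symmetry of the second derivatives of \<open>X\<close>; the curvature is what
  remains. The two terms with \<open>Gam\<close> outermost or inside \<open>shape\<close> arise
  because the field with constant components \<open>v\<close> is not parallel.\<close>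

lemma riccati:
  assumes x: "x \<in> S"
  shows "frechet_derivative (\<lambda>y. shape y v) (at x) (X x)
     = shape x (Gam G x (X x) v) - Gam G x (X x) (shape x v) - shape x (shape x v) - jac x v"
proof -
  let ?D = "\<lambda>v. frechet_derivative X (at x) v"
  let ?D2 = "\<lambda>v. frechet_derivative (\<lambda>y. frechet_derivative X (at y) v) (at x)"
  let ?DG = "\<lambda>w a b. frechet_derivative (\<lambda>y. Gam G y a b) (at x) w"
  note dDX = smooth_on_imp_differentiable[OF open_S smooth_on_frechet_derivative[OF open_S smooth_X] x]
  have geo: "?D (X x) = - Gam G x (X x) (X x)"
    using geodesic_X[OF x] by (simp add: covd_eq eq_neg_iff_add_eq_0)
  have 1: "frechet_derivative (\<lambda>y. shape y v) (at x) (X x)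
      = ?D2 v (X x) + (?DG (X x) v (X x) + Gam G x v (?D (X x)))"
    unfolding covd_eq
    by (subst frechet_derivative_add[OF dDX frechet_derivative_Gam(1)[OF x _ diff_X[OF x]]])
       (auto simp: frechet_derivative_Gam(2)[OF x _ diff_X[OF x]] bilinear_lzero[OF bilinear_Gam])
  have "\<forall>y\<in>S. linear (frechet_derivative X (at y))" using linear_DX by blast
  note lf = frechet_derivative_bounded_linear_family[where F = "\<lambda>y. frechet_derivative X (at y)" and S = S,
      OF this open_S x dDX diff_X[OF x]]
  have "frechet_derivative (\<lambda>y. covd G (X y) X y) (at x) v
      = ?D2 (X x) v + ?D (?D v) + (?DG v (X x) (X x) + Gam G x (?D v) (X x) + Gam G x (X x) (?D v))"
    unfolding covd_eq
    by (subst frechet_derivative_add[OF lf(1) frechet_derivative_Gam(1)[OF x diff_X[OF x] diff_X[OF x]]])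
       (simp add: lf(2) frechet_derivative_Gam(2)[OF x diff_X[OF x] diff_X[OF x]])
  moreover have "frechet_derivative (\<lambda>y. covd G (X y) X y) (at x) = frechet_derivative (\<lambda>y. 0) (at x)"
    by (rule frechet_derivative_cong_on[OF open_S x geodesic_X])
  ultimately have 2: "?D2 (X x) v
      = - ?D (?D v) - ?DG v (X x) (X x) - Gam G x (?D v) (X x) - Gam G x (X x) (?D v)"
    by (simp add: algebra_simps add_eq_0_iff)
  have 3: "?D2 v (X x) = ?D2 (X x) v"
    by (rule symmetric_second_frechet_derivative[OF open_S x smooth_X])
  note linD = linear_add[OF linear_DX[OF x]] linear_diff[OF linear_DX[OF x]] linear_neg[OF linear_DX[OF x]]
  have c: "Gam G x v (X x) = Gam G x (X x) v" "Gam G x (X x) (?D v) = Gam G x (?D v) (X x)"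
    using Gam_commute[OF x] by auto
  show ?thesis
    unfolding 1 3 2 curvature_coord_eq[OF x] unfolding covd_eq geo
    by (simp add: Gam_linear_simps linD c algebra_simps)
qed

text \<open>The Riccati equation solved for \<open>jac\<close>. Only covariant derivatives of fields
  remain, so a map that preserves these also preserves \<open>jac\<close>.\<close>

lemma riccati_field:
  assumes x: "x \<in> S" and V: "V differentiable at x"
  shows "jac x (V x) = shape x (covd G (X x) V x) - covd G (X x) (\<lambda>y. shape y (V y)) x - shape x (shape x (V x))"
proof -
  have "\<forall>y\<in>S. linear (shape y)" using linear_shape by blast
  note lf = frechet_derivative_bounded_linear_family[where F = shape and S = S and h = V,
      OF this open_S x smooth_on_imp_differentiable[OF open_S smooth_shape x] V]
  show ?thesis
    unfolding covd_eq[of G _ V] covd_eq[of G _ "\<lambda>y. shape y (V y)"] lf(2) riccati[OF x]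
    by (simp add: linear_add[OF linear_shape[OF x]])
qed

section \<open>Matrices of the shape operator and of the Jacobi tensor\<close>

definition shapeM :: "real^'n \<Rightarrow> real^'n^'n" where "shapeM x = matrix (shape x)"
definition jacM :: "real^'n \<Rightarrow> real^'n^'n" where "jacM x = matrix (jac x)"
definition GamM :: "real^'n \<Rightarrow> real^'n^'n" where "GamM x = matrix (Gam G x (X x))"

lemma linear_jac: "x \<in> S \<Longrightarrow> linear (jac x)"
proof -
  assume x: "x \<in> S"
  note dG = Gam_differentiable[OF x]
  have "linear (\<lambda>v. frechet_derivative (\<lambda>y. Gam G y v (X x)) (at x) (X x))"
    by (rule linearI)
       (simp_all add: Gam_linear_simps frechet_derivative_add[OF dG dG]
         frechet_derivative_bounded_linear[OF bounded_linear_scaleR_right dG])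
  then show ?thesis
    unfolding curvature_coord_eq[OF x]
    by (intro linear_compose_add linear_compose_sub linear_frechet_derivative[OF dG] linear_Gam
        linear_compose[OF linear_Gam(2) linear_Gam(1), unfolded comp_def])
qed

lemma shapeM_works: "x \<in> S \<Longrightarrow> shapeM x *v v = shape x v"
  unfolding shapeM_def by (simp add: matrix_works linear_shape linear_matrix_vector_mul_eq)

lemma jacM_works: "x \<in> S \<Longrightarrow> jacM x *v v = jac x v"
  unfolding jacM_def by (simp add: matrix_works linear_jac linear_matrix_vector_mul_eq)

lemma GamM_works: "GamM x *v v = Gam G x (X x) v"
  unfolding GamM_def by (simp add: matrix_works linear_Gam linear_matrix_vector_mul_eq)

lemma smooth_shapeM: "smooth_on S shapeM"
  unfolding shapeM_def by (intro smooth_on_matrix open_S smooth_shape)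

text \<open>The Riccati equation builds \<open>jac\<close> from \<open>shape\<close>,
  \<open>Gam\<close> and a derivative of \<open>shape\<close>, whose smoothness is already
  known.\<close>

lemma smooth_jacM: "smooth_on S jacM"
  unfolding jacM_def
proof (intro smooth_on_matrix open_S)
  fix v
  have s: "smooth_on S (\<lambda>x. shape x (u x))" if "smooth_on S u" for u
    by (intro smooth_covd that smooth_X)
  have "smooth_on S (\<lambda>x. shape x (Gam G x (X x) v) - Gam G x (X x) (shape x v) - shape x (shape x v)
      - frechet_derivative (\<lambda>y. shape y v) (at x) (X x))"
    by (intro smooth_on_diff s smooth_Gam smooth_X smooth_on_const open_S
        smooth_on_frechet_derivative_app[where T = S] smooth_on_ident)
  then show "smooth_on S (\<lambda>x. jac x v)"
    by (subst smooth_on_cong[OF open_S]) (simp_all add: riccati)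
qed

lemma diff_shapeM: "x \<in> S \<Longrightarrow> shapeM differentiable at x"
  by (rule smooth_on_imp_differentiable[OF open_S smooth_shapeM])

lemma diff_jacM: "x \<in> S \<Longrightarrow> jacM differentiable at x"
  by (rule smooth_on_imp_differentiable[OF open_S smooth_jacM])

text \<open>The commutator with \<open>GamM\<close> is the coordinate correction in the covariant
  derivative of an endomorphism; it will disappear under traces.\<close>

lemma riccati_matrix:
  assumes x: "x \<in> S"
  shows "frechet_derivative shapeM (at x) (X x)
    = shapeM x ** GamM x - GamM x ** shapeM x - shapeM x ** shapeM x - jacM x"
proof (rule matrix_eqI)
  fix v
  have "frechet_derivative shapeM (at x) (X x) *v v = frechet_derivative (\<lambda>y. shapeM y *v v) (at x) (X x)"
    by (rule frechet_derivative_matrix_vector_const[OF diff_shapeM[OF x], symmetric])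
  also have "\<dots> = frechet_derivative (\<lambda>y. shape y v) (at x) (X x)"
    by (rule frechet_derivative_cong_on[OF open_S x shapeM_works, THEN fun_cong])
  finally show "frechet_derivative shapeM (at x) (X x) *v v
    = (shapeM x ** GamM x - GamM x ** shapeM x - shapeM x ** shapeM x - jacM x) *v v"
    by (simp add: riccati[OF x] matrix_vector_mult_diff_rdistrib matrix_vector_mul_assoc[symmetric]
        shapeM_works[OF x] jacM_works[OF x] GamM_works)
qed

lemma shape_X: "x \<in> S \<Longrightarrow> shape x (X x) = 0"
  by (rule geodesic_X)

lemma jac_X: "jac x (X x) = 0"
  unfolding curvature_coord_def by simp

text \<open>The hypothesis only concerns fields orthogonal to \<open>X\<close>; on \<open>X\<close> itself \<open>jac\<close> vanishes.\<close>

lemma jacM_parallel: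
  assumes x: "x \<in> S"
    and par: "\<And>w. covd G (X x) (\<lambda>y. jac y (w - (w \<bullet> (G y *v X y)) *\<^sub>R X y)) x
       = jac x (covd G (X x) (\<lambda>y. w - (w \<bullet> (G y *v X y)) *\<^sub>R X y) x)"
  shows "frechet_derivative jacM (at x) (X x) = jacM x ** GamM x - GamM x ** jacM x"
proof (rule matrix_eqI)
  fix w
  let ?L = "\<lambda>v. frechet_derivative jacM (at x) (X x) *v v"
  \<comment> \<open>The difference is tensorial: it depends on \<open>V\<close> only through
    \<open>V x\<close>, and linearly. So its vanishing on the projection of \<open>w\<close> and on
    \<open>X x\<close> gives its vanishing on \<open>w\<close>.\<close>
  have key: "covd G (X x) (\<lambda>y. jac y (V y)) x - jac x (covd G (X x) V x)
      = ?L (V x) + Gam G x (X x) (jac x (V x)) - jac x (Gam G x (X x) (V x))"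
    if V: "V differentiable at x" for V
  proof -
    have "frechet_derivative (\<lambda>y. jac y (V y)) (at x) (X x) = frechet_derivative (\<lambda>y. jacM y *v V y) (at x) (X x)"
      by (rule frechet_derivative_cong_on[OF open_S x jacM_works, THEN fun_cong, symmetric])
    also have "\<dots> = jac x (frechet_derivative V (at x) (X x)) + ?L (V x)"
      by (simp add: frechet_derivative_bilinear[OF bounded_bilinear_matrix_vector_mult diff_jacM[OF x] V] jacM_works[OF x])
    finally show ?thesis
      unfolding covd_eq by (simp add: linear_add[OF linear_jac[OF x]])
  qed
  define c where "c y = w \<bullet> (G y *v X y)" for y
  have dV: "(\<lambda>y. w - c y *\<^sub>R X y) differentiable at x"
    unfolding c_def
    by (intro smooth_on_imp_differentiable[OF open_S _ x] smooth_on_diff smooth_on_scaleR smooth_on_inner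
        smooth_on_bilinear[OF _ bounded_bilinear_matrix_vector_mult] smooth_on_const smooth_X smooth_G open_S)
  have "?L (w - c x *\<^sub>R X x) + Gam G x (X x) (jac x (w - c x *\<^sub>R X x)) - jac x (Gam G x (X x) (w - c x *\<^sub>R X x)) = 0"
    using key[OF dV] par[of w] unfolding c_def[symmetric] by simp
  moreover have "?L (X x) + Gam G x (X x) (jac x (X x)) - jac x (Gam G x (X x) (X x)) = 0"
    using key[OF diff_X[OF x]] geodesic_X[OF x]
    by (simp add: jac_X covd_eq[of G _ "\<lambda>_. 0"] linear_0[OF linear_jac[OF x]] Gam_linear_simps)
  ultimately have "?L w + Gam G x (X x) (jac x w) - jac x (Gam G x (X x) w) = 0"
    by (simp add: matrix_vector_mult_diff_distrib matrix_vector_mult_scaleR Gam_linear_simps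
        linear_diff[OF linear_jac[OF x]] linear_cmul[OF linear_jac[OF x]] jac_X algebra_simps)
  then show "?L w = (jacM x ** GamM x - GamM x ** jacM x) *v w"
    by (simp add: matrix_vector_mult_diff_rdistrib matrix_vector_mul_assoc[symmetric] jacM_works[OF x] GamM_works algebra_simps)
qed

section \<open>The dual one-form and its exterior derivative\<close>

definition dualM :: "real^'n \<Rightarrow> real^'n" where "dualM x = G x *v X x"

text \<open>The matrix of d\<alpha> for \<alpha> = g(X, -), with d\<alpha>(v, w) equal to
  \<open>w \<bullet> (skewM x *v v)\<close>. Written through \<open>shapeM\<close>, it vanishes
  exactly when the shape operator is self-adjoint.\<close>

definition skewM :: "real^'n \<Rightarrow> real^'n^'n" where
  "skewM x = G x ** shapeM x - transpose (G x ** shapeM x)"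

lemma skewM_inner:
  assumes x: "x \<in> S"
  shows "w \<bullet> (skewM x *v v) = w \<bullet> (G x *v shape x v) - v \<bullet> (G x *v shape x w)"
  by (simp add: skewM_def matrix_vector_mult_diff_rdistrib inner_diff_right inner_transpose_mult
      matrix_vector_mul_assoc[symmetric] shapeM_works[OF x] del: transpose_matrix_vector)

lemma smooth_dualM: "smooth_on S dualM"
  unfolding dualM_def
  by (intro smooth_on_bilinear[OF open_S bounded_bilinear_matrix_vector_mult] smooth_G smooth_X)

lemma smooth_skewM: "smooth_on S skewM"
proof -
  have "bounded_linear (transpose :: real^'n^'n \<Rightarrow> _)"
    by (intro linear_conv_bounded_linear[THEN iffD1] linearI) (simp_all add: transpose_def vec_eq_iff)
  then show ?thesis
    unfolding skewM_def
    by (intro smooth_on_diff smooth_on_bounded_linear[OF open_S, where L = transpose]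
        smooth_on_bilinear[OF open_S bounded_bilinear_matrix_matrix_mult] smooth_G smooth_shapeM open_S)
qed

lemma dualM_derivative:
  assumes x: "x \<in> S"
  shows "frechet_derivative dualM (at x) u \<bullet> w = shape x u \<bullet> (G x *v w) + dualM x \<bullet> Gam G x u w"
proof -
  have d: "dualM differentiable at x" by (rule smooth_on_imp_differentiable[OF open_S smooth_dualM x])
  have "frechet_derivative dualM (at x) u \<bullet> w = frechet_derivative (\<lambda>y. dualM y \<bullet> w) (at x) u"
    using frechet_derivative_bounded_linear[OF bounded_linear_inner_left d] by simp
  also have "\<dots> = frechet_derivative (\<lambda>y. X y \<bullet> (G y *v w)) (at x) u"
  proof (rule frechet_derivative_cong_on[OF open_S x, THEN fun_cong])
    show "dualM y \<bullet> w = X y \<bullet> (G y *v w)" if "y \<in> S" for y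
      using G_commute[OF that, of "X y" w] by (simp add: dualM_def inner_commute)
  qed
  also have "\<dots> = shape x u \<bullet> (G x *v w) + X x \<bullet> (G x *v Gam G x u w)"
    by (simp add: inner_G_derivative(2)[OF x diff_X[OF x] differentiable_const] covd_eq[of G u "\<lambda>_. w"])
  finally show ?thesis
    using G_commute[OF x, of "X x"] by (simp add: dualM_def inner_commute)
qed

text \<open>In the antisymmetrized derivative of \<open>dualM\<close> the Christoffel terms cancel,
  as the connection is torsion-free.\<close>

lemma skewM_exterior_derivative:
  assumes x: "x \<in> S"
  shows "w \<bullet> (skewM x *v v) = frechet_derivative dualM (at x) v \<bullet> w - frechet_derivative dualM (at x) w \<bullet> v"
  unfolding skewM_inner[OF x] dualM_derivative[OF x]
  using Gam_commute[OF x, of v w] G_commute[OF x] by simp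

text \<open>Both terms of \<open>skewM_inner\<close> vanish: the shape operator kills
  \<open>X\<close>, and its values are orthogonal to \<open>X\<close>.\<close>

lemma skewM_X: "x \<in> S \<Longrightarrow> w \<bullet> (skewM x *v X x) = 0"
  using skewM_inner[of x w "X x"] shape_X[of x] shape_orthogonal[of x w] G_commute[of x] by simp

text \<open>
  Since \<open>X\<close> lies in the kernel of the closed form \<open>skewM\<close>, the latter is invariant under the flow.
\<close>

lemma skewM_invariant:
  assumes x: "x \<in> S"
  defines "J \<equiv> matrix (frechet_derivative X (at x))"
  shows "frechet_derivative skewM (at x) (X x) = - (transpose J ** skewM x + skewM x ** J)"
proof (rule matrix_eq_innerI)
  fix v w
  let ?a = "\<lambda>y u. frechet_derivative dualM (at y) u"
  let ?D = "\<lambda>v. frechet_derivative X (at x) v"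
  let ?a2 = "\<lambda>v u. frechet_derivative (\<lambda>y. ?a y v) (at x) u"
  have dd: "dualM differentiable at y" if "y \<in> S" for y
    by (rule smooth_on_imp_differentiable[OF open_S smooth_dualM that])
  have da: "(\<lambda>y. ?a y v) differentiable at x" for v
    by (rule smooth_on_imp_differentiable[OF open_S smooth_on_frechet_derivative[OF open_S smooth_dualM] x])
  have a2s: "?a2 v u = ?a2 u v" for u v
    by (rule symmetric_second_frechet_derivative[OF open_S x smooth_dualM])
  have dsk: "skewM differentiable at x" by (rule smooth_on_imp_differentiable[OF open_S smooth_skewM x])
  have di: "frechet_derivative (\<lambda>y. ?a y v \<bullet> w) (at x) u = ?a2 v u \<bullet> w" for u v w
    by (rule frechet_derivative_bounded_linear[OF bounded_linear_inner_left da])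
  have ddi: "(\<lambda>y. ?a y v \<bullet> w) differentiable at x" for v w
    using da by (rule differentiable_inner) simp
  have "\<forall>y\<in>S. linear (?a y)" using dd linear_frechet_derivative by blast
  note lf = frechet_derivative_bounded_linear_family[where F = ?a and S = S, OF this open_S x da diff_X[OF x]]
  \<comment> \<open>The identity d\<alpha>(X, w) = 0, differentiated in direction
    \<open>v\<close>.\<close>
  have ker: "?a2 (X x) v \<bullet> w + ?a x (?D v) \<bullet> w = ?a2 w v \<bullet> X x + ?a x w \<bullet> ?D v" for v w
  proof -
    have "frechet_derivative (\<lambda>y. ?a y (X y) \<bullet> w) (at x) v = frechet_derivative (\<lambda>y. ?a y w \<bullet> X y) (at x) v"
    proof (rule frechet_derivative_cong_on[OF open_S x, THEN fun_cong])
      show "?a y (X y) \<bullet> w = ?a y w \<bullet> X y" if "y \<in> S" for y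
        using skewM_X[OF that, of w] skewM_exterior_derivative[OF that, of w "X y"] by simp
    qed
    then show ?thesis
      by (simp add: frechet_derivative_bounded_linear[OF bounded_linear_inner_left lf(1)] lf(2)
          frechet_derivative_bilinear[OF bounded_bilinear_inner da diff_X[OF x]] inner_add_left)
  qed
  have bl: "bounded_linear (\<lambda>M::real^'n^'n. w \<bullet> (M *v v))"
    using bounded_linear_compose[OF bounded_linear_inner_right
      bounded_bilinear.bounded_linear_left[OF bounded_bilinear_matrix_vector_mult]] .
  have "w \<bullet> (frechet_derivative skewM (at x) (X x) *v v) = frechet_derivative (\<lambda>y. w \<bullet> (skewM y *v v)) (at x) (X x)"
    using frechet_derivative_bounded_linear[OF bl dsk] by simp
  also have "\<dots> = frechet_derivative (\<lambda>y. ?a y v \<bullet> w - ?a y w \<bullet> v) (at x) (X x)"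
    by (rule frechet_derivative_cong_on[OF open_S x skewM_exterior_derivative, THEN fun_cong])
  \<comment> \<open>Closedness of d\<alpha> enters as the symmetry of the second derivatives of
    \<open>dualM\<close>; it moves \<open>X x\<close> into the slot to which \<open>ker\<close>
    applies.\<close>
  also have "\<dots> = ?a2 (X x) v \<bullet> w - ?a2 (X x) w \<bullet> v"
    by (simp add: frechet_derivative_diff ddi di a2s)
  also have "\<dots> = - (w \<bullet> (skewM x *v ?D v)) - ?D w \<bullet> (skewM x *v v)"
    using ker[of v w] ker[of w v] a2s[of v w]
    by (simp add: skewM_exterior_derivative[OF x] inner_commute)
  also have "\<dots> = w \<bullet> (- (transpose J ** skewM x + skewM x ** J) *v v)"
  proof -
    have J: "J *v u = ?D u" for u
      unfolding J_def using linear_DX[OF x] by (simp add: matrix_works linear_matrix_vector_mul_eq)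
    have "w \<bullet> (transpose J *v u) = ?D w \<bullet> u" for u
      using inner_transpose_mult[of w J u] by (simp add: J inner_commute)
    then show ?thesis
      by (simp add: matrix_vector_mult_diff_rdistrib inner_diff_right matrix_vector_mul_assoc[symmetric] J
          bounded_bilinear.minus_left[OF bounded_bilinear_matrix_vector_mult] del: transpose_matrix_vector)
  qed
  finally show "w \<bullet> (frechet_derivative skewM (at x) (X x) *v v)
    = w \<bullet> (- (transpose J ** skewM x + skewM x ** J) *v v)" .
qed

end

section \<open>Changes of charts\<close>

locale metric_isometry =
  dom: metric_chart S G + cod: metric_chart T H
  for S :: "(real^'n::finite) set" and G and T :: "(real^'n) set" and H +
  fixes \<phi> \<psi> :: "real^'n \<Rightarrow> real^'n"
  assumes smooth_\<phi>: "smooth_on S \<phi>" and smooth_\<psi>: "smooth_on T \<psi>"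
    and \<phi>_in: "\<And>x. x \<in> S \<Longrightarrow> \<phi> x \<in> T" and \<psi>_in: "\<And>y. y \<in> T \<Longrightarrow> \<psi> y \<in> S"
    and \<psi>_\<phi>: "\<And>x. x \<in> S \<Longrightarrow> \<psi> (\<phi> x) = x" and \<phi>_\<psi>: "\<And>y. y \<in> T \<Longrightarrow> \<phi> (\<psi> y) = y"
    and isometry: "\<And>x u v. x \<in> S \<Longrightarrow>
      u \<bullet> (G x *v v) = frechet_derivative \<phi> (at x) u \<bullet> (H (\<phi> x) *v frechet_derivative \<phi> (at x) v)"
begin

abbreviation J :: "real^'n \<Rightarrow> real^'n \<Rightarrow> real^'n" where "J x \<equiv> frechet_derivative \<phi> (at x)"

lemma diff_\<phi>: "x \<in> S \<Longrightarrow> \<phi> differentiable at x"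
  by (rule smooth_on_imp_differentiable[OF dom.open_S smooth_\<phi>])

lemma linear_J: "x \<in> S \<Longrightarrow> linear (J x)"
  by (rule linear_frechet_derivative[OF diff_\<phi>])

lemma J_left_inverse:
  assumes x: "x \<in> S"
  shows "frechet_derivative \<psi> (at (\<phi> x)) (J x v) = v"
proof -
  have "((\<lambda>y. \<psi> (\<phi> y)) has_derivative (\<lambda>v. frechet_derivative \<psi> (at (\<phi> x)) (J x v))) (at x)"
    by (rule has_derivative_compose[OF smooth_on_has_derivative[OF dom.open_S smooth_\<phi> x]
          smooth_on_has_derivative[OF cod.open_S smooth_\<psi> \<phi>_in[OF x]]])
  then have "((\<lambda>y. y) has_derivative (\<lambda>v. frechet_derivative \<psi> (at (\<phi> x)) (J x v))) (at x)"
    by (rule has_derivative_transform_within_open[OF _ dom.open_S x \<psi>_\<phi>])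
  from has_derivative_unique[OF this has_derivative_ident] show ?thesis by metis
qed

lemma J_surj:
  assumes x: "x \<in> S"
  obtains v where "J x v = w"
proof -
  have "inj (J x)" using J_left_inverse[OF x] by (metis injI)
  then have "surj (J x)" by (rule eucl.linear_inj_imp_surj[OF linear_J[OF x]])
  then show ?thesis using that by (metis surjD)
qed

lemma J_right_inverse:
  assumes x: "x \<in> S"
  shows "J x (frechet_derivative \<psi> (at (\<phi> x)) w) = w"
  using J_left_inverse[OF x] J_surj[OF x] by metis

lemma diff_J: "x \<in> S \<Longrightarrow> (\<lambda>y. J y v) differentiable at x"
  by (rule smooth_on_imp_differentiable[OF dom.open_S smooth_on_frechet_derivative[OF dom.open_S smooth_\<phi>]])

lemma J_field:
  assumes x: "x \<in> S" and W: "W differentiable at x"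
  shows "(\<lambda>y. J y (W y)) differentiable at x"
    and "frechet_derivative (\<lambda>y. J y (W y)) (at x) u
      = frechet_derivative (\<lambda>y. J y (W x)) (at x) u + J x (frechet_derivative W (at x) u)"
proof -
  have "\<forall>y\<in>S. linear (J y)" using linear_J by blast
  note frechet_derivative_bounded_linear_family[where F = J and S = S, OF this dom.open_S x diff_J[OF x] W]
  then show "(\<lambda>y. J y (W y)) differentiable at x"
    "frechet_derivative (\<lambda>y. J y (W y)) (at x) u
      = frechet_derivative (\<lambda>y. J y (W x)) (at x) u + J x (frechet_derivative W (at x) u)"
    by auto
qed

text \<open>The right-hand side, pulled back by \<open>J x\<close>, is torsion-free because second
  derivatives of \<phi> are symmetric, and compatible with \<open>G\<close> because \<open>G\<close>
  is the pullback of \<open>H\<close>. Uniqueness identifies it with \<open>Gam G x\<close>.\<close>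

lemma christoffel_transform:
  assumes x: "x \<in> S"
  shows "J x (Gam G x u v) = Gam H (\<phi> x) (J x u) (J x v) + frechet_derivative (\<lambda>y. J y v) (at x) u"
proof -
  let ?d = "\<lambda>v u. frechet_derivative (\<lambda>y. J y v) (at x) u"
  define K where "K = frechet_derivative \<psi> (at (\<phi> x))"
  define T where "T u v = K (Gam H (\<phi> x) (J x u) (J x v) + ?d v u)" for u v
  have JT: "J x (T u v) = Gam H (\<phi> x) (J x u) (J x v) + ?d v u" for u v
    unfolding T_def K_def by (rule J_right_inverse[OF x])
  have "T u v = Gam G x u v"
  proof (rule dom.Gam_unique[OF x])
    fix u v w
    show "T u v = T v u" unfolding T_def
      using cod.Gam_commute[OF \<phi>_in[OF x], of "J x u" "J x v"]
        symmetric_second_frechet_derivative[OF dom.open_S x smooth_\<phi>, of u v] by simp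
    have dG: "G differentiable at x" by (rule smooth_on_imp_differentiable[OF dom.open_S dom.smooth_G x])
    have bl: "bounded_linear (\<lambda>M::real^'n^'n. u \<bullet> (M *v v))"
      using bounded_linear_compose[OF bounded_linear_inner_right
        bounded_bilinear.bounded_linear_left[OF bounded_bilinear_matrix_vector_mult]] .
    note dH = smooth_on_has_derivative[OF cod.open_S cod.smooth_G \<phi>_in[OF x]]
    have H\<phi>: "((\<lambda>y. H (\<phi> y)) has_derivative (\<lambda>w. frechet_derivative H (at (\<phi> x)) (J x w))) (at x)"
      by (rule has_derivative_compose[OF smooth_on_has_derivative[OF dom.open_S smooth_\<phi> x] dH])
    note dJ = diff_J[OF x, unfolded frechet_derivative_works]
    note D = bounded_bilinear.FDERIV[OF bounded_bilinear_inner dJ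
        bounded_bilinear.FDERIV[OF bounded_bilinear_matrix_vector_mult H\<phi> dJ], of u v]
    have "u \<bullet> (frechet_derivative G (at x) w *v v) = frechet_derivative (\<lambda>y. u \<bullet> (G y *v v)) (at x) w"
      using frechet_derivative_bounded_linear[OF bl dG] by simp
    also have "\<dots> = frechet_derivative (\<lambda>y. J y u \<bullet> (H (\<phi> y) *v J y v)) (at x) w"
      by (rule frechet_derivative_cong_on[OF dom.open_S x isometry, THEN fun_cong])
    also have "\<dots> = J x u \<bullet> (H (\<phi> x) *v ?d v w + frechet_derivative H (at (\<phi> x)) (J x w) *v J x v)
        + ?d u w \<bullet> (H (\<phi> x) *v J x v)"
      using frechet_derivative_at[OF D, symmetric] by metis
    also have "\<dots> = J x (T w u) \<bullet> (H (\<phi> x) *v J x v) + J x u \<bullet> (H (\<phi> x) *v J x (T w v))"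
      unfolding JT
      by (simp add: inner_add_left inner_add_right matrix_vector_right_distrib cod.metric_compatible[OF \<phi>_in[OF x]])
    finally show "u \<bullet> (frechet_derivative G (at x) w *v v) = T w u \<bullet> (G x *v v) + u \<bullet> (G x *v T w v)"
      unfolding isometry[OF x] .
  qed
  then show ?thesis using JT[of u v] by simp
qed

text \<open>The second derivative of \<phi> produced by the product rule is exactly the
  inhomogeneous term of \<open>christoffel_transform\<close>, so the two cancel.\<close>

lemma covd_transform:
  assumes x: "x \<in> S" and W: "W differentiable at x" and V: "V differentiable at (\<phi> x)"
    and VW: "\<And>y. y \<in> S \<Longrightarrow> V (\<phi> y) = J y (W y)"
  shows "covd H (J x u) V (\<phi> x) = J x (covd G u W x)"
proof -
  have c: "((\<lambda>y. V (\<phi> y)) has_derivative (\<lambda>u. frechet_derivative V (at (\<phi> x)) (J x u))) (at x)"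
    by (rule has_derivative_compose[OF smooth_on_has_derivative[OF dom.open_S smooth_\<phi> x]])
       (use V frechet_derivative_works in blast)
  have "frechet_derivative V (at (\<phi> x)) (J x u) = frechet_derivative (\<lambda>y. V (\<phi> y)) (at x) u"
    using frechet_derivative_at[OF c] by metis
  also have "\<dots> = frechet_derivative (\<lambda>y. J y (W y)) (at x) u"
    by (rule frechet_derivative_cong_on[OF dom.open_S x VW, THEN fun_cong])
  finally have "frechet_derivative V (at (\<phi> x)) (J x u)
    = frechet_derivative (\<lambda>y. J y (W x)) (at x) u + J x (frechet_derivative W (at x) u)"
    unfolding J_field(2)[OF x W] .
  then show ?thesis
    unfolding covd_eq VW[OF x]
    by (simp add: linear_add[OF linear_J[OF x]] christoffel_transform[OF x])
qed

end

locale geodesic_isometry = metric_isometry S G T H \<phi> \<psi>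
    + dom: geodesic_chart S G X + cod: geodesic_chart T H Y
  for S :: "(real^'n::finite) set" and G and T :: "(real^'n) set" and H \<phi> \<psi> X Y +
  assumes Y_\<phi>: "\<And>x. x \<in> S \<Longrightarrow> Y (\<phi> x) = J x (X x)"
begin

lemma shape_transform: "x \<in> S \<Longrightarrow> cod.shape (\<phi> x) (J x v) = J x (dom.shape x v)"
  by (rule covd_transform[OF _ dom.diff_X cod.diff_X[OF \<phi>_in] Y_\<phi>])

text \<open>\<open>riccati_field\<close> reduces \<open>jac\<close> to covariant derivatives, for
  which \<open>covd_transform\<close> is available; second derivatives of the metric never have to
  be transformed.\<close>

lemma jac_transform:
  assumes x: "x \<in> S"
  shows "cod.jac (\<phi> x) (J x v) = J x (dom.jac x v)"
proof -
  \<comment> \<open>The field on \<open>T\<close> that corresponds to the constant field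
    \<open>v\<close> on \<open>S\<close>.\<close>
  define V where "V z = J (\<psi> z) v" for z
  have V\<phi>: "V (\<phi> y) = J y v" if "y \<in> S" for y
    unfolding V_def using \<psi>_\<phi>[OF that] by simp
  have sV: "smooth_on T V"
    unfolding V_def
    by (rule smooth_on_compose[OF cod.open_S dom.open_S smooth_on_frechet_derivative[OF dom.open_S smooth_\<phi>] smooth_\<psi> \<psi>_in])
  note y = \<phi>_in[OF x]
  note dV = smooth_on_imp_differentiable[OF cod.open_S sV y]
  have 1: "covd H (Y (\<phi> x)) V (\<phi> x) = J x (covd G (X x) (\<lambda>_. v) x)"
    unfolding Y_\<phi>[OF x] by (rule covd_transform[OF x _ dV V\<phi>]) auto
  have 2: "covd H (Y (\<phi> x)) (\<lambda>z. cod.shape z (V z)) (\<phi> x) = J x (covd G (X x) (\<lambda>y. dom.shape y v) x)"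
    unfolding Y_\<phi>[OF x]
    by (rule covd_transform[OF x])
       (auto simp: V\<phi> shape_transform intro!: smooth_on_imp_differentiable[OF dom.open_S dom.smooth_shape x]
          smooth_on_imp_differentiable[OF cod.open_S cod.smooth_covd[OF sV cod.smooth_X] y])
  have "cod.jac (\<phi> x) (V (\<phi> x)) = cod.shape (\<phi> x) (covd H (Y (\<phi> x)) V (\<phi> x))
      - covd H (Y (\<phi> x)) (\<lambda>z. cod.shape z (V z)) (\<phi> x) - cod.shape (\<phi> x) (cod.shape (\<phi> x) (V (\<phi> x)))"
    by (rule cod.riccati_field[OF y dV])
  also have "\<dots> = J x (dom.shape x (covd G (X x) (\<lambda>_. v) x) - covd G (X x) (\<lambda>y. dom.shape y v) x
      - dom.shape x (dom.shape x v))"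
    unfolding 1 2 V\<phi>[OF x] shape_transform[OF x] by (simp only: linear_diff[OF linear_J[OF x]])
  also have "\<dots> = J x (dom.jac x v)"
    by (rule arg_cong[where f = "J x"])
       (rule dom.riccati_field[OF x, where V = "\<lambda>_. v", OF differentiable_const, symmetric])
  finally show ?thesis by (simp only: V\<phi>[OF x])
qed

lemma J_matrix: "x \<in> S \<Longrightarrow> matrix (J x) *v v = J x v"
  by (simp add: matrix_works linear_J linear_matrix_vector_mul_eq)

lemma invertible_J: "x \<in> S \<Longrightarrow> invertible (matrix (J x))"
proof -
  assume x: "x \<in> S"
  have "v = 0" if "matrix (J x) *v v = 0" for v
    using J_left_inverse[OF x, of v] J_left_inverse[OF x, of 0] that
    by (simp add: J_matrix[OF x] linear_0[OF linear_J[OF x]])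
  then show ?thesis by (simp add: invertible_left_inverse matrix_left_invertible_ker)
qed

lemma shapeM_transform: "x \<in> S \<Longrightarrow> cod.shapeM (\<phi> x) ** matrix (J x) = matrix (J x) ** dom.shapeM x"
  by (rule matrix_eqI)
     (simp add: matrix_vector_mul_assoc[symmetric] J_matrix cod.shapeM_works[OF \<phi>_in] dom.shapeM_works shape_transform)

lemma jacM_transform: "x \<in> S \<Longrightarrow> cod.jacM (\<phi> x) ** matrix (J x) = matrix (J x) ** dom.jacM x"
  by (rule matrix_eqI)
     (simp add: matrix_vector_mul_assoc[symmetric] J_matrix cod.jacM_works[OF \<phi>_in] dom.jacM_works jac_transform)

lemma skewM_transform: "x \<in> S \<Longrightarrow> J x w \<bullet> (cod.skewM (\<phi> x) *v J x v) = w \<bullet> (dom.skewM x *v v)"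
  by (simp add: cod.skewM_inner[OF \<phi>_in] dom.skewM_inner shape_transform isometry)

lemma skewM_zero_iff:
  assumes x: "x \<in> S"
  shows "cod.skewM (\<phi> x) = 0 \<longleftrightarrow> dom.skewM x = 0"
proof
  assume "cod.skewM (\<phi> x) = 0"
  then have "w \<bullet> (dom.skewM x *v v) = w \<bullet> (0 *v v)" for v w
    using skewM_transform[OF x, of w v] by simp
  then show "dom.skewM x = 0" by (rule matrix_eq_innerI)
next
  assume "dom.skewM x = 0"
  then have *: "J x w \<bullet> (cod.skewM (\<phi> x) *v J x v) = 0" for v w
    using skewM_transform[OF x, of w v] by simp
  have "w \<bullet> (cod.skewM (\<phi> x) *v v) = w \<bullet> (0 *v v)" for v w
  proof -
    obtain v' w' where "J x v' = v" "J x w' = w" using J_surj[OF x] by metis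
    then show ?thesis using *[of w' v'] by simp
  qed
  then show "cod.skewM (\<phi> x) = 0" by (rule matrix_eq_innerI)
qed

end

lemma trace_similar:
  fixes M N P :: "real^'n::finite^'n"
  assumes "invertible P" "M ** P = P ** N"
  shows "trace M = trace N"
proof -
  have "M = P ** N ** matrix_inv P"
    by (metis assms matrix_inv_inverse(1) matrix_mul_assoc matrix_mul_rid)
  then have "trace M = trace (matrix_inv P ** (P ** N))" by (simp add: trace_mul_sym[of "matrix_inv P"])
  also have "\<dots> = trace N" by (simp add: matrix_mul_assoc matrix_inv_inverse(2)[OF assms(1)])
  finally show ?thesis .
qed

lemma similar_mult:
  fixes M N :: "real^'n::finite^'n"
  shows "M ** P = P ** M' \<Longrightarrow> N ** P = P ** N' \<Longrightarrow> M ** N ** P = P ** (M' ** N')"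
  by (metis matrix_mul_assoc)

section \<open>Eigenframes and Riccati inequalities\<close>

context geodesic_chart
begin

text \<open>
  The Riccati equation expresses \<open>jac\<close> through \<open>shape\<close>, so that its symmetry follows by comparing
  the flow derivative of \<open>skewM\<close> computed in two ways.
\<close>

lemma jac_self_adjoint:
  assumes x: "x \<in> S"
  shows "w \<bullet> (G x *v jac x v) = v \<bullet> (G x *v jac x w)"
proof -
  let ?b = "\<lambda>v w. w \<bullet> (G x *v shape x v)"
  let ?\<Gamma> = "Gam G x (X x)"
  define J where "J = matrix (frechet_derivative X (at x))"
  have J: "J *v u = shape x u - ?\<Gamma> u" for u
    unfolding J_def using linear_DX[OF x] Gam_commute[OF x, of u "X x"]
    by (simp add: matrix_works linear_matrix_vector_mul_eq covd_eq)
  have dsk: "skewM differentiable at x" by (rule smooth_on_imp_differentiable[OF open_S smooth_skewM x])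
  have ds: "(\<lambda>y. shape y v) differentiable at x" for v
    by (rule smooth_on_imp_differentiable[OF open_S smooth_shape x])
  have Db: "frechet_derivative (\<lambda>y. w \<bullet> (G y *v shape y v)) (at x) (X x)
      = ?b v (?\<Gamma> w) + ?b (?\<Gamma> v) w - ?b (shape x v) w - w \<bullet> (G x *v jac x v)" for v w
    unfolding inner_G_derivative(2)[OF x differentiable_const ds]
    unfolding covd_eq[of G _ "\<lambda>_. w"] covd_eq[of G _ "\<lambda>y. shape y v"] riccati[OF x]
    by (simp add: inner_diff_right matrix_vector_mult_diff_distrib inner_add_right matrix_vector_right_distrib
        bounded_bilinear.minus_right[OF bounded_bilinear_matrix_vector_mult])
  have bl: "bounded_linear (\<lambda>M::real^'n^'n. w \<bullet> (M *v v))"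
    using bounded_linear_compose[OF bounded_linear_inner_right
      bounded_bilinear.bounded_linear_left[OF bounded_bilinear_matrix_vector_mult]] .
  have "w \<bullet> (frechet_derivative skewM (at x) (X x) *v v) = frechet_derivative (\<lambda>y. w \<bullet> (skewM y *v v)) (at x) (X x)"
    using frechet_derivative_bounded_linear[OF bl dsk] by simp
  also have "\<dots> = frechet_derivative (\<lambda>y. w \<bullet> (G y *v shape y v) - v \<bullet> (G y *v shape y w)) (at x) (X x)"
    by (rule frechet_derivative_cong_on[OF open_S x skewM_inner, THEN fun_cong])
  also have "\<dots> = ?b v (?\<Gamma> w) + ?b (?\<Gamma> v) w - ?b (shape x v) w - w \<bullet> (G x *v jac x v)
     - (?b w (?\<Gamma> v) + ?b (?\<Gamma> w) v - ?b (shape x w) v - v \<bullet> (G x *v jac x w))"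
    unfolding Db[symmetric]
    by (rule frechet_derivative_diff; rule inner_G_derivative(1)[OF x differentiable_const ds])
  finally have 1: "w \<bullet> (frechet_derivative skewM (at x) (X x) *v v) = \<dots>" .
  have 2: "w \<bullet> (frechet_derivative skewM (at x) (X x) *v v)
      = - (w \<bullet> (skewM x *v (J *v v))) - (J *v w) \<bullet> (skewM x *v v)"
    unfolding skewM_invariant[OF x] J_def[symmetric]
    by (simp add: matrix_vector_mult_diff_rdistrib inner_diff_right inner_transpose_mult inner_commute[of _ "J *v w"]
        bounded_bilinear.minus_left[OF bounded_bilinear_matrix_vector_mult] matrix_vector_mul_assoc[symmetric]
        del: transpose_matrix_vector)
  \<comment> \<open>The pair of terms quadratic in \<open>shape\<close> that occurs only in
    \<open>2\<close> cancels by this; all other terms of \<open>1\<close> and \<open>2\<close>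
    agree, except for the two containing \<open>jac\<close>.\<close>
  have 3: "shape x v \<bullet> (G x *v shape x w) = shape x w \<bullet> (G x *v shape x v)"
    by (rule G_commute[OF x])
  note lin = linear_diff[OF linear_shape[OF x]]
  show ?thesis
    using 1 3 unfolding 2 J skewM_inner[OF x]
    by (simp add: lin inner_diff_left inner_diff_right matrix_vector_mult_diff_distrib)
qed

lemma jac_orthogonal:
  assumes x: "x \<in> S"
  shows "jac x v \<bullet> (G x *v X x) = 0"
  using jac_self_adjoint[OF x, of "X x" v] G_commute[OF x, of "jac x v" "X x"] by (simp add: jac_X)

end

text \<open>The matrix, in a frame starting with \<open>X\<close>, of an operator that kills
  \<open>X\<close> and takes values orthogonal to \<open>X\<close>. The zero row and column make its
  trace that of a 2x2 matrix.\<close>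

definition block :: "real \<Rightarrow> real \<Rightarrow> real \<Rightarrow> real \<Rightarrow> real^3^3" where
  "block a b c d = vector [vector [0, 0, 0], vector [0, a, b], vector [0, c, d]]"

lemma block_mult: "block a b c d ** block a' b' c' d'
  = block (a * a' + b * c') (a * b' + b * d') (c * a' + d * c') (c * b' + d * d')"
  by (simp add: block_def vec_eq_iff forall_3 matrix_matrix_mult_def sum_3)

lemma trace_block: "trace (block a b c d) = a + d"
  by (simp add: block_def trace_def sum_3)

lemma block_mult_vec: "block a b c d *v w = vector [0, a * w $ 2 + b * w $ 3, c * w $ 2 + d * w $ 3]"
  by (simp add: block_def vec_eq_iff forall_3 matrix_vector_mult_def sum_3)

locale orthonormal_frame =
  fixes M :: "real^3^3" and X e f :: "real^3"
  assumes sym: "\<And>u v. u \<bullet> (M *v v) = v \<bullet> (M *v u)"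
    and pos: "\<And>v. v \<noteq> 0 \<Longrightarrow> v \<bullet> (M *v v) > 0"
    and X: "X \<bullet> (M *v X) = 1" and e: "e \<bullet> (M *v e) = 1" and f: "f \<bullet> (M *v f) = 1"
    and Xe: "X \<bullet> (M *v e) = 0" and Xf: "X \<bullet> (M *v f) = 0" and ef: "e \<bullet> (M *v f) = 0"
begin

lemma orth': "e \<bullet> (M *v X) = 0" "f \<bullet> (M *v X) = 0" "f \<bullet> (M *v e) = 0"
  using Xe Xf ef sym by metis+

definition P :: "real^3^3" where "P = matrix (\<lambda>w. w $ 1 *\<^sub>R X + w $ 2 *\<^sub>R e + w $ 3 *\<^sub>R f)"

lemma P_works: "P *v w = w $ 1 *\<^sub>R X + w $ 2 *\<^sub>R e + w $ 3 *\<^sub>R f"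
proof -
  have "linear (\<lambda>w::real^3. w $ 1 *\<^sub>R X + w $ 2 *\<^sub>R e + w $ 3 *\<^sub>R f)"
    by (rule linearI) (simp_all add: algebra_simps)
  then show ?thesis unfolding P_def by (simp add: linear_matrix_vector_mul_eq matrix_works)
qed

lemma P_coordinates:
  "X \<bullet> (M *v (P *v w)) = w $ 1" "e \<bullet> (M *v (P *v w)) = w $ 2" "f \<bullet> (M *v (P *v w)) = w $ 3"
  by (simp_all add: P_works matrix_vector_right_distrib matrix_vector_mult_scaleR inner_add_right
      X e f Xe Xf ef orth')

lemma invertible_P: "invertible P"
proof -
  have "w = 0" if "P *v w = 0" for w
    using P_coordinates[of w] that by (simp add: vec_eq_iff forall_3)
  then show ?thesis by (simp add: invertible_left_inverse matrix_left_invertible_ker)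
qed

lemma expansion: "v = (X \<bullet> (M *v v)) *\<^sub>R X + (e \<bullet> (M *v v)) *\<^sub>R e + (f \<bullet> (M *v v)) *\<^sub>R f"
proof -
  obtain w where "v = P *v w"
    using invertible_P by (metis matrix_inv_inverse(1) matrix_vector_mul_assoc matrix_vector_mul_lid)
  then show ?thesis using P_coordinates[of w] by (simp add: P_works)
qed

lemma similar_block:
  assumes "N *v X = 0" "\<And>v. X \<bullet> (M *v (N *v v)) = 0"
  shows "N ** P = P ** block (e \<bullet> (M *v (N *v e))) (e \<bullet> (M *v (N *v f))) (f \<bullet> (M *v (N *v e))) (f \<bullet> (M *v (N *v f)))"
proof (rule matrix_eqI)
  fix w
  let ?b = "\<lambda>u v. u \<bullet> (M *v (N *v v))"
  have N: "N *v v = ?b e v *\<^sub>R e + ?b f v *\<^sub>R f" for v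
    by (subst expansion) (simp add: assms(2))
  have "N *v (P *v w) = w $ 2 *\<^sub>R (N *v e) + w $ 3 *\<^sub>R (N *v f)"
    by (simp add: P_works matrix_vector_right_distrib matrix_vector_mult_scaleR assms(1))
  also have "\<dots> = w $ 2 *\<^sub>R (?b e e *\<^sub>R e + ?b f e *\<^sub>R f) + w $ 3 *\<^sub>R (?b e f *\<^sub>R e + ?b f f *\<^sub>R f)"
    by (simp only: N[of e, symmetric] N[of f, symmetric])
  also have "\<dots> = P *v (block (?b e e) (?b e f) (?b f e) (?b f f) *v w)"
    unfolding P_works block_mult_vec by (simp add: algebra_simps)
  finally show "(N ** P) *v w = (P ** block (?b e e) (?b e f) (?b f e) (?b f f)) *v w"
    by (simp only: matrix_vector_mul_assoc[symmetric])
qed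

end

text \<open>Gram-Schmidt starting from \<open>X\<close>, each time with a vector outside the span of
  those already found; such a vector exists by dimension.\<close>

lemma exists_orthonormal_frame:
  fixes M :: "real^3^3"
  assumes sym: "\<And>u v. u \<bullet> (M *v v) = v \<bullet> (M *v u)"
    and pos: "\<And>v. v \<noteq> 0 \<Longrightarrow> v \<bullet> (M *v v) > 0" and X: "X \<bullet> (M *v X) = 1"
  obtains e f where "orthonormal_frame M X e f"
proof -
  have normalize: "\<exists>u. u \<in> N \<and> u \<bullet> (M *v u) = 1" if "v \<in> N" "v \<noteq> 0" "subspace N" for v N
  proof (intro exI conjI)
    let ?u = "(1 / sqrt (v \<bullet> (M *v v))) *\<^sub>R v"
    show "?u \<in> N" using that by (simp add: subspace_scale)
    show "?u \<bullet> (M *v ?u) = 1"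
      using pos[OF that(2)] by (simp add: matrix_vector_mult_scaleR field_simps)
  qed
  have sub: "subspace {v. u \<bullet> (M *v v) = 0}" for u
    by (auto simp: subspace_def matrix_vector_right_distrib inner_add_right matrix_vector_mult_scaleR)
  have notspan: "\<exists>v::real^3. v \<notin> span {a, b}" for a b
  proof (rule ccontr)
    assume "\<not> ?thesis"
    then have "span {a, b} = (UNIV :: (real^3) set)" by auto
    then have "dim (UNIV :: (real^3) set) \<le> card {a, b}" by (metis dim_le_card finite.emptyI finite_insert order_refl)
    also have "\<dots> \<le> 2" by (simp add: card_insert_if)
    finally show False by (simp)
  qed
  \<comment> \<open>\<open>notspan\<close> speaks of pairs, so \<open>X\<close> is repeated to get
    the span of a single vector.\<close>
  obtain v where v: "v \<notin> span {X, X}" using notspan by blast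
  let ?v = "v - (X \<bullet> (M *v v)) *\<^sub>R X"
  have v0: "?v \<noteq> 0" using v by (metis eq_iff_diff_eq_0 insertI1 span_base span_scale)
  have "?v \<in> {v. X \<bullet> (M *v v) = 0}"
    by (simp add: matrix_vector_mult_diff_distrib matrix_vector_mult_scaleR inner_diff_right X)
  from normalize[OF this v0 sub] obtain e where e: "X \<bullet> (M *v e) = 0" "e \<bullet> (M *v e) = 1" by auto
  obtain w where w: "w \<notin> span {X, e}" using notspan by blast
  let ?w = "w - (X \<bullet> (M *v w)) *\<^sub>R X - (e \<bullet> (M *v w)) *\<^sub>R e"
  have w0: "?w \<noteq> 0"
  proof
    assume "?w = 0"
    then have "w = (X \<bullet> (M *v w)) *\<^sub>R X + (e \<bullet> (M *v w)) *\<^sub>R e" by (simp add: algebra_simps)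
    then show False using w by (metis insertI1 insertI2 span_add span_base span_scale)
  qed
  have "?w \<in> {v. X \<bullet> (M *v v) = 0} \<inter> {v. e \<bullet> (M *v v) = 0}"
    using sym[of e X] e
    by (simp add: matrix_vector_mult_diff_distrib matrix_vector_mult_scaleR inner_diff_right X)
  from normalize[OF this w0 subspace_inter[OF sub sub]]
  obtain f where "X \<bullet> (M *v f) = 0" "e \<bullet> (M *v f) = 0" "f \<bullet> (M *v f) = 1" by auto
  with e have "orthonormal_frame M X e f" by unfold_locales (use sym pos X in auto)
  then show ?thesis by (rule that)
qed

text \<open>\<open>k\<close> is the larger eigenvalue; by the trace, \<open>a + c - k\<close> is the
  other one.\<close>

lemma symmetric_2x2_eigenvector:
  fixes a b c :: real
  obtains p q k where "p\<^sup>2 + q\<^sup>2 = 1" "a * p + b * q = k * p" "b * p + c * q = k * q" "k \<ge> a + c - k"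
proof (cases "b = 0")
  case True
  show ?thesis
  proof (cases "a \<ge> c")
    case True then show ?thesis using that[of 1 0 a] \<open>b = 0\<close> by simp
  next
    case False then show ?thesis using that[of 0 1 c] \<open>b = 0\<close> by simp
  qed
next
  case False
  \<comment> \<open>\<open>k\<close> is the larger root of the characteristic polynomial,
    \<open>(b, k - a)\<close> an eigenvector for it, nonzero since \<open>b\<close> is, and
    \<open>n\<close> its length.\<close>
  define D where "D = sqrt ((a - c)\<^sup>2 + 4 * b\<^sup>2)"
  define k where "k = (a + c + D) / 2"
  define n where "n = sqrt (b\<^sup>2 + (k - a)\<^sup>2)"
  have n: "n > 0" using False unfolding n_def by (simp add: sum_power2_gt_zero_iff)
  have D2: "D * D = (a - c)\<^sup>2 + 4 * b\<^sup>2" unfolding D_def by simp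
  have k: "(k - a) * (k - c) = b * b"
    unfolding k_def using D2 by (simp add: field_simps power2_eq_square)
  show ?thesis
  proof (rule that[of "b / n" "(k - a) / n" k])
    have "n\<^sup>2 = b\<^sup>2 + (k - a)\<^sup>2" unfolding n_def by simp
    then show "(b / n)\<^sup>2 + ((k - a) / n)\<^sup>2 = 1" using n False
      by (simp add: power_divide add_divide_distrib[symmetric])
    show "a * (b / n) + b * ((k - a) / n) = k * (b / n)" using n by (simp add: field_simps)
    show "b * (b / n) + c * ((k - a) / n) = k * ((k - a) / n)" using n k by (simp add: field_simps)
    have "D \<ge> 0" unfolding D_def by simp
    then show "k \<ge> a + c - k" unfolding k_def by (simp add: field_simps)
  qed
qed

text \<open>A rotation of an orthonormal frame of the complement of \<open>X\<close> diagonalizes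
  \<open>R\<close>, while \<open>B\<close> stays merely symmetric, with off-diagonal entry
  \<open>b\<close>. The first four traces are those to be differentiated along the flow; the last
  two occur in their derivatives.\<close>

lemma exists_eigenframe:
  fixes M B R :: "real^3^3"
  assumes sym: "\<And>u v. u \<bullet> (M *v v) = v \<bullet> (M *v u)"
    and pos: "\<And>v. v \<noteq> 0 \<Longrightarrow> v \<bullet> (M *v v) > 0" and X: "X \<bullet> (M *v X) = 1"
    and BX: "B *v X = 0" "\<And>v. X \<bullet> (M *v (B *v v)) = 0"
    and RX: "R *v X = 0" "\<And>v. X \<bullet> (M *v (R *v v)) = 0"
    and Bsym: "\<And>u v. u \<bullet> (M *v (B *v v)) = v \<bullet> (M *v (B *v u))"
    and Rsym: "\<And>u v. u \<bullet> (M *v (R *v v)) = v \<bullet> (M *v (R *v u))"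
  obtains e f k l a b d where "orthonormal_frame M X e f" "k \<ge> l"
    "R *v e = k *\<^sub>R e" "R *v f = l *\<^sub>R f" "B *v e = a *\<^sub>R e + b *\<^sub>R f"
    "trace B = a + d" "trace R = k + l" "trace (R ** R) = k\<^sup>2 + l\<^sup>2" "trace (B ** R) = k * a + l * d"
    "trace (B ** B) = a\<^sup>2 + 2 * b\<^sup>2 + d\<^sup>2" "trace (B ** B ** R) = k * (a\<^sup>2 + b\<^sup>2) + l * (b\<^sup>2 + d\<^sup>2)"
proof -
  obtain e0 f0 where "orthonormal_frame M X e0 f0" using exists_orthonormal_frame[OF sym pos X] .
  then interpret F0: orthonormal_frame M X e0 f0 .
  define r where "r u v = u \<bullet> (M *v (R *v v))" for u v
  obtain p q k where pq: "p\<^sup>2 + q\<^sup>2 = 1" "r e0 e0 * p + r e0 f0 * q = k * p"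
    "r e0 f0 * p + r f0 f0 * q = k * q" "k \<ge> r e0 e0 + r f0 f0 - k"
    using symmetric_2x2_eigenvector .
  define l where "l = r e0 e0 + r f0 f0 - k"
  define e where "e = p *\<^sub>R e0 + q *\<^sub>R f0"
  define f where "f = (- q) *\<^sub>R e0 + p *\<^sub>R f0"
  note exp = matrix_vector_right_distrib matrix_vector_mult_scaleR inner_add_right inner_add_left
    matrix_vector_mult_diff_distrib inner_diff_right inner_diff_left
  have fr: "orthonormal_frame M X e f"
    using pq(1) unfolding e_def f_def
    by unfold_locales
       (simp_all add: F0.sym F0.pos X exp F0.e F0.f F0.ef F0.orth' F0.Xe F0.Xf power2_eq_square)
  interpret F: orthonormal_frame M X e f by (rule fr)
  have rs: "r f0 e0 = r e0 f0" unfolding r_def by (rule Rsym)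
  have r0: "r e e0 = k * p" "r e f0 = k * q" "r f e0 = - q * r e0 e0 + p * r e0 f0" "r f f0 = - q * r e0 f0 + p * r f0 f0"
    using pq(2,3) rs unfolding r_def e_def f_def by (simp_all add: exp mult_ac)
  have rl: "r u e = p * r u e0 + q * r u f0" "r u f = - q * r u e0 + p * r u f0" for u
    unfolding r_def e_def f_def by (simp_all add: exp)
  have ree: "r e e = k" "r e f = 0"
    unfolding rl r0 using pq(1) by (simp_all add: power2_eq_square algebra_simps) (metis distrib_left mult.right_neutral mult.assoc mult.commute)
  \<comment> \<open>The trace of \<open>r\<close> is unchanged by the rotation of the frame.\<close>
  have rff: "r f f = l"
  proof -
    have "r e0 e0 * p * p + 2 * (r e0 f0 * p * q) + r f0 f0 * q * q = k"
      using ree(1) unfolding rl e_def using pq(2,3) rs unfolding r_def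
      by (simp add: exp algebra_simps)
    moreover have "r f f = r e0 e0 * q * q - 2 * (r e0 f0 * p * q) + r f0 f0 * p * p"
      unfolding rl r0 by (simp add: algebra_simps)
    ultimately have "r f f + k = r e0 e0 * (p\<^sup>2 + q\<^sup>2) + r f0 f0 * (p\<^sup>2 + q\<^sup>2)"
      by (simp add: algebra_simps power2_eq_square)
    then show ?thesis unfolding pq(1) l_def by simp
  qed
  have rfe: "r f e = 0" using ree(2) Rsym unfolding r_def by metis
  define a b d where "a = e \<bullet> (M *v (B *v e))" and "b = e \<bullet> (M *v (B *v f))" and "d = f \<bullet> (M *v (B *v f))"
  have b': "f \<bullet> (M *v (B *v e)) = b" unfolding b_def by (rule Bsym)
  have B: "B ** F.P = F.P ** block a b b d"
    using F.similar_block[OF BX] unfolding a_def[symmetric] b_def[symmetric] d_def[symmetric] b' .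
  have R: "R ** F.P = F.P ** block k 0 0 l"
    using F.similar_block[OF RX] ree rff rfe unfolding r_def by simp
  have comp: "(N ** N') ** F.P = F.P ** (K ** K')" if "N ** F.P = F.P ** K" "N' ** F.P = F.P ** K'" for N N' K K'
    using that by (metis matrix_mul_assoc)
  note tr = trace_similar[OF F.invertible_P]
  show ?thesis
  proof (rule that[OF fr])
    show "k \<ge> l" unfolding l_def by (rule pq(4))
    show "R *v e = k *\<^sub>R e" using F.expansion[of "R *v e"] RX(2) ree rfe unfolding r_def by simp
    show "R *v f = l *\<^sub>R f" using F.expansion[of "R *v f"] RX(2) ree rff unfolding r_def by simp
    show "B *v e = a *\<^sub>R e + b *\<^sub>R f" using F.expansion[of "B *v e"] BX(2) b' unfolding a_def by simp
    show "trace B = a + d" "trace R = k + l" unfolding tr[OF B] tr[OF R] trace_block by auto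
    show "trace (R ** R) = k\<^sup>2 + l\<^sup>2" "trace (B ** R) = k * a + l * d"
      "trace (B ** B) = a\<^sup>2 + 2 * b\<^sup>2 + d\<^sup>2" "trace (B ** B ** R) = k * (a\<^sup>2 + b\<^sup>2) + l * (b\<^sup>2 + d\<^sup>2)"
      unfolding tr[OF comp[OF R R]] tr[OF comp[OF B R]] tr[OF comp[OF B B]] tr[OF comp[OF comp[OF B B] R]]
        block_mult trace_block
      by (simp_all add: power2_eq_square algebra_simps)
  qed
qed

section \<open>Comparison for Riccati inequalities and linear equations\<close>

text \<open>A nonzero solution would blow up in finite time, since \<open>1 / h\<close> grows at least linearly.\<close>

lemma negative_riccati_inequality_blow_up:
  fixes h h' :: "real \<Rightarrow> real"
  assumes h: "\<And>t. (h has_real_derivative h' t) (at t)" and c: "c > 0" "\<And>t. h' t \<le> - c * (h t)\<^sup>2"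
  shows "h s \<ge> 0"
proof (rule ccontr)
  assume "\<not> h s \<ge> 0"
  \<comment> \<open>\<open>h\<close> decreases, so it stays negative after \<open>s\<close> and
    \<open>1 / h\<close> is defined there.\<close>
  have dec: "h t \<le> h s" if "t \<ge> s" for t
  proof (rule DERIV_nonpos_imp_nonincreasing[OF that])
    fix x show "\<exists>y. (h has_real_derivative y) (at x) \<and> y \<le> 0"
      using h[of x] c(2)[of x] c(1) by (intro exI[of _ "h' x"]) (auto intro: order_trans)
  qed
  \<comment> \<open>The time at which the solution of \<open>h' = - c * h^2\<close> with the same
    value at \<open>s\<close> blows up: there the lower bound for \<open>1 / h\<close> reaches 0,
    although \<open>h\<close> is still negative.\<close>
  define t where "t = s - 1 / (c * h s)"
  have st: "s \<le> t" using \<open>\<not> h s \<ge> 0\<close> c(1) unfolding t_def by (simp add: divide_nonneg_neg field_simps mult_pos_neg)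
  have "inverse (h s) - c * s \<le> inverse (h t) - c * t"
  proof (rule DERIV_nonneg_imp_nondecreasing[OF st])
    fix x assume "s \<le> x"
    then have neg: "h x < 0" using dec[of x] \<open>\<not> h s \<ge> 0\<close> by simp
    have "((\<lambda>t. inverse (h t) - c * t) has_real_derivative - (inverse (h x) * h' x * inverse (h x)) - c) (at x)"
      using neg by (auto intro!: derivative_eq_intros h)
    moreover have "- (inverse (h x) * h' x * inverse (h x)) - c = (- h' x - c * (h x)\<^sup>2) / (h x)\<^sup>2"
      using neg by (simp add: field_simps power2_eq_square)
    moreover have "\<dots> \<ge> 0" using c(2)[of x] by simp
    ultimately show "\<exists>y. ((\<lambda>t. inverse (h t) - c * t) has_real_derivative y) (at x) \<and> y \<ge> 0"
      by metis
  qed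
  moreover have "c * t = c * s - inverse (h s)"
    using \<open>\<not> h s \<ge> 0\<close> c(1) unfolding t_def by (simp add: field_simps)
  ultimately have "inverse (h t) \<ge> 0" by simp
  then show False using dec[OF st] \<open>\<not> h s \<ge> 0\<close> by simp
qed

text \<open>The time-reversed function \<open>- h (- t)\<close> satisfies the same inequality, so
  the blow-up bounds \<open>h\<close> from both sides. The constant \<open>c\<close> will be 1 for a
  diagonal entry and 1/2 for the trace of a 2x2 operator.\<close>

lemma riccati_inequality_zero:
  fixes h h' :: "real \<Rightarrow> real"
  assumes h: "\<And>t. (h has_real_derivative h' t) (at t)" and c: "c > 0" "\<And>t. h' t \<le> - c * (h t)\<^sup>2"
  shows "h t = 0" "h' t = 0"
proof -
  have h0: "h t = 0" for t
  proof (rule antisym)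
    show "h t \<ge> 0" using negative_riccati_inequality_blow_up[OF h c] .
    have "((\<lambda>t. - h (- t)) has_real_derivative h' (- t)) (at t)" for t
      using DERIV_minus[OF DERIV_chain2[OF h[of "- t"] DERIV_minus[OF DERIV_ident]]] by simp
    from negative_riccati_inequality_blow_up[OF this c(1), of "- t"] c(2)
    show "h t \<le> 0" by simp
  qed
  show "h t = 0" by (rule h0)
  have "h = (\<lambda>_. 0)" using h0 by auto
  then show "h' t = 0" using h[of t] DERIV_unique DERIV_const by metis
qed

text \<open>Gronwall for \<open>|y|^2\<close> in both directions: multiplied by
  \<open>exp (- 2 * K * t)\<close> it cannot increase, multiplied by \<open>exp (2 * K * t)\<close>
  it cannot decrease, so a zero spreads to either side.\<close>

lemma linear_ode_zero:
  fixes y y' :: "real \<Rightarrow> 'a::real_inner"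
  assumes y: "\<And>t. t \<in> {a..b} \<Longrightarrow> (y has_vector_derivative y' t) (at t)"
    and K: "\<And>t. t \<in> {a..b} \<Longrightarrow> norm (y' t) \<le> K * norm (y t)"
    and s: "s \<in> {a..b}" "y s = 0" and t: "t \<in> {a..b}"
  shows "y t = 0"
proof -
  define n where "n t = y t \<bullet> y t" for t
  have n: "(n has_real_derivative 2 * (y t \<bullet> y' t)) (at t)" if "t \<in> {a..b}" for t
    unfolding n_def has_real_derivative_iff_has_vector_derivative
    using bounded_bilinear.has_vector_derivative[OF bounded_bilinear_inner y[OF that] y[OF that]]
    by (simp add: inner_commute)
  have b: "\<bar>y t \<bullet> y' t\<bar> \<le> K * n t" if "t \<in> {a..b}" for t
  proof -
    have "\<bar>y t \<bullet> y' t\<bar> \<le> norm (y t) * norm (y' t)" by (rule Cauchy_Schwarz_ineq2)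
    also have "\<dots> \<le> norm (y t) * (K * norm (y t))" using K[OF that] by (intro mult_left_mono) auto
    finally show ?thesis by (simp add: n_def dot_square_norm power2_eq_square mult_ac)
  qed
  have e: "((\<lambda>t. n t * exp (r * t)) has_real_derivative (2 * (y t \<bullet> y' t) + r * n t) * exp (r * t)) (at t)"
    if "t \<in> {a..b}" for t r
    by (auto intro!: derivative_eq_intros n[OF that] simp: algebra_simps)
  have "n t * exp (r * t) \<le> 0" if "r = (if s \<le> t then - (2 * K) else 2 * K)" for r
  proof (cases "s \<le> t")
    case True
    have "n t * exp (r * t) \<le> n s * exp (r * s)"
    proof (rule DERIV_nonpos_imp_nonincreasing[OF True])
      fix x assume "s \<le> x" "x \<le> t"
      then have x: "x \<in> {a..b}" using s t by auto
      show "\<exists>y. ((\<lambda>t. n t * exp (r * t)) has_real_derivative y) (at x) \<and> y \<le> 0"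
        using e[OF x, of r] b[OF x] True that by (auto simp: mult_nonpos_nonneg abs_le_iff intro!: exI)
    qed
    then show ?thesis using s by (simp add: n_def)
  next
    case False
    then have "t \<le> s" by simp
    have "n t * exp (r * t) \<le> n s * exp (r * s)"
    proof (rule DERIV_nonneg_imp_nondecreasing[OF \<open>t \<le> s\<close>])
      fix x assume "t \<le> x" "x \<le> s"
      then have x: "x \<in> {a..b}" using s t by auto
      show "\<exists>y. ((\<lambda>t. n t * exp (r * t)) has_real_derivative y) (at x) \<and> y \<ge> 0"
        using e[OF x, of r] b[OF x] False that by (intro exI) (auto simp: abs_le_iff)
    qed
    then show ?thesis using s by (simp add: n_def)
  qed
  then have "n t \<le> 0" by (metis exp_gt_zero mult_le_0_iff not_less order_less_imp_le)
  then show ?thesis unfolding n_def using inner_gt_zero_iff[of "y t"] by (metis not_less)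
qed

section \<open>Riemannian manifolds\<close>

text \<open>For a chart \<open>c\<close> around \<open>p\<close> this is the inverse of taking
  components in \<open>c\<close>, by \<open>tangent_of_self\<close> and
  \<open>tangent_of_eq\<close>.\<close>

definition tangent_of :: "('a, 'n::finite) chart set \<Rightarrow> ('a, 'n) chart \<Rightarrow> 'a \<Rightarrow> real^'n \<Rightarrow> ('a, 'n) tvec" where
  "tangent_of A c p w = (\<lambda>d. if d \<in> charts_at A p then chart_change c d p w else 0)"

locale riemannian_manifold =
  fixes A :: "('a::{t2_space,second_countable_topology}, 'n::finite) chart set"
    and g :: "('a, 'n) metric"
  assumes atlas: "smooth_atlas A" and metric: "riemannian_metric A g"
begin

lemma chartD:
  assumes "c \<in> A"
  shows "open (dom c)" "open (crd c ` dom c)" "homeomorphism (dom c) (crd c ` dom c) (crd c) (par c)"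
  using atlas assms unfolding smooth_atlas_def by auto

lemma charts_atD: "c \<in> charts_at A p \<Longrightarrow> c \<in> A" "c \<in> charts_at A p \<Longrightarrow> p \<in> dom c"
  and charts_atI: "c \<in> A \<Longrightarrow> p \<in> dom c \<Longrightarrow> c \<in> charts_at A p"
  unfolding charts_at_def by auto

lemma chart_exists: obtains c where "c \<in> charts_at A p"
proof -
  have "p \<in> (\<Union>c\<in>A. dom c)" using atlas unfolding smooth_atlas_def by simp
  then show ?thesis using that charts_atI by blast
qed

lemma par_crd: "c \<in> A \<Longrightarrow> p \<in> dom c \<Longrightarrow> par c (crd c p) = p"
  using homeomorphism_apply1[OF chartD(3)] .

lemma crd_par: "c \<in> A \<Longrightarrow> x \<in> crd c ` dom c \<Longrightarrow> crd c (par c x) = x"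
  using homeomorphism_apply2[OF chartD(3)] .

lemma par_dom: "c \<in> A \<Longrightarrow> x \<in> crd c ` dom c \<Longrightarrow> par c x \<in> dom c"
  using homeomorphism_image2[OF chartD(3)] by blast

lemma open_chart_image:
  assumes c: "c \<in> A" and U: "open U"
  shows "open (crd c ` (dom c \<inter> U))"
proof -
  have "crd c ` (dom c \<inter> U) = crd c ` dom c \<inter> par c -` U"
    using par_crd[OF c] crd_par[OF c] par_dom[OF c] by (auto simp: image_iff)
  moreover have "continuous_on (crd c ` dom c) (par c)"
    using chartD(3)[OF c] unfolding homeomorphism_def by blast
  ultimately show ?thesis
    using continuous_open_preimage[OF _ chartD(2)[OF c] U] by simp
qed

lemma smooth_transition: "c \<in> A \<Longrightarrow> d \<in> A \<Longrightarrow> smooth_on (crd c ` (dom c \<inter> dom d)) (\<lambda>x. crd d (par c x))"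
  using atlas unfolding smooth_atlas_def comp_def by blast

lemma transition_derivative:
  assumes "c \<in> charts_at A p" "d \<in> charts_at A p"
  shows "((\<lambda>x. crd d (par c x)) has_derivative chart_change c d p) (at (crd c p))"
  unfolding chart_change_def comp_def
  by (rule smooth_on_has_derivative[OF open_chart_image smooth_transition])
     (use assms charts_atD chartD(1) in auto)

lemma linear_chart_change: "c \<in> charts_at A p \<Longrightarrow> d \<in> charts_at A p \<Longrightarrow> linear (chart_change c d p)"
  using transition_derivative has_derivative_linear by blast

lemma chart_change_self:
  assumes c: "c \<in> charts_at A p"
  shows "chart_change c c p v = v"
proof -
  note A = charts_atD[OF c]
  have "((\<lambda>x. x) has_derivative chart_change c c p) (at (crd c p))"
    by (rule has_derivative_transform_within_open[OF transition_derivative[OF c c] chartD(2)[OF A(1)]])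
       (use A crd_par in auto)
  from has_derivative_unique[OF this has_derivative_ident] show ?thesis by metis
qed

lemma chart_change_trans:
  assumes c: "c \<in> charts_at A p" and d: "d \<in> charts_at A p" and e: "e \<in> charts_at A p"
  shows "chart_change d e p (chart_change c d p v) = chart_change c e p v"
proof -
  note cA = charts_atD[OF c] note dA = charts_atD[OF d]
  have pc: "par c (crd c p) = p" by (rule par_crd[OF cA])
  have "((\<lambda>x. crd e (par d (crd d (par c x)))) has_derivative (\<lambda>v. chart_change d e p (chart_change c d p v))) (at (crd c p))"
    by (rule has_derivative_compose[OF transition_derivative[OF c d]])
       (use transition_derivative[OF d e] in \<open>simp add: pc\<close>)
  then have "((\<lambda>x. crd e (par c x)) has_derivative (\<lambda>v. chart_change d e p (chart_change c d p v))) (at (crd c p))"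
    by (rule has_derivative_transform_within_open[OF _ open_chart_image[OF cA(1) chartD(1)[OF dA(1)]]])
       (use cA dA par_crd[OF cA(1)] par_crd[OF dA(1)] in auto)
  from has_derivative_unique[OF this transition_derivative[OF c e]] show ?thesis by metis
qed

lemma tangent_of_apply: "d \<in> charts_at A p \<Longrightarrow> tangent_of A c p w d = chart_change c d p w"
  by (simp add: tangent_of_def)

lemma tangent_of_in: "c \<in> charts_at A p \<Longrightarrow> tangent_of A c p w \<in> tangent_space A p"
  unfolding tangent_space_def by (auto simp: tangent_of_def chart_change_trans)

lemma tangent_of_self: "c \<in> charts_at A p \<Longrightarrow> tangent_of A c p w c = w"
  by (simp add: tangent_of_def chart_change_self)

lemma tangent_space_change: "c \<in> charts_at A p \<Longrightarrow> d \<in> charts_at A p \<Longrightarrow> v \<in> tangent_space A p \<Longrightarrow> v d = chart_change c d p (v c)"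
  unfolding tangent_space_def by blast

lemma tangent_of_eq:
  assumes "c \<in> charts_at A p" "v \<in> tangent_space A p"
  shows "tangent_of A c p (v c) = v"
proof (rule ext)
  fix d
  have "v d = 0" if "d \<notin> charts_at A p"
    using assms(2) that unfolding tangent_space_def by blast
  then show "tangent_of A c p (v c) d = v d"
    unfolding tangent_of_def using tangent_space_change[OF assms(1) _ assms(2)] by metis
qed

lemma tangent_of_linear:
  "c \<in> charts_at A p \<Longrightarrow> tangent_of A c p (a *\<^sub>R u + b *\<^sub>R v) = a *\<^sub>R tangent_of A c p u + b *\<^sub>R tangent_of A c p v"
  by (auto simp: tangent_of_def fun_eq_iff scaleR_fun_def linear_add[OF linear_chart_change] linear_cmul[OF linear_chart_change])

lemma coord_vec_eq: "coord_vec A c i p = tangent_of A c p (axis i 1)"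
  unfolding coord_vec_def tangent_of_def ..

lemma metricD:
  assumes "u \<in> tangent_space A p" "v \<in> tangent_space A p"
  shows "g p u v = g p v u" "w \<in> tangent_space A p \<Longrightarrow> g p (a *\<^sub>R u + b *\<^sub>R v) w = a * g p u w + b * g p v w"
    "u \<noteq> 0 \<Longrightarrow> g p u u > 0"
  using metric assms unfolding riemannian_metric_def by blast+

abbreviation MG :: "('a, 'n) chart \<Rightarrow> real^'n \<Rightarrow> real^'n^'n" where "MG c \<equiv> metric_matrix A g c"

lemma metric_tangent_of:
  assumes c: "c \<in> charts_at A p"
  shows "g p (tangent_of A c p u) (tangent_of A c p v) = u \<bullet> (MG c (crd c p) *v v)"
proof -
  note [simp] = tangent_of_in[OF c]
  define q where "q u v = g p (tangent_of A c p u) (tangent_of A c p v)" for u v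
  have sym: "q u v = q v u" for u v unfolding q_def by (rule metricD) simp_all
  have l2: "q (a *\<^sub>R u + b *\<^sub>R v) w = a * q u w + b * q v w" for a b u v w
    unfolding q_def tangent_of_linear[OF c] by (rule metricD) simp_all
  have lin: "linear (\<lambda>u. q u v)" for v
    using l2[of 1 _ 1 _ v] l2[of _ _ 0 0 v] by (intro linearI) simp_all
  have lin': "linear (q u)" for u
    using lin[of u] sym[of _ u] by simp
  have "q u v = q (\<Sum>i\<in>UNIV. u $ i *\<^sub>R axis i 1) (\<Sum>j\<in>UNIV. v $ j *\<^sub>R axis j 1)"
    by (simp only: basis_expansion scalar_mult_eq_scaleR[symmetric])
  also have "\<dots> = (\<Sum>i\<in>UNIV. \<Sum>j\<in>UNIV. u $ i * v $ j * q (axis i 1) (axis j 1))"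
    by (simp add: linear_sum[OF lin] linear_sum[OF lin'] linear_cmul[OF lin] linear_cmul[OF lin'] sum_distrib_left mult_ac)
       (rule sum.swap)
  also have "\<dots> = u \<bullet> (MG c (crd c p) *v v)"
    unfolding inner_sum_matrix metric_matrix_def coord_vec_eq
    using par_crd[OF charts_atD[OF c]] by (simp add: q_def)
  finally show ?thesis unfolding q_def .
qed

lemma metric_eq:
  assumes c: "c \<in> charts_at A p" and u: "u \<in> tangent_space A p" "v \<in> tangent_space A p"
  shows "g p u v = u c \<bullet> (MG c (crd c p) *v v c)"
  using metric_tangent_of[OF c, of "u c" "v c"] tangent_of_eq[OF c] u by simp

lemma metric_chart:
  assumes c: "c \<in> A"
  shows "metric_chart (crd c ` dom c) (MG c)"
proof
  show "open (crd c ` dom c)" by (rule chartD(2)[OF c])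
  show "smooth_on (crd c ` dom c) (MG c)" using metric c unfolding riemannian_metric_def by blast
next
  fix x assume "x \<in> crd c ` dom c"
  then obtain p where p: "p \<in> dom c" "x = crd c p" by auto
  note c' = charts_atI[OF c p(1)]
  note [simp] = tangent_of_in[OF c']
  show "transpose (MG c x) = MG c x"
    unfolding metric_matrix_def coord_vec_eq p(2) par_crd[OF c p(1)]
    by (auto simp: vec_eq_iff transpose_def intro!: metricD)
  fix v :: "real^'n" assume "v \<noteq> 0"
  then have "tangent_of A c p v \<noteq> 0" using tangent_of_self[OF c', of v] by auto
  then show "v \<bullet> (MG c x *v v) > 0"
    unfolding p(2) metric_tangent_of[OF c', symmetric] by (rule metricD(3)[OF tangent_of_in[OF c'] tangent_of_in[OF c', of v]])
qed

end

lemma metric_chart_subset: "metric_chart S G \<Longrightarrow> open T \<Longrightarrow> T \<subseteq> S \<Longrightarrow> metric_chart T G"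
  unfolding metric_chart_def using smooth_on_subset by blast

lemma geodesic_chart_subset: "geodesic_chart S G X \<Longrightarrow> open T \<Longrightarrow> T \<subseteq> S \<Longrightarrow> geodesic_chart T G X"
  unfolding geodesic_chart_def geodesic_chart_axioms_def using smooth_on_subset metric_chart_subset by blast

locale geodesic_manifold = riemannian_manifold A g
  for A :: "('a::{t2_space,second_countable_topology}, 'n::finite) chart set" and g +
  fixes X :: "'a \<Rightarrow> ('a, 'n) tvec"
  assumes geodesic: "geodesic_field A g X"
begin

lemma X_tangent: "X p \<in> tangent_space A p"
  using geodesic unfolding geodesic_field_def vector_field_on_def by blast

abbreviation CX :: "('a, 'n) chart \<Rightarrow> real^'n \<Rightarrow> real^'n" where "CX c \<equiv> \<lambda>x. X (par c x) c"

lemma CX_crd: "c \<in> charts_at A p \<Longrightarrow> CX c (crd c p) = X p c"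
  using par_crd charts_atD by metis

lemma geodesic_chart:
  assumes c: "c \<in> A"
  shows "geodesic_chart (crd c ` dom c) (MG c) (CX c)"
proof (intro geodesic_chart.intro geodesic_chart_axioms.intro metric_chart[OF c])
  show "smooth_on (crd c ` dom c) (CX c)"
    using geodesic c unfolding geodesic_field_def vector_field_on_def by (metis Int_UNIV_right)
next
  fix x assume "x \<in> crd c ` dom c"
  then obtain p where p: "p \<in> dom c" "x = crd c p" by auto
  note c' = charts_atI[OF c p(1)]
  show "CX c x \<bullet> (MG c x *v CX c x) = 1"
    using geodesic metric_eq[OF c' X_tangent X_tangent] unfolding geodesic_field_def p(2) CX_crd[OF c'] by simp
  have "nabla A g p (X p) X c = 0" using geodesic unfolding geodesic_field_def by (simp add: zero_fun_def)
  then show "covd (MG c) (CX c x) (CX c) x = 0"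
    unfolding nabla_def p(2) CX_crd[OF c'] using c' by simp
qed

text \<open>Both metric matrices represent the same \<open>g\<close>, and both coordinate fields the
  same \<open>X\<close>, so the coordinate change respects them on the overlap.\<close>

lemma geodesic_isometry:
  assumes c: "c \<in> A" and d: "d \<in> A"
  shows "geodesic_isometry (crd c ` (dom c \<inter> dom d)) (MG c) (crd d ` (dom c \<inter> dom d)) (MG d)
    (\<lambda>x. crd d (par c x)) (\<lambda>y. crd c (par d y)) (CX c) (CX d)"
proof -
  let ?S = "crd c ` (dom c \<inter> dom d)" and ?T = "crd d ` (dom c \<inter> dom d)"
  have o: "open ?S" "open ?T"
    using open_chart_image[OF c chartD(1)[OF d]] open_chart_image[OF d chartD(1)[OF c]] by (simp_all add: Int_commute)
  have "geodesic_chart ?S (MG c) (CX c)" "geodesic_chart ?T (MG d) (CX d)"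
    using geodesic_chart_subset[OF geodesic_chart[OF c] o(1)] geodesic_chart_subset[OF geodesic_chart[OF d] o(2)] by auto
  moreover have "metric_isometry ?S (MG c) ?T (MG d) (\<lambda>x. crd d (par c x)) (\<lambda>y. crd c (par d y))"
  proof (intro metric_isometry.intro metric_isometry_axioms.intro)
    show "metric_chart ?S (MG c)" "metric_chart ?T (MG d)"
      using metric_chart_subset[OF metric_chart[OF c] o(1)] metric_chart_subset[OF metric_chart[OF d] o(2)] by auto
    show "smooth_on ?S (\<lambda>x. crd d (par c x))" by (rule smooth_transition[OF c d])
    show "smooth_on ?T (\<lambda>y. crd c (par d y))" using smooth_transition[OF d c] by (simp add: Int_commute)
  next
    fix x u v assume "x \<in> ?S"
    then obtain p where p: "p \<in> dom c" "p \<in> dom d" "x = crd c p" by auto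
    note c' = charts_atI[OF c p(1)] and d' = charts_atI[OF d p(2)]
    have J: "frechet_derivative (\<lambda>x. crd d (par c x)) (at x) = chart_change c d p"
      unfolding chart_change_def comp_def p(3) ..
    have t: "tangent_of A c p w d = chart_change c d p w" for w by (rule tangent_of_apply[OF d'])
    show "u \<bullet> (MG c x *v v) = frechet_derivative (\<lambda>x. crd d (par c x)) (at x) u \<bullet>
           (MG d (crd d (par c x)) *v frechet_derivative (\<lambda>x. crd d (par c x)) (at x) v)"
      unfolding J unfolding p(3) par_crd[OF c p(1)] metric_tangent_of[OF c', symmetric]
        metric_eq[OF d' tangent_of_in[OF c'] tangent_of_in[OF c']] t ..
  qed (use par_crd[OF c] par_crd[OF d] in auto)
  moreover have "geodesic_isometry_axioms ?S (\<lambda>x. crd d (par c x)) (CX c) (CX d)"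
  proof
    fix x assume "x \<in> ?S"
    then obtain p where p: "p \<in> dom c" "p \<in> dom d" "x = crd c p" by auto
    note c' = charts_atI[OF c p(1)] and d' = charts_atI[OF d p(2)]
    show "CX d (crd d (par c x)) = frechet_derivative (\<lambda>x. crd d (par c x)) (at x) (CX c x)"
      using tangent_space_change[OF c' d' X_tangent] unfolding p(3) par_crd[OF c p(1)] par_crd[OF d p(2)]
      by (simp add: chart_change_def comp_def)
  qed
  ultimately show ?thesis unfolding geodesic_isometry_def by blast
qed

abbreviation BM :: "('a, 'n) chart \<Rightarrow> 'a \<Rightarrow> real^'n^'n" where
  "BM c p \<equiv> geodesic_chart.shapeM (MG c) (CX c) (crd c p)"
abbreviation RM :: "('a, 'n) chart \<Rightarrow> 'a \<Rightarrow> real^'n^'n" where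
  "RM c p \<equiv> geodesic_chart.jacM (MG c) (CX c) (crd c p)"
abbreviation OM :: "('a, 'n) chart \<Rightarrow> 'a \<Rightarrow> real^'n^'n" where
  "OM c p \<equiv> geodesic_chart.skewM (MG c) (CX c) (crd c p)"

lemma nabla_X:
  assumes c: "c \<in> charts_at A p"
  shows "nabla A g p v X c = BM c p *v v c"
proof -
  interpret geodesic_chart "crd c ` dom c" "MG c" "CX c" by (rule geodesic_chart[OF charts_atD(1)[OF c]])
  show ?thesis
    using c shapeM_works[of "crd c p" "v c"] charts_atD[OF c] by (simp add: nabla_def)
qed

lemma curvature_X:
  assumes c: "c \<in> charts_at A p"
  shows "curvature A g p v (X p) (X p) c = RM c p *v v c"
proof -
  interpret geodesic_chart "crd c ` dom c" "MG c" "CX c" by (rule geodesic_chart[OF charts_atD(1)[OF c]])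
  show ?thesis
    using c jacM_works[of "crd c p" "v c"] charts_atD[OF c] CX_crd[OF c] by (simp add: curvature_def)
qed

text \<open>One and the same \<open>P\<close>, the differential of the coordinate change, conjugates
  \<open>BM\<close> and \<open>RM\<close>, so traces of products of them do not depend on the chart.
  \<open>OM\<close> represents a bilinear form and is not conjugated; only its vanishing is carried
  over.\<close>

lemma matrix_transition:
  assumes c: "c \<in> charts_at A p" and d: "d \<in> charts_at A p"
  obtains P where "invertible P" "\<And>v. P *v v = chart_change c d p v"
    "BM d p ** P = P ** BM c p" "RM d p ** P = P ** RM c p" "OM d p = 0 \<longleftrightarrow> OM c p = 0"
proof -
  note cA = charts_atD[OF c] and dA = charts_atD[OF d]
  interpret geodesic_isometry "crd c ` (dom c \<inter> dom d)" "MG c" "crd d ` (dom c \<inter> dom d)" "MG d"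
    "\<lambda>x. crd d (par c x)" "\<lambda>y. crd c (par d y)" "CX c" "CX d"
    by (rule geodesic_isometry[OF cA(1) dA(1)])
  have x: "crd c p \<in> crd c ` (dom c \<inter> dom d)" using cA dA by auto
  have y: "crd d (par c (crd c p)) = crd d p" using par_crd[OF cA] by simp
  show ?thesis
    by (rule that[OF invertible_J[OF x]])
       (use J_matrix[OF x] shapeM_transform[OF x] jacM_transform[OF x] skewM_zero_iff[OF x]
        in \<open>simp_all add: y chart_change_def comp_def\<close>)
qed

lemma curvature_tangent:
  assumes v: "v \<in> tangent_space A p"
  shows "curvature A g p v (X p) (X p) \<in> tangent_space A p"
  unfolding tangent_space_def
proof (intro CollectI conjI ballI allI impI)
  fix c d assume c: "c \<in> charts_at A p" and d: "d \<in> charts_at A p"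
  obtain P where P: "\<And>v. P *v v = chart_change c d p v" "RM d p ** P = P ** RM c p"
    using matrix_transition[OF c d] by metis
  show "curvature A g p v (X p) (X p) d = chart_change c d p (curvature A g p v (X p) (X p) c)"
    unfolding curvature_X[OF c] curvature_X[OF d] tangent_space_change[OF c d v] P(1)[symmetric]
    using P(2) by (simp add: matrix_vector_mul_assoc)
next
  fix c assume "c \<notin> charts_at A p"
  then show "curvature A g p v (X p) (X p) c = 0" by (simp add: curvature_def)
qed

lemma jac_parallel_chart:
  assumes par: "jacobi_parallel A g X" and c: "c \<in> charts_at A p"
  shows "frechet_derivative (geodesic_chart.jacM (MG c) (CX c)) (at (crd c p)) (CX c (crd c p))
    = RM c p ** geodesic_chart.GamM (MG c) (CX c) (crd c p) - geodesic_chart.GamM (MG c) (CX c) (crd c p) ** RM c p"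
proof -
  note cA = charts_atD[OF c]
  interpret geodesic_chart "crd c ` dom c" "MG c" "CX c" by (rule geodesic_chart[OF cA(1)])
  have x: "crd c p \<in> crd c ` dom c" using cA by auto
  show ?thesis
  proof (rule jacM_parallel[OF x])
    fix w :: "real^'n"
    \<comment> \<open>The constant components \<open>w\<close>, projected orthogonally to
      \<open>X\<close>. The resulting section \<open>V\<close> over the chart domain is the test
      field inserted into the hypothesis.\<close>
    define W where "W y = w - (w \<bullet> (MG c y *v CX c y)) *\<^sub>R CX c y" for y
    define V where "V q = tangent_of A c q (W (crd c q))" for q
    have sW: "smooth_on (crd c ` dom c) W"
      unfolding W_def
      by (intro smooth_on_diff smooth_on_scaleR smooth_on_inner
          smooth_on_bilinear[OF _ bounded_bilinear_matrix_vector_mult] smooth_on_const smooth_X smooth_G open_S)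
    have Vc: "V (par c y) c = W y" if "y \<in> crd c ` dom c" for y
      unfolding V_def using tangent_of_self[OF charts_atI[OF cA(1) par_dom[OF cA(1) that]]] crd_par[OF cA(1) that] by simp
    have "vector_field_on A (dom c) V"
      unfolding vector_field_on_def
    proof (intro conjI ballI)
      fix q assume "q \<in> dom c"
      then show "V q \<in> tangent_space A q" unfolding V_def by (intro tangent_of_in charts_atI cA)
    next
      \<comment> \<open>Smoothness of a field is required in all charts of the atlas, so the
        components of \<open>V\<close> must also be followed into \<open>d\<close>.\<close>
      fix d assume d: "d \<in> A"
      let ?T = "crd d ` (dom d \<inter> dom c)" and ?S = "crd c ` (dom c \<inter> dom d)"
      have o: "open ?T" "open ?S" using open_chart_image[OF d chartD(1)[OF cA(1)]] open_chart_image[OF cA(1) chartD(1)[OF d]] .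
      have sm: "smooth_on ?T (\<lambda>x. frechet_derivative (\<lambda>x. crd d (par c x)) (at (crd c (par d x))) (W (crd c (par d x))))"
        by (rule smooth_on_frechet_derivative_app[OF o smooth_transition[OF cA(1) d] smooth_transition[OF d cA(1)]
              smooth_on_compose[OF o(1) open_S sW smooth_transition[OF d cA(1)]]])
           (use par_crd[OF d] in auto)
      have e: "frechet_derivative (\<lambda>x. crd d (par c x)) (at (crd c (par d x))) (W (crd c (par d x))) = V (par d x) d"
        if "x \<in> ?T" for x
        using that par_crd[OF d] d unfolding V_def tangent_of_def charts_at_def
        by (auto simp: chart_change_def comp_def)
      show "smooth_on ?T (\<lambda>x. V (par d x) d)"
        using sm smooth_on_cong[OF o(1) e] by simp
    qed
    moreover have "V q \<in> orth A g X q" if q: "q \<in> dom c" for q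
    proof -
      note c' = charts_atI[OF cA(1) q]
      have y: "crd c q \<in> crd c ` dom c" using q by auto
      have "g q (X q) (V q) = CX c (crd c q) \<bullet> (MG c (crd c q) *v W (crd c q))"
        unfolding V_def using metric_eq[OF c' X_tangent tangent_of_in[OF c']] tangent_of_self[OF c'] CX_crd[OF c'] by simp
      also have "\<dots> = 0"
        unfolding W_def using unit_X[OF y] G_commute[OF y, of w "CX c (crd c q)"]
        by (simp add: matrix_vector_mult_diff_distrib matrix_vector_mult_scaleR inner_diff_right)
      finally show ?thesis unfolding orth_def V_def using tangent_of_in[OF c'] by simp
    qed
    ultimately have "\<forall>p\<in>dom c. nabla A g p (X p) (\<lambda>q. jacobi_tensor A g X q (V q)) = jacobi_tensor A g X p (nabla A g p (X p) V)"
      using par[unfolded jacobi_parallel_def, rule_format, of "dom c" V] chartD(1)[OF cA(1)] by blast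
    then have "nabla A g p (X p) (\<lambda>q. jacobi_tensor A g X q (V q)) c = jacobi_tensor A g X p (nabla A g p (X p) V) c"
      using cA(2) by simp
    moreover have "nabla A g p (X p) V c = covd (MG c) (CX c (crd c p)) W (crd c p)"
      unfolding nabla_def covd_eq using c CX_crd[OF c] Vc[OF x]
        frechet_derivative_cong_on[OF open_S x, of "\<lambda>y. V (par c y) c" W] Vc by simp
    moreover have "nabla A g p (X p) (\<lambda>q. jacobi_tensor A g X q (V q)) c
       = covd (MG c) (CX c (crd c p)) (\<lambda>y. jac y (W y)) (crd c p)"
    proof -
      have j: "jacobi_tensor A g X (par c y) (V (par c y)) c = jac y (W y)" if "y \<in> crd c ` dom c" for y
        unfolding jacobi_tensor_def curvature_def
        using charts_atI[OF cA(1) par_dom[OF cA(1) that]] crd_par[OF cA(1) that] Vc[OF that] by simp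
      show ?thesis
        unfolding nabla_def covd_eq using c CX_crd[OF c] j[OF x]
          frechet_derivative_cong_on[OF open_S x j] by simp
    qed
    moreover have "jacobi_tensor A g X p u c = jac (crd c p) (u c)" for u
      unfolding jacobi_tensor_def curvature_def using c CX_crd[OF c] by simp
    ultimately show "covd (MG c) (CX c (crd c p)) (\<lambda>y. jac y (w - (w \<bullet> (MG c y *v CX c y)) *\<^sub>R CX c y)) (crd c p)
        = jac (crd c p) (covd (MG c) (CX c (crd c p)) (\<lambda>y. w - (w \<bullet> (MG c y *v CX c y)) *\<^sub>R CX c y) (crd c p))"
      unfolding W_def by simp
  qed
qed

end

section \<open>Flow lines\<close>

context geodesic_chart
begin

lemma dualM_component_derivative:
  assumes x: "x \<in> S"
  shows "frechet_derivative (\<lambda>y. dualM y $ j) (at x) u = frechet_derivative dualM (at x) u $ j"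
  by (rule frechet_derivative_bounded_linear[OF bounded_linear_vec_nth
        smooth_on_imp_differentiable[OF open_S smooth_dualM x]])

lemma X_skewM: "x \<in> S \<Longrightarrow> X x \<bullet> (skewM x *v w) = 0"
  using skewM_inner[of x "X x" w] shape_X[of x] shape_orthogonal[of x w] G_commute[of x] by simp

end

text \<open>Commuting with \<Gamma> is a derivation, so on a product it again produces a commutator,
  whose trace is 0. Thus the chart-dependent \<Gamma> drops out.\<close>

lemma trace_commutator_derivatives:
  fixes B R \<Gamma> :: "real^'n::finite^'n"
  assumes B': "B' = B ** \<Gamma> - \<Gamma> ** B - B ** B - R" and R': "R' = R ** \<Gamma> - \<Gamma> ** R"
  shows "trace B' = - trace (B ** B) - trace R" "trace R' = 0"
    "trace (R ** R' + R' ** R) = 0"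
    "trace (B ** R' + B' ** R) = - trace (B ** B ** R) - trace (R ** R)"
proof -
  note distribs = trace_add trace_sub
    bounded_bilinear.diff_left[OF bounded_bilinear_matrix_matrix_mult]
    bounded_bilinear.diff_right[OF bounded_bilinear_matrix_matrix_mult]
  show "trace B' = - trace (B ** B) - trace R" "trace R' = 0"
    unfolding B' R' distribs using trace_mul_sym[of B \<Gamma>] trace_mul_sym[of R \<Gamma>] by auto
  show "trace (R ** R' + R' ** R) = 0"
    unfolding R' distribs matrix_mul_assoc using trace_mul_sym[of "R ** R" \<Gamma>] by (simp add: matrix_mul_assoc)
  show "trace (B ** R' + B' ** R) = - trace (B ** B ** R) - trace (R ** R)"
    unfolding B' R' distribs matrix_mul_assoc using trace_mul_sym[of "B ** R" \<Gamma>] by (simp add: matrix_mul_assoc)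
qed

lemma bounded_linear_trace: "bounded_linear (trace :: real^'n::finite^'n \<Rightarrow> real)"
  by (intro linear_conv_bounded_linear[THEN iffD1] linearI)
     (simp_all add: trace_def sum.distrib sum_distrib_left)

context geodesic_manifold
begin

text \<open>The chosen chart is arbitrary and may jump with \<open>p\<close>; before
  differentiating, \<open>invariant_trace_eq\<close> replaces it by a chart fixed near the current
  time.\<close>

definition invariant_trace :: "(('a, 'n) chart \<Rightarrow> 'a \<Rightarrow> real^'n^'n) \<Rightarrow> 'a \<Rightarrow> real" where
  "invariant_trace M p = trace (M (SOME c. c \<in> charts_at A p) p)"

text \<open>The premise \<open>tr\<close> is meant for products of \<open>BM\<close> and
  \<open>RM\<close>, which are conjugated by any \<open>P\<close> that conjugates both
  factors.\<close>

lemma invariant_trace_eq: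
  assumes c: "c \<in> charts_at A p"
    and tr: "\<And>d P. d \<in> charts_at A p \<Longrightarrow> BM d p ** P = P ** BM c p \<Longrightarrow> RM d p ** P = P ** RM c p \<Longrightarrow>
      M d p ** P = P ** M c p"
  shows "invariant_trace M p = trace (M c p)"
proof -
  let ?d = "SOME c. c \<in> charts_at A p"
  have d: "?d \<in> charts_at A p" using someI[of "\<lambda>c. c \<in> charts_at A p", OF c] .
  obtain P where P: "invertible P" "BM ?d p ** P = P ** BM c p" "RM ?d p ** P = P ** RM c p"
    using matrix_transition[OF c d] by metis
  show ?thesis
    unfolding invariant_trace_def by (rule trace_similar[OF P(1) tr[OF d P(2,3)]])
qed

abbreviation "tr_B \<equiv> invariant_trace BM"
abbreviation "tr_R \<equiv> invariant_trace RM"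
abbreviation "tr_RR \<equiv> invariant_trace (\<lambda>c p. RM c p ** RM c p)"
abbreviation "tr_BR \<equiv> invariant_trace (\<lambda>c p. BM c p ** RM c p)"
abbreviation "tr_BB \<equiv> invariant_trace (\<lambda>c p. BM c p ** BM c p)"
abbreviation "tr_BBR \<equiv> invariant_trace (\<lambda>c p. BM c p ** BM c p ** RM c p)"

lemma invariant_traces:
  assumes c: "c \<in> charts_at A p"
  shows "tr_B p = trace (BM c p)" "tr_R p = trace (RM c p)" "tr_RR p = trace (RM c p ** RM c p)"
    "tr_BR p = trace (BM c p ** RM c p)" "tr_BB p = trace (BM c p ** BM c p)"
    "tr_BBR p = trace (BM c p ** BM c p ** RM c p)"
  by (rule invariant_trace_eq[OF c], (assumption | rule similar_mult)+)+

lemma flow_in_chart: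
  assumes \<gamma>: "integral_curve A X \<gamma>" and c: "c \<in> charts_at A (\<gamma> t)"
  shows "\<forall>\<^sub>F s in nhds t. c \<in> charts_at A (\<gamma> s)"
proof -
  have "open (\<gamma> -` dom c)"
    using \<gamma> chartD(1)[OF charts_atD(1)[OF c]] unfolding integral_curve_def by (metis open_vimage)
  then have "\<forall>\<^sub>F s in nhds t. s \<in> \<gamma> -` dom c" using charts_atD(2)[OF c] by (intro eventually_nhds_in_open) auto
  then show ?thesis by (rule eventually_mono) (use charts_atI[OF charts_atD(1)[OF c]] in simp)
qed

lemma flow_derivative:
  fixes F :: "real^'n \<Rightarrow> 'b::real_normed_vector"
  assumes \<gamma>: "integral_curve A X \<gamma>" and c: "c \<in> charts_at A (\<gamma> t)" and F: "smooth_on (crd c ` dom c) F"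
  shows "((\<lambda>s. F (crd c (\<gamma> s))) has_vector_derivative
    frechet_derivative F (at (crd c (\<gamma> t))) (CX c (crd c (\<gamma> t)))) (at t)"
proof -
  note cA = charts_atD[OF c]
  have F': "(F has_derivative frechet_derivative F (at (crd c (\<gamma> t)))) (at (crd c (\<gamma> t)))"
    by (rule smooth_on_has_derivative[OF chartD(2)[OF cA(1)] F]) (use cA(2) in auto)
  have "((\<lambda>s. crd c (\<gamma> s)) has_derivative (\<lambda>h. h *\<^sub>R CX c (crd c (\<gamma> t)))) (at t)"
    using \<gamma> c unfolding integral_curve_def has_vector_derivative_def CX_crd[OF c] by blast
  from has_derivative_compose[OF this F'] show ?thesis
    unfolding has_vector_derivative_def by (simp add: linear_cmul[OF has_derivative_linear[OF F']])
qed

lemma flow_trace_derivative: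
  assumes \<gamma>: "integral_curve A X \<gamma>" and c: "c \<in> charts_at A (\<gamma> t)" and F: "smooth_on (crd c ` dom c) F"
    and \<phi>: "\<And>p. c \<in> charts_at A p \<Longrightarrow> \<phi> p = trace (F (crd c p))"
  shows "((\<lambda>s. \<phi> (\<gamma> s)) has_real_derivative
    trace (frechet_derivative F (at (crd c (\<gamma> t))) (CX c (crd c (\<gamma> t))))) (at t)"
proof -
  have "((\<lambda>s. trace (F (crd c (\<gamma> s)))) has_real_derivative
    trace (frechet_derivative F (at (crd c (\<gamma> t))) (CX c (crd c (\<gamma> t))))) (at t)"
    unfolding has_real_derivative_iff_has_vector_derivative
    by (rule bounded_linear.has_vector_derivative[OF bounded_linear_trace flow_derivative[OF \<gamma> c F]])
  moreover have ev: "\<forall>\<^sub>F s in nhds t. \<phi> (\<gamma> s) = trace (F (crd c (\<gamma> s)))"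
    using flow_in_chart[OF \<gamma> c] by (rule eventually_mono) (rule \<phi>)
  ultimately show ?thesis unfolding DERIV_cong_ev[OF refl ev refl] by simp
qed

text \<open>The trace forms of the Riccati equation and of the parallelism of R. The system is not
  closed, but on an eigenframe \<open>tr_BB\<close> and \<open>tr_BBR\<close> are combinations of
  squares, which is what makes inequalities possible.\<close>

lemma flow_traces:
  assumes par: "jacobi_parallel A g X" and \<gamma>: "integral_curve A X \<gamma>"
  shows "((\<lambda>s. tr_B (\<gamma> s)) has_real_derivative - tr_BB (\<gamma> t) - tr_R (\<gamma> t)) (at t)"
    and "((\<lambda>s. tr_R (\<gamma> s)) has_real_derivative 0) (at t)"
    and "((\<lambda>s. tr_RR (\<gamma> s)) has_real_derivative 0) (at t)"
    and "((\<lambda>s. tr_BR (\<gamma> s)) has_real_derivative - tr_BBR (\<gamma> t) - tr_RR (\<gamma> t)) (at t)"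
proof -
  obtain c where c: "c \<in> charts_at A (\<gamma> t)" by (rule chart_exists)
  note cA = charts_atD[OF c]
  interpret geodesic_chart "crd c ` dom c" "MG c" "CX c" by (rule geodesic_chart[OF cA(1)])
  let ?x = "crd c (\<gamma> t)"
  have x: "?x \<in> crd c ` dom c" using cA by auto
  note D = flow_trace_derivative[OF \<gamma> c]
  note sm = smooth_on_bilinear[OF open_S bounded_bilinear_matrix_matrix_mult]
  note fd = frechet_derivative_bilinear[OF bounded_bilinear_matrix_matrix_mult]
  note tr = trace_commutator_derivatives[OF riccati_matrix[OF x] jac_parallel_chart[OF par c]]
  note iv = invariant_traces
  show "((\<lambda>s. tr_B (\<gamma> s)) has_real_derivative - tr_BB (\<gamma> t) - tr_R (\<gamma> t)) (at t)"
    using D[where \<phi> = tr_B, OF smooth_shapeM iv(1)] unfolding tr(1) iv[OF c] .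
  show "((\<lambda>s. tr_R (\<gamma> s)) has_real_derivative 0) (at t)"
    using D[where \<phi> = tr_R, OF smooth_jacM iv(2)] unfolding tr(2) .
  show "((\<lambda>s. tr_RR (\<gamma> s)) has_real_derivative 0) (at t)"
    using D[where \<phi> = tr_RR, OF sm[OF smooth_jacM smooth_jacM] iv(3)]
    unfolding fd[OF diff_jacM[OF x] diff_jacM[OF x]] tr(3) .
  show "((\<lambda>s. tr_BR (\<gamma> s)) has_real_derivative - tr_BBR (\<gamma> t) - tr_RR (\<gamma> t)) (at t)"
    using D[where \<phi> = tr_BR, OF sm[OF smooth_shapeM smooth_jacM] iv(4)]
    unfolding fd[OF diff_shapeM[OF x] diff_jacM[OF x]] tr(4) iv[OF c] .
qed

section \<open>Propagation of integrability along the flow\<close>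

text \<open>As \<open>d\<alpha>\<close> vanishes on \<open>X\<close>, this amounts to \<open>\<alpha> \<and> d\<alpha> = 0\<close> at \<open>p\<close>.\<close>

definition integrable_at :: "'a \<Rightarrow> bool" where
  "integrable_at p \<longleftrightarrow> (\<forall>c\<in>charts_at A p. OM c p = 0)"

lemma integrable_at_iff: "c \<in> charts_at A p \<Longrightarrow> integrable_at p \<longleftrightarrow> OM c p = 0"
  unfolding integrable_at_def using matrix_transition by metis

text \<open>Within a chart \<open>OM\<close> solves the linear equation of
  \<open>skewM_invariant\<close>, with coefficients bounded on a compact time interval. Hence it
  vanishes throughout that interval or nowhere in it.\<close>

lemma integrable_locally_constant:
  assumes \<gamma>: "integral_curve A X \<gamma>"
  shows "\<forall>\<^sub>F s in nhds t. integrable_at (\<gamma> s) = integrable_at (\<gamma> t)"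
proof -
  obtain c where c: "c \<in> charts_at A (\<gamma> t)" by (rule chart_exists)
  note cA = charts_atD[OF c]
  interpret geodesic_chart "crd c ` dom c" "MG c" "CX c" by (rule geodesic_chart[OF cA(1)])
  obtain e where e: "e > 0" "\<And>s. dist s t < e \<Longrightarrow> c \<in> charts_at A (\<gamma> s)"
    using flow_in_chart[OF \<gamma> c] unfolding eventually_nhds_metric by blast
  \<comment> \<open>Half of \<open>e\<close>, so that the closed interval lies within the times
    spent in the chart.\<close>
  define a b where "a = t - e / 2" and "b = t + e / 2"
  have I: "c \<in> charts_at A (\<gamma> s)" if "s \<in> {a..b}" for s
    using e that unfolding a_def b_def by (auto simp: dist_real_def)
  define J where "J x = matrix (frechet_derivative (CX c) (at x))" for x
  have sJ: "smooth_on (crd c ` dom c) J"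
    unfolding J_def by (intro smooth_on_matrix open_S smooth_on_frechet_derivative smooth_X)
  have tr: "bounded_linear (transpose :: real^'n^'n \<Rightarrow> _)"
    by (intro linear_conv_bounded_linear[THEN iffD1] linearI) (simp_all add: transpose_def vec_eq_iff)
  have bnd: "\<exists>K. \<forall>s\<in>{a..b}. norm (F (crd c (\<gamma> s))) \<le> K" if "smooth_on (crd c ` dom c) F" for F :: "real^'n \<Rightarrow> real^'n^'n"
  proof -
    have "continuous_on {a..b} (\<lambda>s. F (crd c (\<gamma> s)))"
      using flow_derivative[OF \<gamma> I that]
      by (meson continuous_at_imp_continuous_on has_vector_derivative_continuous)
    then have "bounded ((\<lambda>s. F (crd c (\<gamma> s))) ` {a..b})"
      by (intro compact_imp_bounded compact_continuous_image) auto
    then show ?thesis unfolding bounded_iff by auto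
  qed
  obtain K1 where K1: "\<And>s. s \<in> {a..b} \<Longrightarrow> norm (J (crd c (\<gamma> s))) \<le> K1" using bnd[OF sJ] by blast
  obtain K2 where K2: "\<And>s. s \<in> {a..b} \<Longrightarrow> norm (transpose (J (crd c (\<gamma> s)))) \<le> K2"
    using bnd[OF smooth_on_bounded_linear[OF open_S tr sJ]] by blast
  obtain K where K: "K > 0" "\<And>(M :: real^'n^'n) (N :: real^'n^'n). norm (M ** N) \<le> norm M * norm N * K"
    using bounded_bilinear.pos_bounded[OF bounded_bilinear_matrix_matrix_mult] by blast
  let ?y = "\<lambda>s. OM c (\<gamma> s)"
  let ?y' = "\<lambda>s. - (transpose (J (crd c (\<gamma> s))) ** ?y s + ?y s ** J (crd c (\<gamma> s)))"
  have y': "(?y has_vector_derivative ?y' s) (at s)" if "s \<in> {a..b}" for s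
    using flow_derivative[OF \<gamma> I[OF that] smooth_skewM] skewM_invariant[of "crd c (\<gamma> s)"] charts_atD[OF I[OF that]]
    unfolding J_def by simp
  have ny: "norm (?y' s) \<le> (K2 * K + K1 * K) * norm (?y s)" if s: "s \<in> {a..b}" for s
  proof -
    have "norm (?y' s) \<le> norm (transpose (J (crd c (\<gamma> s))) ** ?y s) + norm (?y s ** J (crd c (\<gamma> s)))"
      unfolding norm_minus_cancel by (rule norm_triangle_ineq)
    also have "\<dots> \<le> norm (transpose (J (crd c (\<gamma> s)))) * norm (?y s) * K + norm (?y s) * norm (J (crd c (\<gamma> s))) * K"
      by (rule add_mono[OF K(2) K(2)])
    also have "\<dots> \<le> K2 * norm (?y s) * K + norm (?y s) * K1 * K"
      using K1[OF s] K2[OF s] K(1) by (intro add_mono mult_right_mono mult_left_mono) auto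
    finally show ?thesis by (simp add: algebra_simps)
  qed
  have "integrable_at (\<gamma> s) = integrable_at (\<gamma> t)" if "s \<in> {a..b}" for s
  proof -
    have t: "t \<in> {a..b}" using e(1) unfolding a_def b_def by auto
    show ?thesis
      unfolding integrable_at_iff[OF c] integrable_at_iff[OF I[OF that]]
      using linear_ode_zero[OF y' ny that _ t] linear_ode_zero[OF y' ny t _ that] by metis
  qed
  moreover have "\<forall>\<^sub>F s in nhds t. s \<in> {a<..<b}"
    using e(1) unfolding a_def b_def by (intro eventually_nhds_in_open) auto
  ultimately show ?thesis by (auto elim!: eventually_mono)
qed

text \<open>A locally constant truth value on the connected real line is constant; this joins the
  charts along the flow line.\<close>

lemma integrable_along_flow:
  assumes \<gamma>: "integral_curve A X \<gamma>" and "integrable_at (\<gamma> s)"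
  shows "integrable_at (\<gamma> t)"
proof -
  have "integrable_at (\<gamma> s) = integrable_at (\<gamma> t)"
  proof (rule connected_local_const[OF connected_UNIV UNIV_I UNIV_I, where f = "\<lambda>s. integrable_at (\<gamma> s)"], rule ballI)
    fix u
    show "\<forall>\<^sub>F v in at u. integrable_at (\<gamma> u) = integrable_at (\<gamma> v)"
      using integrable_locally_constant[OF \<gamma>, of u] unfolding eventually_at_filter by (auto elim: eventually_mono)
  qed
  then show ?thesis using assms(2) by simp
qed

section \<open>The contact condition in a chart\<close>

lemma ext_deriv_skewM:
  assumes c: "c \<in> charts_at A p"
  shows "ext_deriv A c (\<lambda>p v. g p (X p) v) p u v = v c \<bullet> (OM c p *v u c)"
proof -
  note cA = charts_atD[OF c]
  interpret geodesic_chart "crd c ` dom c" "MG c" "CX c" by (rule geodesic_chart[OF cA(1)])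
  have x: "crd c p \<in> crd c ` dom c" using cA by auto
  let ?D = "frechet_derivative dualM (at (crd c p))"
  have lin: "linear ?D" by (rule linear_frechet_derivative[OF smooth_on_imp_differentiable[OF open_S smooth_dualM x]])
  have "g (par c y) (X (par c y)) (coord_vec A c j (par c y)) = dualM y $ j" if y: "y \<in> crd c ` dom c" for y j
  proof -
    note c' = charts_atI[OF cA(1) par_dom[OF cA(1) y]]
    have "g (par c y) (X (par c y)) (coord_vec A c j (par c y)) = CX c y \<bullet> (MG c y *v axis j 1)"
      unfolding coord_vec_eq metric_eq[OF c' X_tangent tangent_of_in[OF c']] tangent_of_self[OF c'] crd_par[OF cA(1) y] ..
    also have "\<dots> = dualM y $ j"
      unfolding G_commute[OF y] dualM_def by (simp add: inner_axis')
    finally show ?thesis .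
  qed
  then have p: "pderiv_at i (\<lambda>x. g (par c x) (X (par c x)) (coord_vec A c j (par c x))) (crd c p) = ?D (axis i 1) $ j" for i j
    unfolding pderiv_at_def dualM_component_derivative[OF x, symmetric]
    by (intro fun_cong[OF frechet_derivative_cong_on[OF open_S x]])
  have e: "(\<Sum>i\<in>UNIV. \<Sum>j\<in>UNIV. ?D (axis i 1) $ j * a $ i * b $ j) = ?D a \<bullet> b" for a b
  proof -
    have "?D a = ?D (\<Sum>i\<in>UNIV. a $ i *\<^sub>R axis i 1)" by (simp only: basis_expansion scalar_mult_eq_scaleR[symmetric])
    also have "\<dots> = (\<Sum>i\<in>UNIV. a $ i *\<^sub>R ?D (axis i 1))" by (simp add: linear_sum[OF lin] linear_cmul[OF lin])
    finally show ?thesis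
      by (simp add: inner_sum_left inner_vec_def sum_distrib_left mult_ac) (rule sum.swap)
  qed
  have "ext_deriv A c (\<lambda>p v. g p (X p) v) p u v
    = (\<Sum>i\<in>UNIV. \<Sum>j\<in>UNIV. ?D (axis i 1) $ j * u c $ i * v c $ j)
    - (\<Sum>i\<in>UNIV. \<Sum>j\<in>UNIV. ?D (axis j 1) $ i * u c $ i * v c $ j)"
    unfolding ext_deriv_def p by (simp add: left_diff_distrib sum_subtractf)
  also have "(\<Sum>i\<in>UNIV. \<Sum>j\<in>UNIV. ?D (axis j 1) $ i * u c $ i * v c $ j) = ?D (v c) \<bullet> u c"
    unfolding e[symmetric] by (subst sum.swap) (simp add: mult_ac)
  finally show ?thesis
    unfolding e skewM_exterior_derivative[OF x] .
qed

text \<open>With \<open>X p\<close> as first argument the wedge reduces to d\<alpha> of the other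
  two, since \<alpha>(X) = 1 and d\<alpha> vanishes on X.\<close>

lemma wedge_zero_imp_integrable:
  assumes c: "c \<in> charts_at A p"
    and w: "\<And>u v w. u \<in> tangent_space A p \<Longrightarrow> v \<in> tangent_space A p \<Longrightarrow> w \<in> tangent_space A p \<Longrightarrow>
      wedge_ext_deriv A c (\<lambda>p v. g p (X p) v) p u v w = 0"
  shows "integrable_at p"
proof -
  note cA = charts_atD[OF c]
  interpret geodesic_chart "crd c ` dom c" "MG c" "CX c" by (rule geodesic_chart[OF cA(1)])
  have x: "crd c p \<in> crd c ` dom c" using cA by auto
  have "a \<bullet> (OM c p *v b) = a \<bullet> (0 *v b)" for a b
  proof -
    note [simp] = tangent_of_self[OF c]
    have "v \<bullet> (OM c p *v X p c) = 0" "X p c \<bullet> (OM c p *v v) = 0" for v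
      using skewM_X[OF x] X_skewM[OF x] unfolding CX_crd[OF c] by auto
    moreover have "g p (X p) (X p) = 1" using geodesic unfolding geodesic_field_def by simp
    ultimately show ?thesis
      using w[OF X_tangent tangent_of_in[OF c] tangent_of_in[OF c], of b a]
      unfolding wedge_ext_deriv_def ext_deriv_skewM[OF c] by simp
  qed
  then show ?thesis unfolding integrable_at_iff[OF c] by (rule matrix_eq_innerI)
qed

end

text \<open>
  On an orthonormal frame diagonalizing the (constant) curvature, \<open>h\<close> is the diagonal entry of
  the shape operator belonging to the larger eigenvalue \<open>k\<close>, or its trace if both eigenvalues agree.
\<close>

lemma riccati_traces:
  fixes \<theta> \<tau> r q \<beta> \<rho> :: "real \<Rightarrow> real" and k l a b d :: "real \<Rightarrow> real"
  assumes \<theta>: "\<And>t. (\<theta> has_real_derivative - \<beta> t - r t) (at t)" and \<tau>: "\<And>t. (\<tau> has_real_derivative - \<rho> t - q t) (at t)"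
    and r: "\<And>t. (r has_real_derivative 0) (at t)" and q: "\<And>t. (q has_real_derivative 0) (at t)"
    and kl: "\<And>t. k t \<ge> l t" and tr: "\<And>t. \<theta> t = a t + d t" "\<And>t. r t = k t + l t" "\<And>t. q t = (k t)\<^sup>2 + (l t)\<^sup>2"
      "\<And>t. \<tau> t = k t * a t + l t * d t" "\<And>t. \<beta> t = (a t)\<^sup>2 + 2 * (b t)\<^sup>2 + (d t)\<^sup>2"
      "\<And>t. \<rho> t = k t * ((a t)\<^sup>2 + (b t)\<^sup>2) + l t * ((b t)\<^sup>2 + (d t)\<^sup>2)"
    and k0: "k 0 \<ge> 0"
  shows "k 0 = 0" "a 0 = 0" "b 0 = 0"
proof -
  have rq: "r t = r 0" "q t = q 0" for t
    using DERIV_isconst_all[of r t 0] DERIV_isconst_all[of q t 0] r q by auto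
  have kl0: "k t = k 0" "l t = l 0" for t
  proof -
    \<comment> \<open>As \<open>k t \<ge> l t\<close>, the constant \<open>2 * q - r^2\<close>
      determines the difference of the eigenvalues, and \<open>r\<close> is their sum.\<close>
    have "(k t - l t)\<^sup>2 = 2 * q t - (r t)\<^sup>2" "(k 0 - l 0)\<^sup>2 = 2 * q 0 - (r 0)\<^sup>2"
      unfolding tr by (simp_all add: power2_eq_square algebra_simps)
    then have "(k t - l t)\<^sup>2 = (k 0 - l 0)\<^sup>2" unfolding rq[of t] by simp
    then have "k t - l t = k 0 - l 0" using kl[of t] kl[of 0] by (simp add: power2_eq_iff_nonneg)
    then show "k t = k 0" "l t = l 0" using rq(1)[of t] unfolding tr by auto
  qed
  have "k 0 = 0 \<and> a 0 = 0 \<and> b 0 = 0"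
  proof (cases "k 0 = l 0")
    case True
    \<comment> \<open>The factor 1/2 comes from \<open>(a + d)^2 \<le> 2 * (a^2 + d^2)\<close>; the
      curvature term \<open>r\<close> and the square of \<open>b\<close> are nonnegative and are
      dropped.\<close>
    have h: "- \<beta> t - r t \<le> - (1/2) * (\<theta> t)\<^sup>2" for t
    proof -
      have "(a t + d t)\<^sup>2 \<le> 2 * ((a t)\<^sup>2 + (d t)\<^sup>2)"
        using zero_le_power2[of "a t - d t"] by (simp add: power2_eq_square algebra_simps)
      moreover have "r t \<ge> 0" unfolding tr kl0[of t] using True k0 by simp
      moreover have "(b t)\<^sup>2 \<ge> 0" by simp
      ultimately show ?thesis unfolding tr(1,5) by argo
    qed
    have "- \<beta> 0 - r 0 = 0" by (rule riccati_inequality_zero(2)[OF \<theta> _ h]) simp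
    \<comment> \<open>The vanishing derivative at 0 is a sum of terms of one sign, so each of them
      is 0.\<close>
    then show ?thesis unfolding tr using True k0
      by (simp add: algebra_simps) (smt (verit) zero_le_power2 zero_eq_power2)
  next
    case False
    define D where "D = k 0 - l 0"
    have D: "D > 0" using False kl[of 0] unfolding D_def by simp
    \<comment> \<open>The combination \<open>\<tau> - l * \<theta>\<close> equals
      \<open>(k - l) * a\<close>: it eliminates \<open>d\<close> and isolates the entry of the
      larger eigenvalue.\<close>
    define h where "h t = (\<tau> t - l 0 * \<theta> t) / D" for t
    define h' where "h' t = ((- \<rho> t - q t) - l 0 * (- \<beta> t - r t)) / D" for t
    have dh: "(h has_real_derivative h' t) (at t)" for t
      unfolding h_def h'_def by (rule DERIV_cdivide[OF DERIV_diff[OF \<tau> DERIV_cmult[OF \<theta>]]])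
    have "h t = D * a t / D" for t
      unfolding h_def tr kl0[of t] D_def by (simp add: algebra_simps)
    then have h: "h t = a t" for t using D by simp
    have "h' t = D * (- ((a t)\<^sup>2 + (b t)\<^sup>2) - k 0) / D" for t
      unfolding h'_def tr kl0[of t] D_def by (simp add: algebra_simps power2_eq_square)
    then have h': "h' t = - ((a t)\<^sup>2 + (b t)\<^sup>2) - k 0" for t using D by simp
    have "h' t \<le> - 1 * (h t)\<^sup>2" for t unfolding h h'
      using add_nonneg_nonneg[OF k0 zero_le_power2[of "b t"]] by simp
    \<comment> \<open>\<open>h 0 = 0\<close> yields \<open>a 0 = 0\<close>; in
      \<open>h' 0 = 0\<close> the nonnegative quantities \<open>k 0\<close> and
      \<open>(b 0)^2\<close> must then both vanish.\<close>
    from riccati_inequality_zero[OF dh _ this, of 0] have "h 0 = 0" "h' 0 = 0" by auto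
    then show ?thesis unfolding h h' using k0 by (smt (verit) zero_le_power2 zero_eq_power2)
  qed
  then show "k 0 = 0" "a 0 = 0" "b 0 = 0" by auto
qed

section \<open>Dimension three: maximal curvature and the rank of the shape operator\<close>

locale geodesic_manifold_3 = geodesic_manifold A g X
  for A :: "('a::{t2_space,second_countable_topology}, 3) chart set" and g X
begin

text \<open>Tying the scalars to chart-free traces makes data from different times and charts
  comparable.\<close>

definition eigenframe ::
    "('a, 3) chart \<Rightarrow> 'a \<Rightarrow> real^3 \<Rightarrow> real^3 \<Rightarrow> real \<Rightarrow> real \<Rightarrow> real \<Rightarrow> real \<Rightarrow> real \<Rightarrow> bool" where
  "eigenframe c p e f k l a b d \<longleftrightarrow> orthonormal_frame (MG c (crd c p)) (X p c) e f \<and> k \<ge> l \<and>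
    RM c p *v e = k *\<^sub>R e \<and> RM c p *v f = l *\<^sub>R f \<and> BM c p *v e = a *\<^sub>R e + b *\<^sub>R f \<and>
    tr_B p = a + d \<and> tr_R p = k + l \<and> tr_RR p = k\<^sup>2 + l\<^sup>2 \<and> tr_BR p = k * a + l * d \<and>
    tr_BB p = a\<^sup>2 + 2 * b\<^sup>2 + d\<^sup>2 \<and> tr_BBR p = k * (a\<^sup>2 + b\<^sup>2) + l * (b\<^sup>2 + d\<^sup>2)"

text \<open>Integrability provides the self-adjointness of \<open>BM\<close> that
  \<open>exists_eigenframe\<close> demands; that of \<open>RM\<close> is
  \<open>jac_self_adjoint\<close>.\<close>

lemma eigenframe_exists:
  assumes c: "c \<in> charts_at A p" and I: "integrable_at p"
  shows "\<exists>e f k l a b d. eigenframe c p e f k l a b d"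
proof -
  note cA = charts_atD[OF c]
  interpret geodesic_chart "crd c ` dom c" "MG c" "CX c" by (rule geodesic_chart[OF cA(1)])
  let ?x = "crd c p"
  have x: "?x \<in> crd c ` dom c" using cA by auto
  have sk: "skewM ?x = 0" using I integrable_at_iff[OF c] by simp
  show ?thesis
    unfolding eigenframe_def CX_crd[OF c, symmetric] invariant_traces[OF c]
  proof (rule exists_eigenframe[where M = "MG c ?x" and X = "CX c ?x" and B = "BM c p" and R = "RM c p"])
    show "u \<bullet> (MG c ?x *v v) = v \<bullet> (MG c ?x *v u)" for u v by (rule G_commute[OF x])
    show "v \<bullet> (MG c ?x *v v) > 0" if "v \<noteq> 0" for v by (rule pos_G[OF x that])
    show "CX c ?x \<bullet> (MG c ?x *v CX c ?x) = 1" by (rule unit_X[OF x])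
    show "BM c p *v CX c ?x = 0" "RM c p *v CX c ?x = 0"
      by (simp_all add: shapeM_works[OF x] jacM_works[OF x] shape_X[OF x] jac_X)
    show "CX c ?x \<bullet> (MG c ?x *v (BM c p *v v)) = 0" "CX c ?x \<bullet> (MG c ?x *v (RM c p *v v)) = 0" for v
      unfolding G_commute[OF x, of "CX c ?x"] shapeM_works[OF x] jacM_works[OF x]
      by (rule shape_orthogonal[OF x] jac_orthogonal[OF x])+
    show "u \<bullet> (MG c ?x *v (BM c p *v v)) = v \<bullet> (MG c ?x *v (BM c p *v u))" for u v
      using skewM_inner[OF x, of u v] unfolding sk shapeM_works[OF x] by simp
    show "u \<bullet> (MG c ?x *v (RM c p *v v)) = v \<bullet> (MG c ?x *v (RM c p *v u))" for u v
      unfolding jacM_works[OF x] by (rule jac_self_adjoint[OF x])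
  qed (intro exI conjI)
qed

text \<open>Choosing a chart and an eigenframe at every time makes \<open>k\<close>,
  \<open>l\<close>, \<open>a\<close>, \<open>b\<close>, \<open>d\<close> functions of time with no
  regularity of their own; \<open>riccati_traces\<close> only asks that the traces be
  differentiable.\<close>

lemma integrable_maximal_curvature:
  assumes par: "jacobi_parallel A g X" and comp: "complete_field A X" and I: "integrable_at p"
    and c: "c \<in> charts_at A p"
  obtains e f k l where "orthonormal_frame (MG c (crd c p)) (X p c) e f" "k \<ge> l"
    "RM c p *v e = k *\<^sub>R e" "RM c p *v f = l *\<^sub>R f" "k \<ge> 0 \<Longrightarrow> k = 0 \<and> BM c p *v e = 0"
proof -
  obtain \<gamma> where \<gamma>: "integral_curve A X \<gamma>" "\<gamma> 0 = p" using comp unfolding complete_field_def by blast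
  \<comment> \<open>At time 0 the given chart is kept, so that the frame obtained at
    \<open>p\<close> is expressed in \<open>c\<close>.\<close>
  define ch where "ch t = (if t = 0 then c else SOME c. c \<in> charts_at A (\<gamma> t))" for t :: real
  have ch: "ch t \<in> charts_at A (\<gamma> t)" for t
  proof -
    obtain d where "d \<in> charts_at A (\<gamma> t)" by (rule chart_exists)
    then have "(SOME c. c \<in> charts_at A (\<gamma> t)) \<in> charts_at A (\<gamma> t)" by (rule someI)
    then show ?thesis unfolding ch_def using c \<gamma>(2) by simp
  qed
  have "integrable_at (\<gamma> t)" for t by (rule integrable_along_flow[OF \<gamma>(1), of 0]) (simp add: \<gamma>(2) I)
  then have "\<forall>t. \<exists>e f k l a b d. eigenframe (ch t) (\<gamma> t) e f k l a b d"
    using eigenframe_exists[OF ch] by blast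
  then obtain e f k l a b d where E: "\<And>t. eigenframe (ch t) (\<gamma> t) (e t) (f t) (k t) (l t) (a t) (b t) (d t)"
    by metis
  have tr: "k t \<ge> l t" "tr_B (\<gamma> t) = a t + d t" "tr_R (\<gamma> t) = k t + l t" "tr_RR (\<gamma> t) = (k t)\<^sup>2 + (l t)\<^sup>2"
    "tr_BR (\<gamma> t) = k t * a t + l t * d t" "tr_BB (\<gamma> t) = (a t)\<^sup>2 + 2 * (b t)\<^sup>2 + (d t)\<^sup>2"
    "tr_BBR (\<gamma> t) = k t * ((a t)\<^sup>2 + (b t)\<^sup>2) + l t * ((b t)\<^sup>2 + (d t)\<^sup>2)" for t
    using E[of t] unfolding eigenframe_def by blast+
  have "ch 0 = c" by (simp add: ch_def)
  with E[of 0] have F: "orthonormal_frame (MG c (crd c p)) (X p c) (e 0) (f 0)" "RM c p *v e 0 = k 0 *\<^sub>R e 0"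
    "RM c p *v f 0 = l 0 *\<^sub>R f 0" "BM c p *v e 0 = a 0 *\<^sub>R e 0 + b 0 *\<^sub>R f 0"
    unfolding eigenframe_def \<gamma>(2) by simp_all
  note ft = flow_traces[OF par \<gamma>(1)]
  note z = riccati_traces[OF ft(1,4,2,3) tr]
  show ?thesis
    by (rule that[OF F(1) tr(1) F(2,3)]) (use z F(4) in simp)
qed

lemma sectional_curvature_eigenframe:
  assumes c: "c \<in> charts_at A p" and "orthonormal_frame (MG c (crd c p)) (X p c) e f"
    and R: "RM c p *v e = k *\<^sub>R e" "RM c p *v f = l *\<^sub>R f"
    and v: "v \<in> tangent_space A p" "v c = s *\<^sub>R e + t *\<^sub>R f"
  shows "sectional_curvature A g p v (X p) = (k * s\<^sup>2 + l * t\<^sup>2) / (s\<^sup>2 + t\<^sup>2)"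
proof -
  interpret orthonormal_frame "MG c (crd c p)" "X p c" e f by fact
  note exp = matrix_vector_right_distrib matrix_vector_mult_scaleR inner_add_right inner_add_left
  have "g p (curvature A g p v (X p) (X p)) v = k * s\<^sup>2 + l * t\<^sup>2"
    unfolding metric_eq[OF c curvature_tangent[OF v(1)] v(1)] curvature_X[OF c] v(2)
    by (simp add: exp R e f ef orth' power2_eq_square algebra_simps)
  moreover have "g p v v = s\<^sup>2 + t\<^sup>2"
    unfolding metric_eq[OF c v(1) v(1)] v(2) by (simp add: exp e f ef orth' power2_eq_square)
  moreover have "g p v (X p) = 0"
    unfolding metric_eq[OF c v(1) X_tangent] v(2) by (simp add: exp orth')
  moreover have "g p (X p) (X p) = 1" using geodesic unfolding geodesic_field_def by simp
  ultimately show ?thesis unfolding sectional_curvature_def by simp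
qed

lemma orth_eigenframe:
  assumes c: "c \<in> charts_at A p" and "orthonormal_frame (MG c (crd c p)) (X p c) e f"
    and v: "v \<in> orth A g X p"
  obtains s t where "v c = s *\<^sub>R e + t *\<^sub>R f" "v = s *\<^sub>R tangent_of A c p e + t *\<^sub>R tangent_of A c p f"
proof -
  interpret orthonormal_frame "MG c (crd c p)" "X p c" e f by fact
  have v: "v \<in> tangent_space A p" "g p (X p) v = 0" using v unfolding orth_def by auto
  have "X p c \<bullet> (MG c (crd c p) *v v c) = 0"
    using v(2) unfolding metric_eq[OF c X_tangent v(1)] .
  then have "v c = (e \<bullet> (MG c (crd c p) *v v c)) *\<^sub>R e + (f \<bullet> (MG c (crd c p) *v v c)) *\<^sub>R f"
    using expansion[of "v c"] by simp
  then show ?thesis using that tangent_of_linear[OF c] tangent_of_eq[OF c v(1)] by metis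
qed

text \<open>Sectional curvatures are weighted means of \<open>k\<close> and \<open>l\<close>, and
  the frame vector \<open>e\<close> attains the larger one; so the \<open>GREATEST\<close> denotes a
  true maximum.\<close>

lemma maximal_sectional_curvature:
  assumes c: "c \<in> charts_at A p" and fr: "orthonormal_frame (MG c (crd c p)) (X p c) e f" and kl: "k \<ge> l"
    and R: "RM c p *v e = k *\<^sub>R e" "RM c p *v f = l *\<^sub>R f"
  shows "(GREATEST K. K \<in> (\<lambda>v. sectional_curvature A g p v (X p)) ` (orth A g X p - {0})) = k"
proof (rule Greatest_equality)
  interpret orthonormal_frame "MG c (crd c p)" "X p c" e f by (rule fr)
  let ?e = "tangent_of A c p e"
  have "g p (X p) ?e = 0"
    unfolding metric_eq[OF c X_tangent tangent_of_in[OF c]] tangent_of_self[OF c] by (rule Xe)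
  moreover have "?e \<noteq> 0" using tangent_of_self[OF c, of e] e by auto
  ultimately have "?e \<in> orth A g X p - {0}" unfolding orth_def using tangent_of_in[OF c] by simp
  moreover have "sectional_curvature A g p ?e (X p) = k"
    using sectional_curvature_eigenframe[OF c fr R tangent_of_in[OF c], of e 1 0] tangent_of_self[OF c] by simp
  ultimately show "k \<in> (\<lambda>v. sectional_curvature A g p v (X p)) ` (orth A g X p - {0})" by blast
next
  fix K assume "K \<in> (\<lambda>v. sectional_curvature A g p v (X p)) ` (orth A g X p - {0})"
  then obtain v where v: "v \<in> orth A g X p" "v \<noteq> 0" "K = sectional_curvature A g p v (X p)" by auto
  have vt: "v \<in> tangent_space A p" using v(1) unfolding orth_def by simp
  obtain s t where st: "v c = s *\<^sub>R e + t *\<^sub>R f" "v = s *\<^sub>R tangent_of A c p e + t *\<^sub>R tangent_of A c p f"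
    using orth_eigenframe[OF c fr v(1)] by metis
  have "s \<noteq> 0 \<or> t \<noteq> 0" using st(2) v(2) by auto
  then have "s\<^sup>2 + t\<^sup>2 > 0" by (simp add: sum_power2_gt_zero_iff)
  moreover have "k * s\<^sup>2 + l * t\<^sup>2 \<le> k * (s\<^sup>2 + t\<^sup>2)"
    using mult_right_mono[OF kl zero_le_power2[of t]] by (simp add: algebra_simps)
  ultimately show "K \<le> k"
    unfolding v(3) sectional_curvature_eigenframe[OF c fr R vt st(1)] by (simp add: divide_le_eq)
qed

text \<open>The value on \<open>f\<close> alone spans the image of \<beta>, whose dimension is
  therefore at most 1.\<close>

lemma rank_beta_kernel:
  assumes c: "c \<in> charts_at A p" and fr: "orthonormal_frame (MG c (crd c p)) (X p c) e f"
    and B: "BM c p *v e = 0"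
  shows "rank_beta A g X p \<noteq> 2"
proof -
  let ?F = "tangent_of A c p f"
  have "beta A g X p v \<in> span {beta A g X p ?F}" if "v \<in> orth A g X p" for v
  proof -
    obtain s t where st: "v = s *\<^sub>R tangent_of A c p e + t *\<^sub>R ?F"
      using orth_eigenframe[OF c fr \<open>v \<in> orth A g X p\<close>] by metis
    \<comment> \<open>Tangent vectors are families over charts, so the equation is checked in every
      chart, where \<open>P\<close> carries the kernel vector over from \<open>c\<close>.\<close>
    have "beta A g X p v d = (t *\<^sub>R beta A g X p ?F) d" for d
    proof (cases "d \<in> charts_at A p")
      case True
      obtain P where P: "\<And>v. P *v v = chart_change c d p v" "BM d p ** P = P ** BM c p"
        using matrix_transition[OF c True] by metis
      have "BM d p *v chart_change c d p e = 0"
        unfolding P(1)[symmetric] using P(2) B by (metis matrix_vector_mul_assoc matrix_vector_mult_0_right)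
      then show ?thesis
        unfolding beta_def nabla_X[OF True] scaleR_fun_def st
        by (simp add: tangent_of_apply[OF True] matrix_vector_right_distrib matrix_vector_mult_scaleR nabla_X[OF True])
    next
      case False
      then show ?thesis by (simp add: beta_def nabla_def scaleR_fun_def)
    qed
    then have "beta A g X p v = t *\<^sub>R beta A g X p ?F" by (rule ext)
    then show ?thesis by (simp add: span_base span_scale)
  qed
  then have "dim (beta A g X p ` orth A g X p) \<le> card {beta A g X p ?F}"
    by (intro dim_le_card) auto
  then show ?thesis unfolding rank_beta_def by simp
qed

end

theorem theorem6p1:
  fixes A :: "('a::{t2_space,second_countable_topology}, 3) chart set"
    and g :: "('a, 3) metric"
    and X :: "'a \<Rightarrow> ('a, 3) tvec"
  assumes "smooth_atlas A" and "riemannian_metric A g"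
    and "geodesic_field A g X" and "complete_field A X"
    and "jacobi_parallel A g X"
    and "\<And>p. (GREATEST k. k \<in> (\<lambda>v. sectional_curvature A g p v (X p)) ` (orth A g X p - {0})) > 0
           \<or> (GREATEST k. k \<in> (\<lambda>v. sectional_curvature A g p v (X p)) ` (orth A g X p - {0})) = 0
              \<and> rank_beta A g X p = 2"
  shows "induces_contact_structure A g X"
  unfolding induces_contact_structure_def contact_form_def
proof (intro allI ballI, rule ccontr)
  interpret geodesic_manifold_3 A g X
    using assms(1-3) by unfold_locales
  fix p c assume c: "c \<in> charts_at A p"
  assume "\<not> (\<exists>u\<in>tangent_space A p. \<exists>v\<in>tangent_space A p. \<exists>w\<in>tangent_space A p.
    wedge_ext_deriv A c (\<lambda>p v. g p (X p) v) p u v w \<noteq> 0)"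
  then have I: "integrable_at p" by (intro wedge_zero_imp_integrable[OF c]) blast
  obtain e f k l where F: "orthonormal_frame (MG c (crd c p)) (X p c) e f" "k \<ge> l"
    "RM c p *v e = k *\<^sub>R e" "RM c p *v f = l *\<^sub>R f" "k \<ge> 0 \<Longrightarrow> k = 0 \<and> BM c p *v e = 0"
    using integrable_maximal_curvature[OF assms(5,4) I c] by metis
  show False
    using assms(6)[of p] rank_beta_kernel[OF c F(1)] F(5)
    unfolding maximal_sectional_curvature[OF c F(1-4)] by force
qed

end
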